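(* Let $\Omega\subset\mathbb{R}^d$ ($d\ge 1$) be a bounded domain with smooth boundary, and let $f$ and $h$ satisfy Conditions (I-1), (I-2) and (I-3) stated in the context; in particular $p\ge0$ is the growth exponent in (I-1). Let $u_0\in H^2(\Omega)\cap H^1_0(\Omega)$, $u_1\in H^1_0(\Omega)$, let $u\in W^{1,\infty}_{\mathrm{loc}}(\mathbb{R}^+,H^1_0(\Omega))\cap W^{2,\infty}_{\mathrm{loc}}(\mathbb{R}^+,L^2(\Omega))$ be a solution of $$\begin{cases}u_{tt}-\Delta u+h(t)u_t+f(u)=0, & (t,x)\in\mathbb{R}^+\times\Omega,\\ u=0, & (t,x)\in\mathbb{R}^+\times\partial\Omega,\\ (u(0,x),u_t(0,x))=(u_0(x),u_1(x)), & x\in\Omega,\end{cases}$$ and let $\psi\in S$, where $S=\{\psi\in H^2(\Omega)\cap H^1_0(\Omega): -\Delta\psi+f(\psi)=0\}$. Put $q=\frac{2-p}{2(1+p)}$. Then there exist constants $c>0$, $T>0$, $\theta\in(0,\frac12]$ and $\beta>0$, depending on $\psi$, such that for every $t\ge T$ with $\|u(t,\cdot)-\psi\|_{H^{1-q}(\Omega)}<\beta$ one has $$\|G(u(t,\cdot))\|_{H^{-1}}\ge c\,|E_0(u(t,\cdot))-E_0(\psi)|^{1-\theta},$$ where $G(v)=-\Delta v+f(v)$ and $E_0(v)=\frac12\|\nabla v\|_{L^2}^2+\int_\Omega F(v)\,dx$ with $F(s)=\int_0^s f(t)\,dt$.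
   Context: $\mathbb{R}^+=[0,\infty)$; $H^{s}(\Omega)$ denotes the (fractional) Sobolev space. The conditions are as follows. (I-1) $f\in W^{1,\infty}_{\mathrm{loc}}(\mathbb{R})$ satisfies $\liminf_{|s|\to+\infty}\frac{f(s)}{s}\ge-\mu_1$, where the constant $\mu_1$ satisfies $\mu_1<\mu_0$ and $\mu_0$ is the first eigenvalue of $-\Delta$ in $\Omega$ with zero Dirichlet boundary condition; and $|f'(s)|\le C(1+|s|^p)$ for $s\in\mathbb{R}$, where $C>0$ and $p\ge 0$ are constants with $(d-2)p<2$. (I-2) With $G$, $E_0$, $F$, $S$ as in the claim, there exists a number $\theta\in(0,\frac12]$ such that for each $\psi\in S$ there are constants $c_\psi>0$ and $\sigma_\psi>0$, depending on $\psi$, with $$\|G(v)\|_{H^{-1}}\ge c_\psi|E_0(v)-E_0(\psi)|^{1-\theta}\quad\text{whenever } v\in H^1_0(\Omega),\ \|v-\psi\|_{H^1}\le\sigma_\psi.$$ (I-3) $h\in W^{1,\infty}_{\mathrm{loc}}(\mathbb{R}^+)$ is a nonnegative function, and there exist constants $c,C>0$ and $\alpha\in[0,\theta(1-\theta)^{-1})$ (with $\theta$ from (I-2)) such that either $\frac{c}{(t+1)^\alpha}\le h(t)\le\frac{C}{(t+1)^\alpha}$ for all $t\ge 0$, or $c\,t^\alpha\le h(t)\le C\,t^\alpha$ for all $t\ge 0$. *)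

theory Defs
  imports "HOL-Analysis.Analysis"
begin

text \<open>
  Elements of function spaces over \<open>\<Omega>\<close> are represented by ordinary functions \<open>'a \<Rightarrow> real\<close>; only
  their values on \<open>\<Omega>\<close>, up to null sets, matter. The dimension \<open>d\<close> is \<open>DIM('a)\<close>.
\<close>

section \<open>Smooth functions and smooth bounded domains\<close>

definition partial :: "'a::euclidean_space \<Rightarrow> ('a \<Rightarrow> real) \<Rightarrow> 'a \<Rightarrow> real" where
  "partial b f x = frechet_derivative f (at x) b"

primrec C_k :: "nat \<Rightarrow> ('a::euclidean_space \<Rightarrow> real) \<Rightarrow> bool" where
  "C_k 0 f \<longleftrightarrow> continuous_on UNIV f"
| "C_k (Suc k) f \<longleftrightarrow> (\<forall>x. f differentiable (at x)) \<and> (\<forall>b\<in>Basis. C_k k (partial b f))"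

definition smooth :: "('a::euclidean_space \<Rightarrow> real) \<Rightarrow> bool" where
  "smooth f \<longleftrightarrow> (\<forall>k. C_k k f)"

definition test_functions :: "'a::euclidean_space set \<Rightarrow> ('a \<Rightarrow> real) set" where
  "test_functions \<Omega> =
     {\<phi>. smooth \<phi> \<and> compact (closure {x. \<phi> x \<noteq> 0}) \<and> closure {x. \<phi> x \<noteq> 0} \<subseteq> \<Omega>}"

text \<open>
  Near each boundary point, \<open>\<Omega>\<close> is the region strictly above the graph of a smooth function over
  the hyperplane orthogonal to a unit vector \<open>e\<close>. The function \<open>\<gamma>\<close> is evaluated on that hyperplane
  only.
\<close>

definition smooth_boundary :: "'a::euclidean_space set \<Rightarrow> bool" where
  "smooth_boundary \<Omega> \<longleftrightarrow>
     (\<forall>x\<in>frontier \<Omega>. \<exists>r>0. \<exists>e \<gamma>. norm e = 1 \<and> smooth \<gamma> \<and>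
        \<Omega> \<inter> ball x r = {y \<in> ball x r. y \<bullet> e > \<gamma> (y - (y \<bullet> e) *\<^sub>R e)})"

definition smooth_bounded_domain :: "'a::euclidean_space set \<Rightarrow> bool" where
  "smooth_bounded_domain \<Omega> \<longleftrightarrow>
     open \<Omega> \<and> connected \<Omega> \<and> \<Omega> \<noteq> {} \<and> bounded \<Omega> \<and> smooth_boundary \<Omega>"

section \<open>Weak derivatives and Sobolev spaces\<close>

definition locally_integrable :: "'a::euclidean_space set \<Rightarrow> ('a \<Rightarrow> real) \<Rightarrow> bool" where
  "locally_integrable \<Omega> f \<longleftrightarrow> (\<forall>K. compact K \<and> K \<subseteq> \<Omega> \<longrightarrow> integrable (lebesgue_on K) f)"

definition has_weak_partial ::
    "'a::euclidean_space set \<Rightarrow> 'a \<Rightarrow> ('a \<Rightarrow> real) \<Rightarrow> ('a \<Rightarrow> real) \<Rightarrow> bool" where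
  "has_weak_partial \<Omega> b f g \<longleftrightarrow>
     locally_integrable \<Omega> f \<and> locally_integrable \<Omega> g \<and>
     (\<forall>\<phi>\<in>test_functions \<Omega>.
        (LINT x|lebesgue_on \<Omega>. f x * partial b \<phi> x) = - (LINT x|lebesgue_on \<Omega>. g x * \<phi> x))"

text \<open>Weak derivatives are unique up to null sets; this picks a representative.\<close>

definition weak_partial :: "'a::euclidean_space set \<Rightarrow> 'a \<Rightarrow> ('a \<Rightarrow> real) \<Rightarrow> 'a \<Rightarrow> real" where
  "weak_partial \<Omega> b f = (SOME g. has_weak_partial \<Omega> b f g)"

definition L2 :: "'a::euclidean_space set \<Rightarrow> ('a \<Rightarrow> real) set" where
  "L2 \<Omega> = {f. f \<in> borel_measurable (lebesgue_on \<Omega>) \<and> integrable (lebesgue_on \<Omega>) (\<lambda>x. (f x)\<^sup>2)}"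

definition L2_inner :: "'a::euclidean_space set \<Rightarrow> ('a \<Rightarrow> real) \<Rightarrow> ('a \<Rightarrow> real) \<Rightarrow> real" where
  "L2_inner \<Omega> v w = (LINT x|lebesgue_on \<Omega>. v x * w x)"

definition L2_norm :: "'a::euclidean_space set \<Rightarrow> ('a \<Rightarrow> real) \<Rightarrow> real" where
  "L2_norm \<Omega> v = sqrt (L2_inner \<Omega> v v)"

text \<open>\<open>H_k \<Omega> k\<close> is the integer order space $H^k(\Omega)$.\<close>

primrec H_k :: "'a::euclidean_space set \<Rightarrow> nat \<Rightarrow> ('a \<Rightarrow> real) set" where
  "H_k \<Omega> 0 = L2 \<Omega>"
| "H_k \<Omega> (Suc k) = {f \<in> L2 \<Omega>. \<forall>b\<in>Basis. \<exists>g\<in>H_k \<Omega> k. has_weak_partial \<Omega> b f g}"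

definition grad_inner :: "'a::euclidean_space set \<Rightarrow> ('a \<Rightarrow> real) \<Rightarrow> ('a \<Rightarrow> real) \<Rightarrow> real" where
  "grad_inner \<Omega> v w = (\<Sum>b\<in>Basis. L2_inner \<Omega> (weak_partial \<Omega> b v) (weak_partial \<Omega> b w))"

definition H1_norm :: "'a::euclidean_space set \<Rightarrow> ('a \<Rightarrow> real) \<Rightarrow> real" where
  "H1_norm \<Omega> v = sqrt (L2_inner \<Omega> v v + grad_inner \<Omega> v v)"

definition H10 :: "'a::euclidean_space set \<Rightarrow> ('a \<Rightarrow> real) set" where
  "H10 \<Omega> = {v \<in> H_k \<Omega> 1. \<forall>\<epsilon>>0. \<exists>\<phi>\<in>test_functions \<Omega>. H1_norm \<Omega> (\<lambda>x. v x - \<phi> x) < \<epsilon>}"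

text \<open>Elements of $H^{-1}(\Omega)$ are linear functionals on $H^1_0(\Omega)$, with the dual norm.\<close>

definition Hm1_norm :: "'a::euclidean_space set \<Rightarrow> (('a \<Rightarrow> real) \<Rightarrow> real) \<Rightarrow> real" where
  "Hm1_norm \<Omega> L = (SUP w\<in>{w \<in> H10 \<Omega>. H1_norm \<Omega> w \<le> 1}. \<bar>L w\<bar>)"

text \<open>
  Sobolev--Slobodeckij norms: for $s = k + \sigma$ with $k = \lfloor s\rfloor$ the Gagliardo
  seminorm of order $\sigma$ is applied to the weak derivatives of order $k$ (no seminorm if
  $\sigma = 0$). Meaningful for $s \ge 0$; the norm is infinite outside $H^s(\Omega)$.
\<close>

definition gagliardo_sq ::
    "'a::euclidean_space set \<Rightarrow> real \<Rightarrow> ('a \<Rightarrow> real) \<Rightarrow> ennreal" where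
  "gagliardo_sq \<Omega> \<sigma> f =
     (if \<sigma> = 0 then 0
      else (\<integral>\<^sup>+x. (\<integral>\<^sup>+y. ennreal ((f x - f y)\<^sup>2 / norm (x - y) powr (real DIM('a) + 2 * \<sigma>))
              \<partial>lebesgue_on \<Omega>) \<partial>lebesgue_on \<Omega>))"

primrec slobodeckij_sq ::
    "'a::euclidean_space set \<Rightarrow> nat \<Rightarrow> real \<Rightarrow> ('a \<Rightarrow> real) \<Rightarrow> ennreal" where
  "slobodeckij_sq \<Omega> 0 \<sigma> f =
     (\<integral>\<^sup>+x. ennreal ((f x)\<^sup>2) \<partial>lebesgue_on \<Omega>) + gagliardo_sq \<Omega> \<sigma> f"
| "slobodeckij_sq \<Omega> (Suc k) \<sigma> f =
     (\<integral>\<^sup>+x. ennreal ((f x)\<^sup>2) \<partial>lebesgue_on \<Omega>)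
       + (\<Sum>b\<in>Basis. slobodeckij_sq \<Omega> k \<sigma> (weak_partial \<Omega> b f))"

definition Hs_norm :: "'a::euclidean_space set \<Rightarrow> real \<Rightarrow> ('a \<Rightarrow> real) \<Rightarrow> ennreal" where
  "Hs_norm \<Omega> s f =
     (let k = nat \<lfloor>s\<rfloor>; N = slobodeckij_sq \<Omega> k (s - real k) f
      in if f \<in> H_k \<Omega> k \<and> N < \<infinity> then ennreal (sqrt (enn2real N)) else \<infinity>)"

section \<open>Local Sobolev spaces in one variable\<close>

definition Linf_loc :: "real set \<Rightarrow> (real \<Rightarrow> real) set" where
  "Linf_loc I = {g \<in> borel_measurable (lebesgue_on I).
     \<forall>K. compact K \<and> K \<subseteq> I \<longrightarrow> (\<exists>M. AE t in lebesgue_on K. \<bar>g t\<bar> \<le> M)}"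

text \<open>$W^{1,\infty}_{\mathrm{loc}}(I)$ for scalar functions, with the continuous representative.\<close>

definition W1inf_loc :: "real set \<Rightarrow> (real \<Rightarrow> real) set" where
  "W1inf_loc I = {g. continuous_on I g \<and> g \<in> Linf_loc I \<and>
     (\<exists>g'\<in>Linf_loc I. has_weak_partial (interior I) 1 g g')}"

section \<open>Functions of time with values in a function space\<close>

text \<open>
  A (semi)normed function space is given by a carrier \<open>X\<close> and a norm \<open>N\<close>. Strong measurability
  and the Bochner integral are the usual ones, via simple functions: a simple function is given
  by a list of pairs of a set of finite measure and a vector.
\<close>

definition simple_data :: "('a \<Rightarrow> real) set \<Rightarrow> real set \<Rightarrow> (real set \<times> ('a \<Rightarrow> real)) list \<Rightarrow> bool"
  where
  "simple_data X I s \<longleftrightarrow> (\<forall>(E, w)\<in>set s. E \<in> lmeasurable \<and> E \<subseteq> I \<and> w \<in> X)"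

definition simple_fun :: "(real set \<times> ('a \<Rightarrow> real)) list \<Rightarrow> real \<Rightarrow> 'a \<Rightarrow> real" where
  "simple_fun s t x = (\<Sum>(E, w)\<leftarrow>s. indicator E t * w x)"

definition simple_int :: "(real set \<times> ('a \<Rightarrow> real)) list \<Rightarrow> 'a \<Rightarrow> real" where
  "simple_int s x = (\<Sum>(E, w)\<leftarrow>s. measure lebesgue E * w x)"

definition strongly_measurable ::
    "('a \<Rightarrow> real) set \<Rightarrow> (('a \<Rightarrow> real) \<Rightarrow> real) \<Rightarrow> real set \<Rightarrow> (real \<Rightarrow> 'a \<Rightarrow> real) \<Rightarrow> bool" where
  "strongly_measurable X N I v \<longleftrightarrow>
     (AE t in lebesgue_on I. v t \<in> X) \<and>
     (\<exists>s. (\<forall>n. simple_data X I (s n)) \<and>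
        (AE t in lebesgue_on I. (\<lambda>n. N (\<lambda>x. simple_fun (s n) t x - v t x)) \<longlonglongrightarrow> 0))"

definition has_vector_integral ::
    "('a \<Rightarrow> real) set \<Rightarrow> (('a \<Rightarrow> real) \<Rightarrow> real) \<Rightarrow> real set \<Rightarrow> (real \<Rightarrow> 'a \<Rightarrow> real) \<Rightarrow>
       ('a \<Rightarrow> real) \<Rightarrow> bool" where
  "has_vector_integral X N I v y \<longleftrightarrow>
     strongly_measurable X N I v \<and> y \<in> X \<and>
     (\<exists>s. (\<forall>n. simple_data X I (s n)) \<and>
        (\<lambda>n. \<integral>\<^sup>+t. ennreal (N (\<lambda>x. simple_fun (s n) t x - v t x)) \<partial>lebesgue_on I) \<longlonglongrightarrow> 0 \<and>
        (\<lambda>n. N (\<lambda>x. simple_int (s n) x - y x)) \<longlonglongrightarrow> 0)"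

definition has_weak_time_derivative ::
    "('a \<Rightarrow> real) set \<Rightarrow> (('a \<Rightarrow> real) \<Rightarrow> real) \<Rightarrow> real set \<Rightarrow> (real \<Rightarrow> 'a \<Rightarrow> real) \<Rightarrow>
       (real \<Rightarrow> 'a \<Rightarrow> real) \<Rightarrow> bool" where
  "has_weak_time_derivative X N I v v' \<longleftrightarrow>
     (\<forall>\<eta>\<in>test_functions (interior I). \<exists>y.
        has_vector_integral X N I (\<lambda>t x. partial 1 \<eta> t * v t x) y \<and>
        has_vector_integral X N I (\<lambda>t x. \<eta> t * v' t x) (\<lambda>x. - y x))"

definition vLinf_loc ::
    "('a \<Rightarrow> real) set \<Rightarrow> (('a \<Rightarrow> real) \<Rightarrow> real) \<Rightarrow> real set \<Rightarrow> (real \<Rightarrow> 'a \<Rightarrow> real) set" where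
  "vLinf_loc X N I = {v. strongly_measurable X N I v \<and>
     (\<forall>K. compact K \<and> K \<subseteq> I \<longrightarrow> (\<exists>M. AE t in lebesgue_on K. N (v t) \<le> M))}"

text \<open>\<open>vWinf_loc X N I m\<close> is $W^{m,\infty}_{\mathrm{loc}}(I, X)$.\<close>

primrec vWinf_loc ::
    "('a \<Rightarrow> real) set \<Rightarrow> (('a \<Rightarrow> real) \<Rightarrow> real) \<Rightarrow> real set \<Rightarrow> nat \<Rightarrow> (real \<Rightarrow> 'a \<Rightarrow> real) set" where
  "vWinf_loc X N I 0 = vLinf_loc X N I"
| "vWinf_loc X N I (Suc m) = {v \<in> vLinf_loc X N I.
     \<exists>v'\<in>vWinf_loc X N I m. has_weak_time_derivative X N I v v'}"

definition continuous_into ::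
    "('a \<Rightarrow> real) set \<Rightarrow> (('a \<Rightarrow> real) \<Rightarrow> real) \<Rightarrow> real set \<Rightarrow> (real \<Rightarrow> 'a \<Rightarrow> real) \<Rightarrow> bool" where
  "continuous_into X N I v \<longleftrightarrow>
     (\<forall>t\<in>I. v t \<in> X \<and> ((\<lambda>s. N (\<lambda>x. v s x - v t x)) \<longlongrightarrow> 0) (at t within I))"

section \<open>The energy, its gradient, and the equilibria\<close>

definition antideriv :: "(real \<Rightarrow> real) \<Rightarrow> real \<Rightarrow> real" where
  "antideriv f s = (LBINT t=0..s. f t)"

definition E0 :: "'a::euclidean_space set \<Rightarrow> (real \<Rightarrow> real) \<Rightarrow> ('a \<Rightarrow> real) \<Rightarrow> real" where
  "E0 \<Omega> f v = 1/2 * grad_inner \<Omega> v v + (LINT x|lebesgue_on \<Omega>. antideriv f (v x))"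

text \<open>
  $G(v) = -\Delta v + f(v)$ as an element of $H^{-1}(\Omega)$, where $-\Delta v$ for
  $v \in H^1_0(\Omega)$ is the functional $w \mapsto \int_\Omega \nabla v\cdot\nabla w$.
\<close>

definition G :: "'a::euclidean_space set \<Rightarrow> (real \<Rightarrow> real) \<Rightarrow> ('a \<Rightarrow> real) \<Rightarrow> ('a \<Rightarrow> real) \<Rightarrow> real" where
  "G \<Omega> f v w = grad_inner \<Omega> v w + L2_inner \<Omega> (\<lambda>x. f (v x)) w"

definition laplacian :: "'a::euclidean_space set \<Rightarrow> ('a \<Rightarrow> real) \<Rightarrow> 'a \<Rightarrow> real" where
  "laplacian \<Omega> v x = (\<Sum>b\<in>Basis. weak_partial \<Omega> b (weak_partial \<Omega> b v) x)"

definition equilibria :: "'a::euclidean_space set \<Rightarrow> (real \<Rightarrow> real) \<Rightarrow> ('a \<Rightarrow> real) set" where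
  "equilibria \<Omega> f = {\<psi> \<in> H_k \<Omega> 2 \<inter> H10 \<Omega>.
     AE x in lebesgue_on \<Omega>. - laplacian \<Omega> \<psi> x + f (\<psi> x) = 0}"

section \<open>Structural conditions\<close>

definition dirichlet_eigenvalue :: "'a::euclidean_space set \<Rightarrow> real \<Rightarrow> bool" where
  "dirichlet_eigenvalue \<Omega> \<mu> \<longleftrightarrow>
     (\<exists>\<phi>\<in>H10 \<Omega>. \<not> (AE x in lebesgue_on \<Omega>. \<phi> x = 0) \<and>
        (\<forall>w\<in>H10 \<Omega>. grad_inner \<Omega> \<phi> w = \<mu> * L2_inner \<Omega> \<phi> w))"

definition first_dirichlet_eigenvalue :: "'a::euclidean_space set \<Rightarrow> real" where
  "first_dirichlet_eigenvalue \<Omega> = (LEAST \<mu>. dirichlet_eigenvalue \<Omega> \<mu>)"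

text \<open>Powers of nonnegative reals with $x^0 = 1$ also at $x = 0$, where \<open>0 powr 0 = 0\<close>.\<close>

definition rpow :: "real \<Rightarrow> real \<Rightarrow> real" where
  "rpow x a = (if a = 0 then 1 else x powr a)"

definition nonlinearity_condition ::
    "'a::euclidean_space set \<Rightarrow> real \<Rightarrow> (real \<Rightarrow> real) \<Rightarrow> bool" where
  "nonlinearity_condition \<Omega> p f \<longleftrightarrow>
     f \<in> W1inf_loc UNIV \<and>
     (\<exists>\<mu>\<^sub>1 < first_dirichlet_eigenvalue \<Omega>. Liminf at_infinity (\<lambda>s. ereal (f s / s)) \<ge> ereal (- \<mu>\<^sub>1)) \<and>
     p \<ge> 0 \<and> (real DIM('a) - 2) * p < 2 \<and>
     (\<exists>C>0. \<exists>f'\<in>Linf_loc UNIV. has_weak_partial UNIV 1 f f' \<and>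
        (AE s in lebesgue. \<bar>f' s\<bar> \<le> C * (1 + rpow \<bar>s\<bar> p)))"

definition lojasiewicz_condition ::
    "'a::euclidean_space set \<Rightarrow> (real \<Rightarrow> real) \<Rightarrow> real \<Rightarrow> bool" where
  "lojasiewicz_condition \<Omega> f \<theta> \<longleftrightarrow>
     0 < \<theta> \<and> \<theta> \<le> 1/2 \<and>
     (\<forall>\<psi>\<in>equilibria \<Omega> f. \<exists>c>0. \<exists>\<sigma>>0. \<forall>v\<in>H10 \<Omega>. H1_norm \<Omega> (\<lambda>x. v x - \<psi> x) \<le> \<sigma> \<longrightarrow>
        Hm1_norm \<Omega> (G \<Omega> f v) \<ge> c * \<bar>E0 \<Omega> f v - E0 \<Omega> f \<psi>\<bar> powr (1 - \<theta>))"

definition damping_condition :: "real \<Rightarrow> (real \<Rightarrow> real) \<Rightarrow> bool" where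
  "damping_condition \<theta> h \<longleftrightarrow>
     h \<in> W1inf_loc {0..} \<and> (\<forall>t\<ge>0. h t \<ge> 0) \<and>
     (\<exists>c>0. \<exists>C>0. \<exists>\<alpha>\<ge>0. \<alpha> < \<theta> / (1 - \<theta>) \<and>
        ((\<forall>t\<ge>0. c / rpow (t + 1) \<alpha> \<le> h t \<and> h t \<le> C / rpow (t + 1) \<alpha>) \<or>
         (\<forall>t\<ge>0. c * rpow t \<alpha> \<le> h t \<and> h t \<le> C * rpow t \<alpha>)))"

section \<open>The damped wave equation\<close>

text \<open>
  The regularity class $W^{1,\infty}_{\mathrm{loc}}(\mathbb{R}^+,H^1_0(\Omega)) \cap
  W^{2,\infty}_{\mathrm{loc}}(\mathbb{R}^+,L^2(\Omega))$. Its elements have representatives that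
  are continuous into $H^1_0(\Omega)$; \<open>u\<close> is required to be this one, so that \<open>u t\<close> is
  meaningful for every single \<open>t\<close>.
\<close>

definition solution_class :: "'a::euclidean_space set \<Rightarrow> (real \<Rightarrow> 'a \<Rightarrow> real) set" where
  "solution_class \<Omega> =
     {u \<in> vWinf_loc (H10 \<Omega>) (H1_norm \<Omega>) {0..} 1 \<inter> vWinf_loc (L2 \<Omega>) (L2_norm \<Omega>) {0..} 2.
        continuous_into (H10 \<Omega>) (H1_norm \<Omega>) {0..} u}"

text \<open>
  The equation holds in $H^{-1}(\Omega)$ for almost every \<open>t\<close>; the boundary condition is
  \<open>u t \<in> H10 \<Omega>\<close>; \<open>ut\<close> is the representative of the time derivative that is continuous into
  $L^2(\Omega)$, which gives a meaning to the second initial condition.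
\<close>

definition solves_damped_wave ::
    "'a::euclidean_space set \<Rightarrow> (real \<Rightarrow> real) \<Rightarrow> (real \<Rightarrow> real) \<Rightarrow> ('a \<Rightarrow> real) \<Rightarrow> ('a \<Rightarrow> real) \<Rightarrow>
       (real \<Rightarrow> 'a \<Rightarrow> real) \<Rightarrow> bool" where
  "solves_damped_wave \<Omega> f h u\<^sub>0 u\<^sub>1 u \<longleftrightarrow>
     (\<forall>t\<ge>0. u t \<in> H10 \<Omega>) \<and>
     (\<exists>ut utt.
        has_weak_time_derivative (L2 \<Omega>) (L2_norm \<Omega>) {0..} u ut \<and>
        has_weak_time_derivative (L2 \<Omega>) (L2_norm \<Omega>) {0..} ut utt \<and>
        continuous_into (L2 \<Omega>) (L2_norm \<Omega>) {0..} ut \<and>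
        (AE t in lebesgue_on {0..}. \<forall>w\<in>H10 \<Omega>.
           L2_inner \<Omega> (utt t) w + h t * L2_inner \<Omega> (ut t) w + G \<Omega> f (u t) w = 0) \<and>
        (AE x in lebesgue_on \<Omega>. u 0 x = u\<^sub>0 x) \<and>
        (AE x in lebesgue_on \<Omega>. ut 0 x = u\<^sub>1 x))"

end

(*
Only the smallness of w = u(t) - \<psi> in L^2 is used. For t \<ge> 1 the energy |u_t|^2/2 + E_0(u) does not
increase. Condition (I-1) bounds F below by a quadratic, so E_0(u(t)) controls the gradient once the L^2
norm is bounded; neither \<mu>_0 nor compactness is needed, and u(t) stays in a fixed H^1 ball at
all times considered. If |w|_{H^1} is at most the radius \<sigma> of (I-2), then (I-2) applies. Otherwise
testing G(u) = G(u) - G(\<psi>) with w gives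
|G(u)|_{H^{-1}} \<ge> |w|_{H^1} - C |w|_{L^2} \<ge> \<sigma>/2, while E_0(u) - E_0(\<psi>) is bounded. The
estimate of f(u) - f(\<psi>) in L^2 rests on the subcritical embedding of H^1_0 into L^{2(p+1)}.

The energy inequality is obtained without regularising: u is locally Lipschitz into H^1_0 and u_t into
L^2, and testing the equation with u(t') - u(t) shows that the energy grows by at most C (t' - t)^2.
*)

theory Submission
  imports Defs
begin

section \<open>Smooth bump functions\<close>

text \<open>Time regularity is handled by duality. Vector-valued integrals and derivatives are
  tested against a fixed vector, which leaves scalar weak derivatives on the open half-line. For
  these the fundamental theorem is proved directly, and testing an increment with itself turns
  scalar bounds back into norm bounds. Since the half-line is open at 0, the time intervals start at
  1, which is also the \<open>T\<close> of the theorem; its exponent \<theta> is the one of (I-2).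

  The embedding comes from a bootstrap: an L^r bound on the unit ball of H^1 yields, through a
  translation estimate, a weak-type bound of exponent 2 + 2r/d. For d at least 3 the iteration
  stalls exactly at the critical exponent, and (d-2)p < 2 says that 2(p+1) lies below it.

  \<open>weak_partial\<close> is a choice, so identities between weak derivatives hold only almost
  everywhere and rest on a uniqueness theorem, for which explicit bump functions are built. The
  norms are seminorms on functions; many estimates therefore speak of some positive \<open>N\<close>
  above a norm rather than of the norm itself, which permits division by \<open>N\<close>.\<close>

lemma partial_eqI: "(f has_derivative D) (at x) \<Longrightarrow> partial b f x = D b"
  unfolding partial_def by (metis frechet_derivative_at)

lemma has_derivative_frechet:
  "f differentiable (at x) \<Longrightarrow> (f has_derivative frechet_derivative f (at x)) (at x)"
  using frechet_derivative_works by blast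

section \<open>Closure properties of smooth functions\<close>

lemma partial_add:
  assumes "f differentiable (at x)" "g differentiable (at x)"
  shows "partial b (\<lambda>x. f x + g x) x = partial b f x + partial b g x"
  using has_derivative_add[OF assms[THEN has_derivative_frechet]]
  by (simp add: partial_eqI partial_def[symmetric])

lemma partial_scale:
  assumes "f differentiable (at x)"
  shows "partial b (\<lambda>x. c * f x) x = c * partial b f x"
  using has_derivative_mult_right[OF assms[THEN has_derivative_frechet], of c]
  by (simp add: partial_eqI partial_def[symmetric])

lemma partial_mult:
  assumes "f differentiable (at x)" "g differentiable (at x)"
  shows "partial b (\<lambda>x. f x * g x) x = partial b f x * g x + f x * partial b g x"
  using has_derivative_mult[OF assms[THEN has_derivative_frechet]]
  by (simp add: partial_eqI partial_def[symmetric])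

lemma C_k_const: "C_k k (\<lambda>x::'a::euclidean_space. c)"
proof (induction k arbitrary: c)
  case (Suc k)
  have "partial b (\<lambda>x::'a. c) = (\<lambda>x. 0)" for b
    by (rule ext, rule partial_eqI[where D = "\<lambda>_. 0"]) simp
  then show ?case using Suc by simp
qed simp

lemma C_k_add: "C_k k f \<Longrightarrow> C_k k g \<Longrightarrow> C_k k (\<lambda>x. f x + g x)"
proof (induction k arbitrary: f g)
  case 0
  then show ?case by (auto intro: continuous_intros)
next
  case (Suc k)
  have "partial b (\<lambda>x. f x + g x) = (\<lambda>x. partial b f x + partial b g x)" for b
    using Suc.prems by (intro ext partial_add) auto
  then show ?case using Suc by auto
qed

lemma C_k_scale: "C_k k f \<Longrightarrow> C_k k (\<lambda>x. c * f x)"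
proof (induction k arbitrary: f)
  case 0
  then show ?case by (auto intro: continuous_intros)
next
  case (Suc k)
  have "partial b (\<lambda>x. c * f x) = (\<lambda>x. c * partial b f x)" for b
    using Suc.prems by (intro ext partial_scale) auto
  then show ?case using Suc by auto
qed

lemma smooth_const: "smooth (\<lambda>x. c)"
  by (simp add: smooth_def C_k_const)

lemma smooth_add: "smooth f \<Longrightarrow> smooth g \<Longrightarrow> smooth (\<lambda>x. f x + g x)"
  by (simp add: smooth_def C_k_add)

lemma smooth_scale: "smooth f \<Longrightarrow> smooth (\<lambda>x. c * f x)"
  by (simp add: smooth_def C_k_scale)

lemma smooth_differentiable: "smooth f \<Longrightarrow> f differentiable (at x)"
  unfolding smooth_def by (metis C_k.simps(2))

lemma smooth_partial: "smooth f \<Longrightarrow> b \<in> Basis \<Longrightarrow> smooth (partial b f)"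
  unfolding smooth_def by (metis C_k.simps(2))

lemma smooth_continuous: "smooth f \<Longrightarrow> continuous_on S f"
  unfolding smooth_def by (metis C_k.simps(1) continuous_on_subset subset_UNIV)

text \<open>Leibniz' rule pairs a derivative of one factor with the other factor undifferentiated.
  Assuming full smoothness makes both products instances of the induction hypothesis, without
  monotonicity of \<open>C_k\<close> in the order.\<close>

lemma C_k_mult: "smooth f \<Longrightarrow> smooth g \<Longrightarrow> C_k k (\<lambda>x. f x * g x)"
proof (induction k arbitrary: f g)
  case 0
  then show ?case by (auto intro: continuous_intros smooth_continuous)
next
  case (Suc k)
  have "partial b (\<lambda>x. f x * g x) = (\<lambda>x. partial b f x * g x + f x * partial b g x)" for b
    using Suc.prems by (intro ext partial_mult smooth_differentiable)
  then show ?case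
    using Suc by (auto intro!: C_k_add Suc.IH smooth_partial simp: smooth_differentiable)
qed

lemma smooth_mult: "smooth f \<Longrightarrow> smooth g \<Longrightarrow> smooth (\<lambda>x. f x * g x)"
  by (simp add: smooth_def[of "\<lambda>x. f x * g x"] C_k_mult)

lemma smooth_prod:
  "finite A \<Longrightarrow> (\<And>i. i \<in> A \<Longrightarrow> smooth (f i)) \<Longrightarrow> smooth (\<lambda>x. \<Prod>i\<in>A. f i x)"
  by (induction A rule: finite_induct) (auto intro: smooth_mult smooth_const)

text \<open>The chain rule for a function of one linear coordinate. It lets bumps on the line be
  placed along the axes and multiplied to bumps on boxes.\<close>

lemma has_derivative_compose_inner:
  fixes g :: "real \<Rightarrow> real"
  assumes "g differentiable (at (x \<bullet> e + s))"
  shows "((\<lambda>x. g (x \<bullet> e + s)) has_derivative (\<lambda>y. (y \<bullet> e) * partial 1 g (x \<bullet> e + s))) (at x)"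
proof -
  let ?D = "frechet_derivative g (at (x \<bullet> e + s))"
  have D: "(g has_derivative ?D) (at (x \<bullet> e + s))" by (rule has_derivative_frechet[OF assms])
  have "((\<lambda>x. x \<bullet> e + s) has_derivative (\<lambda>y. y \<bullet> e)) (at x)"
    by (auto intro!: derivative_eq_intros)
  from has_derivative_compose[OF this D]
  have "((\<lambda>x. g (x \<bullet> e + s)) has_derivative (\<lambda>y. ?D (y \<bullet> e))) (at x)" .
  moreover have "(\<lambda>y. ?D (y \<bullet> e)) = (\<lambda>y. (y \<bullet> e) * ?D 1)"
  proof
    fix y
    show "?D (y \<bullet> e) = (y \<bullet> e) * ?D 1"
      using linear_scale[OF linear_frechet_derivative[OF assms], of "y \<bullet> e" 1]
      by (simp only: real_scaleR_def mult_1_right)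
  qed
  ultimately show ?thesis unfolding partial_def by (simp only:)
qed

lemma C_k_compose_inner: "C_k k g \<Longrightarrow> C_k k (\<lambda>x. g (x \<bullet> e + s))"
proof (induction k arbitrary: g)
  case 0
  then have "continuous_on UNIV g" by simp
  moreover have "continuous_on UNIV (\<lambda>x::'a. x \<bullet> e + s)" by (intro continuous_intros)
  ultimately have "continuous_on UNIV (\<lambda>x::'a. g (x \<bullet> e + s))"
    by (rule continuous_on_compose2) simp
  then show ?case by simp
next
  case (Suc k)
  have d: "((\<lambda>x. g (x \<bullet> e + s)) has_derivative (\<lambda>y. (y \<bullet> e) * partial 1 g (x \<bullet> e + s))) (at x)" for x
    using Suc.prems by (intro has_derivative_compose_inner) auto
  have pe: "partial b (\<lambda>x. g (x \<bullet> e + s)) = (\<lambda>x. (b \<bullet> e) * partial 1 g (x \<bullet> e + s))" for b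
    using d by (intro ext partial_eqI)
  have df: "\<forall>x. (\<lambda>x. g (x \<bullet> e + s)) differentiable (at x)"
    using d differentiable_def by blast
  have "C_k k (\<lambda>x. partial 1 g (x \<bullet> e + s))"
    by (rule Suc.IH) (use Suc.prems in simp)
  then have "\<forall>b\<in>Basis. C_k k (partial b (\<lambda>x. g (x \<bullet> e + s)))"
    unfolding pe by (intro ballI C_k_scale)
  with df show ?case unfolding C_k.simps by (rule conjI)
qed

lemma smooth_compose_inner:
  assumes "smooth g" shows "smooth (\<lambda>x. g (x \<bullet> e + s))"
  unfolding smooth_def
proof
  fix k
  have "C_k k g" using assms by (simp add: smooth_def)
  then show "C_k k (\<lambda>x. g (x \<bullet> e + s))" by (rule C_k_compose_inner[where g = g and e = e and s = s])
qed

section \<open>Bumps built from exp(-1/x)\<close>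

lemma partial_real:
  assumes "(f has_real_derivative d) (at x)" shows "partial 1 f x = d"
proof -
  have "(f has_derivative (*) d) (at x)" using assms by (simp add: has_field_derivative_def)
  then show ?thesis by (simp only: partial_eqI mult_1_right)
qed

text \<open>Only the member \<open>n = 0\<close> serves as a bump. The negative powers are carried
  along because the span of the family is closed under differentiation, so that smoothness becomes a
  plain induction on the order.\<close>

definition exp_bump :: "nat \<Rightarrow> real \<Rightarrow> real" where
  "exp_bump n x = (if x > 0 then inverse x ^ n * exp (- inverse x) else 0)"

lemma exp_bump_has_derivative:
  "(exp_bump n has_real_derivative (exp_bump (n + 2) x - real n * exp_bump (n + 1) x)) (at x)"
proof -
  consider "x > 0" | "x < 0" | "x = 0" by linarith
  then show ?thesis
  proof cases
    case 1
    \<comment> \<open>The truncated exponent \<open>n - 1\<close> is harmless: for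
      \<open>n = 0\<close> its term carries the factor 0.\<close>
    have eq: "inverse x ^ n * (exp (- inverse x) * inverse x ^ 2)
        + (of_nat n * (inverse x ^ (n - 1) * - (inverse x ^ 2))) * exp (- inverse x)
      = exp_bump (n + 2) x - real n * exp_bump (n + 1) x"
      using 1 by (cases n) (auto simp: exp_bump_def field_simps power2_eq_square)
    have "((\<lambda>x. inverse x ^ n * exp (- inverse x)) has_real_derivative
        exp_bump (n + 2) x - real n * exp_bump (n + 1) x) (at x)"
      unfolding eq[symmetric] using 1
      by (auto intro!: derivative_eq_intros simp: power2_eq_square algebra_simps)
    moreover have "eventually (\<lambda>y. exp_bump n y = inverse y ^ n * exp (- inverse y)) (nhds x)"
      using eventually_nhds_in_open[OF open_greaterThan, of x 0] 1
      by (auto elim!: eventually_mono simp: exp_bump_def)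
    ultimately show ?thesis by (subst DERIV_cong_ev[OF refl _ refl]) auto
  next
    case 2
    have "eventually (\<lambda>y. exp_bump n y = 0) (nhds x)"
      using eventually_nhds_in_open[OF open_lessThan, of x 0] 2
      by (auto elim!: eventually_mono simp: exp_bump_def)
    then show ?thesis using 2 by (subst DERIV_cong_ev[OF refl _ refl]) (auto simp: exp_bump_def)
  next
    case 3
    \<comment> \<open>At 0 the difference quotient from the right is y^(-n-1) exp(-1/y). With 1/y as
      the variable this is a power divided by an exponential at infinity.\<close>
    have "((\<lambda>y::real. y ^ (n + 1) / exp y) \<longlongrightarrow> 0) at_top" by (rule tendsto_power_div_exp_0)
    from filterlim_compose[OF this filterlim_inverse_at_top_right]
    have r: "((\<lambda>y. exp_bump n y / y) \<longlongrightarrow> 0) (at_right 0)"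
      by (rule filterlim_cong[THEN iffD1, rotated -1])
        (auto simp: eventually_at_right_field exp_bump_def field_simps exp_minus intro!: exI[of _ 1])
    have "((\<lambda>y. exp_bump n y / y) \<longlongrightarrow> 0) (at_left 0)"
      by (rule tendsto_eventually) (auto simp: eventually_at_left_field exp_bump_def intro!: exI[of _ "-1"])
    with r have "((\<lambda>y. exp_bump n y / y) \<longlongrightarrow> 0) (at 0)" by (simp add: filterlim_split_at)
    then show ?thesis using 3 by (simp add: DERIV_def exp_bump_def)
  qed
qed

lemma C_k_exp_bump: "C_k k (exp_bump n)"
proof (induction k arbitrary: n)
  case 0
  show ?case
    using DERIV_isCont[OF exp_bump_has_derivative] by (auto intro!: continuous_at_imp_continuous_on)
next
  case (Suc k)
  have "partial 1 (exp_bump n) = (\<lambda>x. exp_bump (n + 2) x + (- real n) * exp_bump (n + 1) x)"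
    using partial_real[OF exp_bump_has_derivative] by auto
  moreover have "exp_bump n differentiable (at x)" for x
    using exp_bump_has_derivative real_differentiable_def by blast
  moreover have "C_k k (\<lambda>x. exp_bump (n + 2) x + (- real n) * exp_bump (n + 1) x)"
    by (intro C_k_add C_k_scale Suc.IH)
  ultimately show ?case by simp
qed

lemma smooth_exp_bump: "smooth (exp_bump n)"
  by (simp add: smooth_def C_k_exp_bump)

text \<open>For every positive \<open>r\<close> the function is positive exactly on the open box. A
  factor exp(-1/(r s)), with s the distance to a face, tends to 1 as \<open>r\<close> grows, so the
  bumps converge pointwise to the indicator of the box.\<close>

definition box_bump :: "real \<Rightarrow> 'a::euclidean_space \<Rightarrow> 'a \<Rightarrow> 'a \<Rightarrow> real" where
  "box_bump r a c x = (\<Prod>b\<in>Basis. exp_bump 0 (r * ((x - a) \<bullet> b)) * exp_bump 0 (r * ((c - x) \<bullet> b)))"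

lemma exp_bump_le_1: "0 \<le> exp_bump 0 x" "exp_bump 0 x \<le> 1"
  by (auto simp: exp_bump_def)

lemma box_bump_bounds: "0 \<le> box_bump r a c x" "box_bump r a c x \<le> 1"
  unfolding box_bump_def using exp_bump_le_1
  by (auto intro!: prod_nonneg prod_le_1 mult_le_one)

lemma smooth_box_bump: "smooth (box_bump r a c)"
proof -
  have "smooth (\<lambda>x. exp_bump 0 (x \<bullet> (r *\<^sub>R b) + (- r * (a \<bullet> b))) * exp_bump 0 (x \<bullet> (- r *\<^sub>R b) + r * (c \<bullet> b)))"
    for b :: 'a by (intro smooth_mult smooth_compose_inner smooth_exp_bump)
  then have "smooth (\<lambda>x. exp_bump 0 (r * ((x - a) \<bullet> b)) * exp_bump 0 (r * ((c - x) \<bullet> b)))" for b :: 'a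
    by (simp add: algebra_simps)
  then show ?thesis unfolding box_bump_def by (intro smooth_prod) auto
qed

lemma box_bump_eq_0:
  assumes "r > 0" "x \<notin> box a c" shows "box_bump r a c x = 0"
proof -
  obtain b where b: "b \<in> Basis" "\<not> (a \<bullet> b < x \<bullet> b \<and> x \<bullet> b < c \<bullet> b)"
    using assms by (auto simp: mem_box)
  then have "exp_bump 0 (r * ((x - a) \<bullet> b)) = 0 \<or> exp_bump 0 (r * ((c - x) \<bullet> b)) = 0"
    using assms by (auto simp: exp_bump_def inner_diff_left zero_less_mult_iff)
  then show ?thesis unfolding box_bump_def using b by (intro prod_zero) auto
qed

lemma box_bump_pos:
  assumes "r > 0" "x \<in> box a c" shows "box_bump r a c x > 0"
  unfolding box_bump_def using assms
  by (auto intro!: prod_pos mult_pos_pos simp: exp_bump_def mem_box inner_diff_left)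

lemma box_bump_test_function:
  assumes "r > 0" "cbox a c \<subseteq> \<Omega>" shows "box_bump r a c \<in> test_functions \<Omega>"
proof -
  have "{x. box_bump r a c x \<noteq> 0} \<subseteq> cbox a c"
    using box_bump_eq_0[OF assms(1)] box_subset_cbox by blast
  then have "closure {x. box_bump r a c x \<noteq> 0} \<subseteq> cbox a c"
    by (intro closure_minimal) auto
  moreover from this have "compact (closure {x. box_bump r a c x \<noteq> 0})"
    by (meson bounded_cbox bounded_subset closed_closure compact_eq_bounded_closed)
  ultimately show ?thesis using assms smooth_box_bump by (auto simp: test_functions_def)
qed

lemma box_bump_tendsto: "(\<lambda>n. box_bump (real (Suc n)) a c x) \<longlonglongrightarrow> indicator (box a c) x"
proof (cases "x \<in> box a c")
  case False
  then show ?thesis by (simp add: box_bump_eq_0)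
next
  case True
  have *: "(\<lambda>n. exp_bump 0 (real (Suc n) * y)) \<longlonglongrightarrow> 1" if "y > 0" for y
  proof -
    have "(\<lambda>n. exp (- (inverse (real (Suc n)) * inverse y))) \<longlonglongrightarrow> exp (- (0 * inverse y))"
      by (intro tendsto_intros LIMSEQ_inverse_real_of_nat)
    then show ?thesis using that by (simp add: exp_bump_def zero_less_mult_iff)
  qed
  have "(\<lambda>n. box_bump (real (Suc n)) a c x) \<longlonglongrightarrow> (\<Prod>b\<in>(Basis::'a set). 1 * 1)"
    unfolding box_bump_def
    using True by (intro tendsto_prod tendsto_mult *) (auto simp: mem_box inner_diff_left)
  then show ?thesis using True by simp
qed

section \<open>Uniqueness of weak derivatives\<close>

lemma integral_lebesgue_on_indicator:
  fixes f :: "'a::euclidean_space \<Rightarrow> real"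
  assumes "S \<in> sets lebesgue"
  shows "(LINT x|lebesgue_on S. f x) = (LINT x|lebesgue. indicator S x * f x)"
  using integral_restrict_space[of S lebesgue f] assms by simp

lemma integrable_lebesgue_on_indicator:
  fixes f :: "'a::euclidean_space \<Rightarrow> real"
  assumes "S \<in> sets lebesgue"
  shows "integrable (lebesgue_on S) f \<longleftrightarrow> integrable lebesgue (\<lambda>x. indicator S x * f x)"
  using integrable_restrict_space[of S lebesgue f] assms by simp

lemma AE_lebesgue_on_iff:
  assumes "S \<in> sets lebesgue"
  shows "(AE x in lebesgue_on S. P x) \<longleftrightarrow> (AE x in lebesgue. x \<in> S \<longrightarrow> P x)"
  using assms by (simp add: AE_restrict_space_iff)

lemma continuous_imp_lebesgue_measurable:
  fixes f :: "'a::euclidean_space \<Rightarrow> real"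
  shows "continuous_on UNIV f \<Longrightarrow> f \<in> borel_measurable lebesgue"
  by (intro measurable_completion) (simp add: borel_measurable_continuous_onI)

text \<open>Open boxes form an intersection-stable generator of the Borel sets, so Dynkin's lemma
  carries the vanishing of the integrals from boxes to all Borel sets. A function with this property
  is a density of the zero measure.\<close>

lemma AE_eq_0_if_box_integrals_eq_0:
  fixes g :: "'a::euclidean_space \<Rightarrow> real"
  assumes g: "integrable lebesgue g"
    and box: "\<And>a c. (LINT x|lebesgue. indicator (box a c) x * g x) = 0"
  shows "AE x in lebesgue. g x = 0"
proof -
  \<comment> \<open>Generators and uniqueness of densities concern Borel sets, hence the passage to
    a Borel representative under \<open>lborel\<close>.\<close>
  obtain g' where g'[measurable]: "g' \<in> borel_measurable lborel" and ae: "AE x in lborel. g x = g' x"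
    using completion_ex_borel_measurable_real[of g lborel] g by auto
  have aeL: "AE x in lebesgue. g x = g' x" using ae by (rule AE_completion)
  have meas: "g' \<in> borel_measurable lebesgue" using g' by (rule measurable_completion)
  have "integrable lebesgue g'"
    using integrable_cong_AE[THEN iffD1, OF _ meas aeL g] g by auto
  then have int: "integrable lborel g'" by (simp add: integrable_completion)
  have box': "(LINT x|lborel. indicator (box a c) x * g' x) = 0" for a c
  proof -
    have "(LINT x|lborel. indicator (box a c) x * g' x) = (LINT x|lebesgue. indicator (box a c) x * g' x)"
      by (subst integral_completion) auto
    also have "\<dots> = (LINT x|lebesgue. indicator (box a c) x * g x)"
      using g meas aeL by (intro integral_cong_AE borel_measurable_times borel_measurable_indicator) auto
    finally show ?thesis using box by simp
  qed
  have int_ind: "integrable lborel (\<lambda>x. indicator A x * g' x)" if "A \<in> sets borel" for A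
    using integrable_real_mult_indicator[OF _ int, of A] that by (simp add: mult.commute)
  \<comment> \<open>The complement step of the induction below needs the integral over the whole
    space, which is the limit over growing boxes.\<close>
  have UNIV0: "(LINT x|lborel. g' x) = 0"
  proof -
    have "(\<lambda>n. LINT x|lborel. indicator (box (- real n *\<^sub>R One) (real n *\<^sub>R One)) x * g' x)
        \<longlonglongrightarrow> (LINT x|lborel. g' x)"
    proof (rule integral_dominated_convergence[where w = "\<lambda>x. \<bar>g' x\<bar>"])
      show "AE x in lborel. (\<lambda>n. indicator (box (- real n *\<^sub>R One) (real n *\<^sub>R One)) x * g' x) \<longlonglongrightarrow> g' x"
      proof (rule AE_I2)
        fix x :: 'a
        obtain N where N: "x \<in> box (- real N *\<^sub>R One) (real N *\<^sub>R One)"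
        proof -
          have "x \<in> (\<Union>i::nat. box (- (real i *\<^sub>R One)) (real i *\<^sub>R One))"
            by (simp only: UN_box_eq_UNIV UNIV_I)
          then show ?thesis using that by auto
        qed
        have "eventually (\<lambda>n. indicator (box (- real n *\<^sub>R One) (real n *\<^sub>R One)) x * g' x = g' x) sequentially"
          using eventually_ge_at_top[of N]
        proof eventually_elim
          case (elim n)
          have "x \<in> box (- real n *\<^sub>R One) (real n *\<^sub>R One)"
            using N elim by (fastforce simp: mem_box)
          then show ?case by simp
        qed
        then show "(\<lambda>n. indicator (box (- real n *\<^sub>R One) (real n *\<^sub>R One)) x * g' x) \<longlonglongrightarrow> g' x"
          by (rule tendsto_eventually)
      qed
    qed (use int in \<open>auto split: split_indicator\<close>)
    then show ?thesis by (simp add: box' LIMSEQ_const_iff)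
  qed
  have all: "(LINT x|lborel. indicator A x * g' x) = 0" if A: "A \<in> sets borel" for A
  proof -
    let ?E = "range (\<lambda>(a, b). box a b :: 'a set)"
    have st: "Int_stable ?E" by (auto simp: Int_stable_def box_Int_box)
    have ss: "sets (borel :: 'a measure) = sigma_sets UNIV ?E" by (simp add: borel_eq_box)
    have "A \<in> sigma_sets UNIV ?E" using A ss by simp
    with st subset_UNIV[of ?E, folded Pow_UNIV] show ?thesis
    proof (induction rule: sigma_sets_induct_disjoint)
      case (basic A)
      then show ?case using box' by auto
    next
      case empty
      show ?case by simp
    next
      case (compl A)
      then have "A \<in> sets borel" using ss by simp
      have "(LINT x|lborel. indicator (UNIV - A) x * g' x) = (LINT x|lborel. g' x - indicator A x * g' x)"
        by (intro Bochner_Integration.integral_cong) (auto split: split_indicator)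
      also have "\<dots> = 0"
        using int int_ind[OF \<open>A \<in> sets borel\<close>] compl UNIV0 by simp
      finally show ?case .
    next
      case (union A)
      have A: "A i \<in> sets lborel" for i using union ss by auto
      have "(LINT x:(\<Union>i. A i)|lborel. g' x) = (\<Sum>i. (LINT x:(A i)|lborel. g' x))"
      proof (rule lebesgue_integral_countable_add)
        show "set_integrable lborel (\<Union>i. A i) g'"
          using int_ind[of "\<Union>i. A i"] A by (auto simp: set_integrable_def)
      qed (use A union in \<open>auto simp: disjoint_family_on_def\<close>)
      then show ?case using union by (simp add: set_lebesgue_integral_def)
    qed
  qed
  have "AE x in lborel. g' x = 0"
    by (rule density_unique_real[where f' = "\<lambda>x. 0"]) (use int all in \<open>auto simp: set_lebesgue_integral_def\<close>)
  with ae have "AE x in lborel. g x = 0" by eventually_elim simp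
  then show ?thesis by (rule AE_completion)
qed

lemma locally_integrableD:
  assumes "locally_integrable \<Omega> g" "compact K" "K \<subseteq> \<Omega>"
  shows "integrable lebesgue (\<lambda>x. indicator K x * g x)"
proof -
  have "K \<in> sets lebesgue" using assms lmeasurable_compact by blast
  then show ?thesis
    using assms integrable_lebesgue_on_indicator[of K g] by (auto simp: locally_integrable_def)
qed

lemma test_functionsD:
  assumes "\<phi> \<in> test_functions \<Omega>"
  shows "smooth \<phi>" and "\<And>x. x \<notin> \<Omega> \<Longrightarrow> \<phi> x = 0"
    and "compact (closure {x. \<phi> x \<noteq> 0})" and "closure {x. \<phi> x \<noteq> 0} \<subseteq> \<Omega>"
    and "\<And>x. x \<notin> closure {x. \<phi> x \<noteq> 0} \<Longrightarrow> \<phi> x = 0"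
proof -
  have *: "smooth \<phi> \<and> compact (closure {x. \<phi> x \<noteq> 0}) \<and> closure {x. \<phi> x \<noteq> 0} \<subseteq> \<Omega>"
    using assms unfolding test_functions_def by (rule CollectD)
  then show "smooth \<phi>" "compact (closure {x. \<phi> x \<noteq> 0})" "closure {x. \<phi> x \<noteq> 0} \<subseteq> \<Omega>"
    by (blast, blast, blast)
  show 1: "\<phi> x = 0" if "x \<notin> closure {x. \<phi> x \<noteq> 0}" for x
    using that closure_subset[of "{x. \<phi> x \<noteq> 0}"] by blast
  show "\<phi> x = 0" if "x \<notin> \<Omega>" for x
    using that * by (intro 1) blast
qed

text \<open>The fundamental lemma of the calculus of variations. As \<open>g\<close> is only locally
  integrable, it is cut off to a closed box inside \<Omega>, treated there by box integrals, and the
  countably many closed boxes that exhaust \<Omega> are put together.\<close>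

lemma AE_eq_0_if_test_integrals_eq_0:
  fixes g :: "'a::euclidean_space \<Rightarrow> real"
  assumes "open \<Omega>" and g: "locally_integrable \<Omega> g"
    and test: "\<And>\<phi>. \<phi> \<in> test_functions \<Omega> \<Longrightarrow> (LINT x|lebesgue_on \<Omega>. g x * \<phi> x) = 0"
  shows "AE x in lebesgue_on \<Omega>. g x = 0"
proof -
  have \<Omega>[simp]: "\<Omega> \<in> sets lebesgue" using assms(1) by auto
  have box0: "(LINT x|lebesgue. indicator (box a c) x * g x) = 0" if ac: "cbox a c \<subseteq> \<Omega>" for a c
  proof -
    \<comment> \<open>Box bumps are at most 1 and live in the box, so the cut-off of \<bar>g\<bar>
      to the closed box dominates.\<close>
    have "(\<lambda>n. LINT x|lebesgue. box_bump (real (Suc n)) a c x * (indicator (cbox a c) x * g x))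
        \<longlonglongrightarrow> (LINT x|lebesgue. indicator (box a c) x * g x)"
    proof (rule integral_dominated_convergence[where w = "\<lambda>x. \<bar>indicator (cbox a c) x * g x\<bar>"])
      have int: "integrable lebesgue (\<lambda>x. indicator (cbox a c) x * g x)"
        using locally_integrableD[OF g compact_cbox ac] .
      then show "integrable lebesgue (\<lambda>x. \<bar>indicator (cbox a c) x * g x\<bar>)" by auto
      have bm: "box_bump r a c \<in> borel_measurable lebesgue" for r
        by (intro continuous_imp_lebesgue_measurable smooth_continuous smooth_box_bump)
      show "(\<lambda>x. box_bump (real (Suc n)) a c x * (indicator (cbox a c) x * g x))
          \<in> borel_measurable lebesgue" for n
        by (rule borel_measurable_times[OF bm borel_measurable_integrable[OF int]])
      have eq: "indicator (box a c) x * g x = indicator (box a c) x * (indicator (cbox a c) x * g x)" for x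
        using box_subset_cbox by (auto split: split_indicator)
      show "(\<lambda>x. indicator (box a c) x * g x) \<in> borel_measurable lebesgue"
        unfolding eq
        by (rule borel_measurable_times[OF borel_measurable_indicator borel_measurable_integrable[OF int]]) simp
      show "AE x in lebesgue. (\<lambda>n. box_bump (real (Suc n)) a c x * (indicator (cbox a c) x * g x))
          \<longlonglongrightarrow> indicator (box a c) x * g x"
        unfolding eq by (intro AE_I2 tendsto_mult tendsto_const box_bump_tendsto)
      show "AE x in lebesgue. norm (box_bump (real (Suc n)) a c x * (indicator (cbox a c) x * g x))
          \<le> \<bar>indicator (cbox a c) x * g x\<bar>" for n
        using box_bump_bounds[of "real (Suc n)" a c]
        by (intro AE_I2) (simp add: abs_mult mult_left_le_one_le)
    qed
    moreover have "(LINT x|lebesgue. box_bump (real (Suc n)) a c x * (indicator (cbox a c) x * g x)) = 0" for n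
    proof -
      have "(LINT x|lebesgue. box_bump (real (Suc n)) a c x * (indicator (cbox a c) x * g x))
        = (LINT x|lebesgue. indicator \<Omega> x * (g x * box_bump (real (Suc n)) a c x))"
      proof (intro Bochner_Integration.integral_cong refl)
        fix x
        show "box_bump (real (Suc n)) a c x * (indicator (cbox a c) x * g x)
          = indicator \<Omega> x * (g x * box_bump (real (Suc n)) a c x)"
          using ac box_bump_eq_0[of "real (Suc n)" x a c] box_subset_cbox[of a c]
          by (cases "x \<in> box a c") (auto split: split_indicator)
      qed
      also have "\<dots> = 0"
        using test[OF box_bump_test_function[of "real (Suc n)", OF _ ac]]
        by (simp add: integral_lebesgue_on_indicator)
      finally show ?thesis .
    qed
    ultimately show ?thesis by (simp add: LIMSEQ_const_iff)
  qed
  have cbox0: "AE x in lebesgue. x \<in> cbox a c \<longrightarrow> g x = 0" if ac: "cbox a c \<subseteq> \<Omega>" for a c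
  proof -
    let ?g = "\<lambda>x. indicator (box a c) x * g x"
    have "?g = (\<lambda>x. indicator (box a c) x * (indicator (cbox a c) x * g x))"
      using box_subset_cbox[of a c] by (auto intro!: ext split: split_indicator)
    then have "integrable lebesgue ?g"
      using integrable_real_mult_indicator[OF _ locally_integrableD[OF g compact_cbox ac], of "box a c"]
      by (simp add: mult_ac)
    moreover have "(LINT x|lebesgue. indicator (box a' c') x * ?g x) = 0" for a' c'
    \<comment> \<open>A nonempty intersection of open boxes is a box, and its closure is the
      corresponding closed box, which is what \<open>box0\<close> requires. For an empty
      \<open>box\<close> the \<open>cbox\<close> need not be its closure, so that case is
      separate.\<close>
    proof (cases "box a' c' \<inter> box a c = {}")
      case True
      then have "(\<lambda>x. indicator (box a' c') x * ?g x) = (\<lambda>x. 0)"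
        by (auto intro!: ext split: split_indicator)
      then show ?thesis by (simp only: integral_zero)
    next
      case False
      obtain a'' c'' where eq: "box a' c' \<inter> box a c = box a'' c''"
        using box_Int_box by blast
      have "closure (box a'' c'') \<subseteq> closure (box a c)" using eq by (intro closure_mono) auto
      then have "cbox a'' c'' \<subseteq> cbox a c"
        using False eq by (metis Int_empty_right closure_box)
      then have "(LINT x|lebesgue. indicator (box a'' c'') x * g x) = 0"
        using ac by (intro box0) auto
      then show ?thesis
        by (simp add: eq[symmetric] indicator_inter_arith mult.assoc)
    qed
    ultimately have "AE x in lebesgue. ?g x = 0" by (rule AE_eq_0_if_box_integrals_eq_0)
    \<comment> \<open>Only the open box has been reached; the faces are a null set.\<close>
    moreover have "AE x in lebesgue. x \<notin> cbox a c - box a c"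
      using negligible_frontier_interval[of a c] negligible_iff_null_sets AE_not_in by blast
    ultimately show ?thesis by eventually_elim (auto split: split_indicator_asm)
  qed
  obtain D where D: "countable D" "D \<subseteq> Pow \<Omega>" "\<And>X. X \<in> D \<Longrightarrow> \<exists>a b. X = cbox a b" "\<Union>D = \<Omega>"
    using open_countable_Union_open_cbox[OF assms(1)] by metis
  have "AE x in lebesgue. \<forall>X\<in>D. x \<in> X \<longrightarrow> g x = 0"
  proof (subst AE_ball_countable[OF D(1)], intro ballI)
    fix X assume "X \<in> D"
    then obtain a b where "X = cbox a b" "cbox a b \<subseteq> \<Omega>" using D(2,3) by blast
    then show "AE x in lebesgue. x \<in> X \<longrightarrow> g x = 0" using cbox0 by simp
  qed
  then have "AE x in lebesgue. x \<in> \<Omega> \<longrightarrow> g x = 0"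
    by eventually_elim (use D(4) in auto)
  then show ?thesis by (simp add: AE_lebesgue_on_iff)
qed

lemma integrable_mult_test_function:
  fixes g :: "'a::euclidean_space \<Rightarrow> real"
  assumes "open \<Omega>" "locally_integrable \<Omega> g" "\<phi> \<in> test_functions \<Omega>"
  shows "integrable (lebesgue_on \<Omega>) (\<lambda>x. g x * \<phi> x)"
proof -
  let ?K = "closure {x. \<phi> x \<noteq> 0}"
  have int: "integrable lebesgue (\<lambda>x. indicator ?K x * g x)"
    using locally_integrableD[OF assms(2)] test_functionsD[OF assms(3)] by blast
  have c: "continuous_on UNIV \<phi>" using smooth_continuous test_functionsD(1)[OF assms(3)] by blast
  then have "bounded (\<phi> ` ?K)"
    using test_functionsD(3)[OF assms(3)]
    by (intro compact_imp_bounded compact_continuous_image) (auto intro: continuous_on_subset)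
  then obtain B where B: "\<And>x. x \<in> ?K \<Longrightarrow> \<bar>\<phi> x\<bar> \<le> B" by (auto simp: bounded_iff)
  have "integrable lebesgue (\<lambda>x. indicator ?K x * g x * \<phi> x)"
  proof (rule Bochner_Integration.integrable_bound[where f = "\<lambda>x. B * (indicator ?K x * g x)"])
    show "(\<lambda>x. indicator ?K x * g x * \<phi> x) \<in> borel_measurable lebesgue"
      using int c by (intro borel_measurable_times[OF borel_measurable_integrable]
          continuous_imp_lebesgue_measurable)
    show "AE x in lebesgue. norm (indicator ?K x * g x * \<phi> x) \<le> norm (B * (indicator ?K x * g x))"
    proof (rule AE_I2)
      fix x
      show "norm (indicator ?K x * g x * \<phi> x) \<le> norm (B * (indicator ?K x * g x))"
      proof (cases "x \<in> ?K")
        case True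
        then have "\<bar>\<phi> x\<bar> \<le> \<bar>B\<bar>" using B by fastforce
        then show ?thesis using True by (simp add: abs_mult mult.commute[of "\<bar>B\<bar>"] mult_left_mono)
      qed simp
    qed
  qed (use int in simp)
  moreover have "(\<lambda>x. indicator ?K x * g x * \<phi> x) = (\<lambda>x. indicator \<Omega> x * (g x * \<phi> x))"
  proof
    fix x
    show "indicator ?K x * g x * \<phi> x = indicator \<Omega> x * (g x * \<phi> x)"
      using test_functionsD(4)[OF assms(3)] test_functionsD(5)[OF assms(3), of x]
      by (cases "x \<in> ?K"; cases "x \<in> \<Omega>") auto
  qed
  ultimately show ?thesis using assms(1) by (subst integrable_lebesgue_on_indicator) auto
qed

lemma has_weak_partial_unique:
  assumes "open \<Omega>" "has_weak_partial \<Omega> b f g" "has_weak_partial \<Omega> b f g'"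
  shows "AE x in lebesgue_on \<Omega>. g x = g' x"
proof -
  have li: "locally_integrable \<Omega> g" "locally_integrable \<Omega> g'"
    using assms by (auto simp: has_weak_partial_def)
  have "AE x in lebesgue_on \<Omega>. g x - g' x = 0"
  proof (rule AE_eq_0_if_test_integrals_eq_0[OF assms(1)])
    show "locally_integrable \<Omega> (\<lambda>x. g x - g' x)" using li by (auto simp: locally_integrable_def)
    fix \<phi> assume \<phi>: "\<phi> \<in> test_functions \<Omega>"
    show "(LINT x|lebesgue_on \<Omega>. (g x - g' x) * \<phi> x) = 0"
      using assms \<phi> integrable_mult_test_function[OF assms(1) li(1) \<phi>]
        integrable_mult_test_function[OF assms(1) li(2) \<phi>]
      by (auto simp: has_weak_partial_def left_diff_distrib)
  qed
  then show ?thesis by eventually_elim simp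
qed

section \<open>Weak derivatives on the line\<close>

definition step_bump :: "real \<Rightarrow> real" where
  "step_bump x = exp_bump 0 x * exp_bump 0 (1 - x)"

lemma step_bump_nonneg: "0 \<le> step_bump x"
  by (simp add: step_bump_def exp_bump_le_1)

lemma step_bump_eq_0: "x \<le> 0 \<or> 1 \<le> x \<Longrightarrow> step_bump x = 0"
  by (auto simp: step_bump_def exp_bump_def)

lemma step_bump_pos: "0 < x \<Longrightarrow> x < 1 \<Longrightarrow> 0 < step_bump x"
  by (auto simp: step_bump_def exp_bump_def)

lemma smooth_step_bump: "smooth step_bump"
proof -
  have "smooth (\<lambda>x::real. exp_bump 0 (x \<bullet> 1 + 0) * exp_bump 0 (x \<bullet> (-1) + 1))"
    by (intro smooth_mult smooth_compose_inner smooth_exp_bump)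
  moreover have "step_bump = (\<lambda>x. exp_bump 0 (x \<bullet> 1 + 0) * exp_bump 0 (x \<bullet> (-1) + 1))"
    by (auto simp: step_bump_def)
  ultimately show ?thesis by (simp only:)
qed

lemma continuous_step_bump: "continuous_on S step_bump"
  by (rule smooth_continuous[OF smooth_step_bump])

definition step_mass :: real where "step_mass = integral {0..1} step_bump"

text \<open>The lower limit -1 lies strictly to the left of the support [0,1] of the bump. Points
  right of -1 are thus interior to an interval of integration, and elsewhere the function is locally
  0. It is left unnormalised and climbs from 0 to \<open>step_mass\<close>.\<close>

definition smooth_step :: "real \<Rightarrow> real" where
  "smooth_step x = integral {-1..x} step_bump"

lemma smooth_step_deriv: "(smooth_step has_real_derivative step_bump x) (at x)"
proof (cases "x > -1")
  case True
  have "((\<lambda>u. integral {-1..u} step_bump) has_real_derivative step_bump x) (at x within {-1..x+1})"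
    using True by (intro integral_has_real_derivative continuous_step_bump) auto
  moreover have "at x within {-1..x+1} = at x"
    using True by (intro at_within_interior) auto
  ultimately show ?thesis by (simp add: smooth_step_def[abs_def])
next
  case False
  have z: "smooth_step y = 0" if "y < 0" for y
  proof -
    have "integral {-1..y} step_bump = integral {-1..y} (\<lambda>_. 0)"
      using that by (intro integral_cong) (auto simp: step_bump_eq_0)
    then show ?thesis by (simp add: smooth_step_def)
  qed
  have "eventually (\<lambda>y. smooth_step y = 0) (nhds x)"
    using eventually_nhds_in_open[OF open_lessThan, of x 0] False
    by (auto elim!: eventually_mono simp: z)
  then show ?thesis using False
    by (subst DERIV_cong_ev[OF refl _ refl]) (auto simp: step_bump_eq_0)
qed

lemma step_bump_integrable: "step_bump integrable_on {a..b}"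
  by (intro integrable_continuous_real continuous_step_bump)

lemma smooth_step_le_0: "x \<le> 0 \<Longrightarrow> smooth_step x = 0"
proof -
  assume "x \<le> 0"
  then have "integral {-1..x} step_bump = integral {-1..x} (\<lambda>_. 0)"
    by (intro integral_cong) (auto simp: step_bump_eq_0)
  then show ?thesis by (simp add: smooth_step_def)
qed

lemma smooth_step_ge_1: "1 \<le> x \<Longrightarrow> smooth_step x = step_mass"
proof -
  assume x: "1 \<le> x"
  have "integral {-1..x} step_bump = integral {-1..0} step_bump + integral {0..x} step_bump"
    using x by (intro Henstock_Kurzweil_Integration.integral_combine[symmetric] step_bump_integrable) auto
  moreover have "integral {0..x} step_bump = integral {0..1} step_bump + integral {1..x} step_bump"
    using x by (intro Henstock_Kurzweil_Integration.integral_combine[symmetric] step_bump_integrable) auto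
  moreover have "integral {-1..0} step_bump = 0" using smooth_step_le_0[of 0] by (simp add: smooth_step_def)
  moreover have "integral {1..x} step_bump = integral {1..x} (\<lambda>_. 0)"
    by (intro integral_cong) (auto simp: step_bump_eq_0)
  ultimately show ?thesis by (simp add: smooth_step_def step_mass_def)
qed

lemma smooth_step_mono: "x \<le> y \<Longrightarrow> smooth_step x \<le> smooth_step y"
  by (rule DERIV_nonneg_imp_nondecreasing) (use smooth_step_deriv step_bump_nonneg in blast)+

lemma step_mass_pos: "step_mass > 0"
proof -
  have "smooth_step 0 < smooth_step 1"
  proof (rule DERIV_pos_imp_increasing_open[of 0 1 smooth_step])
    show "continuous_on {0..1} smooth_step"
      using DERIV_isCont[OF smooth_step_deriv] by (intro continuous_at_imp_continuous_on ballI)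
    show "\<exists>y. (smooth_step has_real_derivative y) (at x) \<and> 0 < y" if "0 < x" "x < 1" for x
      using smooth_step_deriv step_bump_pos[OF that] by blast
  qed simp
  then show ?thesis by (simp add: smooth_step_le_0 smooth_step_ge_1)
qed

lemma smooth_step_bounds: "0 \<le> smooth_step x" "smooth_step x \<le> step_mass"
  using smooth_step_mono[of "min x 0" x] smooth_step_mono[of x "max x 1"]
  by (simp_all add: smooth_step_le_0 smooth_step_ge_1)

lemma smooth_smooth_step: "smooth smooth_step"
  unfolding smooth_def
proof
  fix k show "C_k k smooth_step"
  proof (cases k)
    case 0
    then show ?thesis
      using DERIV_isCont[OF smooth_step_deriv] by (auto intro!: continuous_at_imp_continuous_on)
  next
    case (Suc j)
    have "partial 1 smooth_step = step_bump" using partial_real[OF smooth_step_deriv] by auto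
    moreover have "smooth_step differentiable (at x)" for x
      using smooth_step_deriv real_differentiable_def by blast
    ultimately show ?thesis using Suc smooth_step_bump by (simp add: smooth_def)
  qed
qed

lemma integral_step_bump_lborel: "(LINT x|lborel. step_bump x) = step_mass"
  "integrable lborel step_bump"
proof -
  have eq: "step_bump = (\<lambda>x. indicator {0..1} x *\<^sub>R step_bump x)"
    by (auto intro!: ext simp: step_bump_eq_0 split: split_indicator)
  have i: "set_integrable lborel {0..1} step_bump"
    by (rule borel_integrable_atLeastAtMost') (rule continuous_step_bump)
  then show "integrable lborel step_bump" by (subst eq) (simp add: set_integrable_def)
  show "(LINT x|lborel. step_bump x) = step_mass"
    by (subst eq) (use set_borel_integral_eq_integral(2)[OF i] in \<open>simp add: set_lebesgue_integral_def step_mass_def\<close>)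
qed

text \<open>The kernel lives between s - d/(n+1) and s + (1-d)/(n+1). Thus \<open>d = 0\<close>
  approaches \<open>s\<close> from the right and \<open>d = 1\<close> from the left, and only the
  matching one-sided limit of \<open>g\<close> enters. An affine substitution moves the scaling into
  \<open>g\<close>, where dominated convergence applies.\<close>

lemma smooth_step_concentrate:
  fixes g :: "real \<Rightarrow> real"
  assumes g[measurable]: "g \<in> borel_measurable borel" and B: "\<And>x. \<bar>g x\<bar> \<le> B"
    and lim: "\<And>y. 0 < y \<Longrightarrow> y < 1 \<Longrightarrow> (\<lambda>n. g (s + (y - d) / real (Suc n))) \<longlonglongrightarrow> L"
  shows "(\<lambda>n. LINT x|lborel. g x * (real (Suc n) * step_bump (real (Suc n) * (x - s) + d)))
      \<longlonglongrightarrow> L * step_mass"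
proof -
  have [measurable]: "step_bump \<in> borel_measurable borel"
    by (intro borel_measurable_continuous_onI continuous_step_bump)
  have "(LINT x|lborel. g x * (real (Suc n) * step_bump (real (Suc n) * (x - s) + d)))
    = (LINT y|lborel. g (s + (y - d) / real (Suc n)) * step_bump y)" for n
  proof -
    have "(LINT x|lborel. g x * (real (Suc n) * step_bump (real (Suc n) * (x - s) + d)))
      = \<bar>1 / real (Suc n)\<bar> *\<^sub>R (LINT y|lborel. g ((s - d / real (Suc n)) + (1 / real (Suc n)) * y)
          * (real (Suc n) * step_bump (real (Suc n) * (((s - d / real (Suc n)) + (1 / real (Suc n)) * y) - s) + d)))"
      by (rule lborel_integral_real_affine) simp
    also have "\<dots> = (LINT y|lborel. \<bar>1 / real (Suc n)\<bar> *\<^sub>R (g ((s - d / real (Suc n)) + (1 / real (Suc n)) * y)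
          * (real (Suc n) * step_bump (real (Suc n) * (((s - d / real (Suc n)) + (1 / real (Suc n)) * y) - s) + d))))"
      by (rule integral_scaleR_right[symmetric])
    also have "\<dots> = (LINT y|lborel. g (s + (y - d) / real (Suc n)) * step_bump y)"
    proof (intro Bochner_Integration.integral_cong refl)
      fix y :: real
      have 1: "(s - d / real (Suc n)) + (1 / real (Suc n)) * y = s + (y - d) / real (Suc n)"
        by (simp add: diff_divide_distrib)
      have 2: "real (Suc n) * (s + (y - d) / real (Suc n) - s) + d = y" by (simp add: field_simps)
      show "\<bar>1 / real (Suc n)\<bar> *\<^sub>R (g ((s - d / real (Suc n)) + (1 / real (Suc n)) * y)
          * (real (Suc n) * step_bump (real (Suc n) * (((s - d / real (Suc n)) + (1 / real (Suc n)) * y) - s) + d)))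
        = g (s + (y - d) / real (Suc n)) * step_bump y"
        unfolding 1 2 by (simp del: of_nat_Suc)
    qed
    finally show ?thesis .
  qed
  moreover have "(\<lambda>n. LINT y|lborel. g (s + (y - d) / real (Suc n)) * step_bump y)
      \<longlonglongrightarrow> (LINT y|lborel. L * step_bump y)"
  proof (rule integral_dominated_convergence[where w = "\<lambda>y. B * step_bump y"])
    show "AE y in lborel. (\<lambda>n. g (s + (y - d) / real (Suc n)) * step_bump y) \<longlonglongrightarrow> L * step_bump y"
    proof (rule AE_I2)
      fix y
      show "(\<lambda>n. g (s + (y - d) / real (Suc n)) * step_bump y) \<longlonglongrightarrow> L * step_bump y"
        using lim[of y] step_bump_eq_0[of y]
        by (cases "0 < y \<and> y < 1") (intro tendsto_mult tendsto_const, simp, force)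
    qed
    show "AE y in lborel. norm (g (s + (y - d) / real (Suc n)) * step_bump y) \<le> B * step_bump y" for n
      using B step_bump_nonneg by (intro AE_I2) (auto simp: abs_mult intro!: mult_right_mono)
  qed (use integral_step_bump_lborel(2) in auto)
  ultimately show ?thesis by (simp add: integral_step_bump_lborel)
qed

text \<open>The test functions \<open>\<eta> n\<close> approximate a multiple of the indicator of \<open>{s..t}\<close> from inside.\<close>

lemma weak_partial_FTC:
  fixes g k :: "real \<Rightarrow> real"
  assumes I: "open I" and w: "has_weak_partial I 1 g k" and g: "continuous_on I g"
    and st: "s < t" "{s..t} \<subseteq> I"
  shows "g t - g s = (LINT x|lebesgue_on {s..t}. k x)"
proof -
  define G where "G x = indicator {s..t} x * g x" for x
  \<comment> \<open>The ascent takes place on [s, s + 1/(n+1)] and, because of the shift by 1, the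
    descent on [t - 1/(n+1), t]. Both fit into [s,t] as soon as (n+1)(t-s) is at least 1, which
    fixes \<open>N\<close> below.\<close>
  define \<eta> where "\<eta> n x = smooth_step (real (Suc n) * (x - s)) - smooth_step (real (Suc n) * (x - t) + 1)" for n x
  define \<delta> where "\<delta> n x = real (Suc n) * step_bump (real (Suc n) * (x - s) + 0)
      - real (Suc n) * step_bump (real (Suc n) * (x - t) + 1)" for n x
  have d\<eta>: "(\<eta> n has_real_derivative \<delta> n x) (at x)" for n x
    unfolding \<eta>_def \<delta>_def
    by (rule DERIV_diff; rule DERIV_cong[OF DERIV_chain2[OF smooth_step_deriv]])
      (auto intro!: derivative_eq_intros)
  have \<eta>0: "\<eta> n x = 0" if "x \<notin> {s..t}" "real (Suc n) * (t - s) \<ge> 1" for n x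
  proof (cases "x < s")
    case True
    have "real (Suc n) * (x - s) \<le> 0" using True by (simp add: mult_le_0_iff)
    moreover have "real (Suc n) * (x - t) + 1 \<le> 0"
    proof -
      have "real (Suc n) * (x - t) \<le> real (Suc n) * (s - t)" using True by (intro mult_left_mono) auto
      then show ?thesis using that(2) by (simp add: algebra_simps)
    qed
    ultimately show ?thesis by (simp add: \<eta>_def smooth_step_le_0)
  next
    case False
    then have xt: "x > t" using that by auto
    then have "real (Suc n) * (x - t) + 1 \<ge> 1" by simp
    moreover have "real (Suc n) * (x - s) \<ge> 1"
    proof -
      have "real (Suc n) * (x - s) \<ge> real (Suc n) * (t - s)" using xt by (intro mult_left_mono) auto
      then show ?thesis using that(2) by linarith
    qed
    ultimately show ?thesis by (simp add: \<eta>_def smooth_step_ge_1)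
  qed
  have \<delta>0: "\<delta> n x = 0" if "x \<notin> {s..t}" "real (Suc n) * (t - s) \<ge> 1" for n x
  proof -
    have "eventually (\<lambda>y. y \<in> - {s..t}) (nhds x)"
      using that by (intro eventually_nhds_in_open) auto
    then have "eventually (\<lambda>y. \<eta> n y = 0) (nhds x)"
      by eventually_elim (intro \<eta>0 that(2), simp)
    then have "(\<eta> n has_real_derivative 0) (at x)"
      by (subst DERIV_cong_ev[OF refl _ refl]) auto
    then show ?thesis using d\<eta> DERIV_unique by blast
  qed
  obtain N :: nat where N: "1 / (t - s) < real N" using reals_Archimedean2 by blast
  have Nn: "real (Suc n) * (t - s) \<ge> 1" if "n \<ge> N" for n
  proof -
    have "1 / (t - s) \<le> real (Suc n)" using N that by linarith
    then show ?thesis using st by (simp add: field_simps)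
  qed
  have test: "\<eta> n \<in> test_functions I" if "n \<ge> N" for n
  proof -
    have "smooth (\<lambda>x. smooth_step (x \<bullet> real (Suc n) + (- real (Suc n) * s)) + (-1) * smooth_step (x \<bullet> real (Suc n) + (1 - real (Suc n) * t)))"
      by (intro smooth_add smooth_scale smooth_compose_inner smooth_smooth_step)
    moreover have "\<eta> n = (\<lambda>x. smooth_step (x \<bullet> real (Suc n) + (- real (Suc n) * s)) + (-1) * smooth_step (x \<bullet> real (Suc n) + (1 - real (Suc n) * t)))"
      by (auto simp: \<eta>_def algebra_simps)
    ultimately have "smooth (\<eta> n)" by simp
    moreover have sub: "closure {x. \<eta> n x \<noteq> 0} \<subseteq> {s..t}"
      using \<eta>0[OF _ Nn[OF that]] by (intro closure_minimal) (blast, simp)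
    moreover have "compact (closure {x. \<eta> n x \<noteq> 0})"
      using sub by (meson bounded_closed_interval bounded_subset closed_closure compact_eq_bounded_closed)
    ultimately show ?thesis using st unfolding test_functions_def by blast
  qed
  have I': "I \<in> sets lebesgue" using I by auto
  have Gm: "G \<in> borel_measurable borel"
  proof -
    have "(\<lambda>x. indicator {s..t} x *\<^sub>R g x) \<in> borel_measurable borel"
      by (rule borel_measurable_continuous_on_indicator) (use g st in \<open>auto intro: continuous_on_subset\<close>)
    then show ?thesis by (simp add: G_def[abs_def])
  qed
  obtain B where B: "\<And>x. \<bar>G x\<bar> \<le> B"
  proof -
    have "bounded (g ` {s..t})"
      using g st by (intro compact_imp_bounded compact_continuous_image) (auto intro: continuous_on_subset)
    then obtain B where B: "\<forall>x\<in>{s..t}. \<bar>g x\<bar> \<le> B" unfolding bounded_iff by auto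
    moreover have "\<bar>g s\<bar> \<le> B" using st by (intro bspec[OF B]) simp
    then have "0 \<le> B" by linarith
    ultimately show ?thesis by (intro that[of B]) (auto simp: G_def split: split_indicator)
  qed
  have gs: "(g \<longlongrightarrow> g x) (at x within {s..t})" if "x \<in> {s..t}" for x
    using g st that by (meson continuous_on_def continuous_on_subset)
  have Glim: "(\<lambda>n. G (y n)) \<longlonglongrightarrow> g x" if "x \<in> {s..t}" "y \<longlonglongrightarrow> x" "eventually (\<lambda>n. y n \<in> {s..t}) sequentially" for x y
  proof -
    have "continuous_on {s..t} g" using g st continuous_on_subset by blast
    then have "(\<lambda>n. g (y n)) \<longlonglongrightarrow> g x"
      using that by (intro continuous_on_tendsto_compose[of "{s..t}" g]) auto
    moreover have "eventually (\<lambda>n. g (y n) = G (y n)) sequentially"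
      using that(3) by eventually_elim (simp add: G_def)
    ultimately show ?thesis by (rule Lim_transform_eventually)
  qed
  have lim0: "(\<lambda>n. c / real (Suc n)) \<longlonglongrightarrow> 0" for c :: real
    using tendsto_mult[OF tendsto_const LIMSEQ_inverse_real_of_nat, of c] by (simp add: divide_inverse)
  have small: "eventually (\<lambda>n. \<bar>c\<bar> / real (Suc n) < t - s) sequentially" for c :: real
    using order_tendstoD(2)[OF lim0] st by auto
  have L1: "(\<lambda>n. LINT x|lborel. G x * (real (Suc n) * step_bump (real (Suc n) * (x - s) + 0))) \<longlonglongrightarrow> g s * step_mass"
  proof (rule smooth_step_concentrate[OF Gm B])
    fix y :: real assume y: "0 < y" "y < 1"
    show "(\<lambda>n. G (s + (y - 0) / real (Suc n))) \<longlonglongrightarrow> g s"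
    proof (rule Glim)
      show "(\<lambda>n. s + (y - 0) / real (Suc n)) \<longlonglongrightarrow> s" using tendsto_add[OF tendsto_const lim0, of s y] by simp
      show "eventually (\<lambda>n. s + (y - 0) / real (Suc n) \<in> {s..t}) sequentially"
        using small[of y] by eventually_elim (use y in auto)
    qed (use st in auto)
  qed
  have L2: "(\<lambda>n. LINT x|lborel. G x * (real (Suc n) * step_bump (real (Suc n) * (x - t) + 1))) \<longlonglongrightarrow> g t * step_mass"
  proof (rule smooth_step_concentrate[OF Gm B])
    fix y :: real assume y: "0 < y" "y < 1"
    show "(\<lambda>n. G (t + (y - 1) / real (Suc n))) \<longlonglongrightarrow> g t"
    proof (rule Glim)
      show "(\<lambda>n. t + (y - 1) / real (Suc n)) \<longlonglongrightarrow> t" using tendsto_add[OF tendsto_const lim0, of t "y - 1"] by simp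
      show "eventually (\<lambda>n. t + (y - 1) / real (Suc n) \<in> {s..t}) sequentially"
        using small[of "y - 1"]
      proof eventually_elim
        case (elim n)
        have "(y - 1) / real (Suc n) = - (\<bar>y - 1\<bar> / real (Suc n))" using y by (simp add: field_simps)
        moreover have "\<bar>y - 1\<bar> / real (Suc n) \<ge> 0" by simp
        ultimately show ?case using elim by (auto simp del: abs_ge_zero)
      qed
    qed (use st in auto)
  qed
  have bm: "(\<lambda>x. real (Suc n) * step_bump (real (Suc n) * (x - c) + d)) \<in> borel_measurable borel" for n c d
    using continuous_step_bump[of UNIV]
    by (intro borel_measurable_continuous_onI continuous_intros continuous_on_compose2[OF continuous_step_bump]) auto
  have \<delta>m: "\<delta> n \<in> borel_measurable borel" for n
    unfolding \<delta>_def[abs_def] by (intro borel_measurable_diff bm)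
  have int: "integrable lborel (\<lambda>x. G x * (real (Suc n) * step_bump (real (Suc n) * (x - c) + d)))" for n c d
  proof -
    have "integrable lborel (\<lambda>x. step_bump ((real (Suc n) * (- c) + d) + real (Suc n) * x))"
      by (rule lborel_integrable_real_affine) (use integral_step_bump_lborel(2) in auto)
    then have i: "integrable lborel (\<lambda>x. B * (real (Suc n) * step_bump (real (Suc n) * (x - c) + d)))"
      by (simp add: algebra_simps)
    show ?thesis
      by (rule Bochner_Integration.integrable_bound[OF i])
        (use Gm bm B step_bump_nonneg in \<open>auto simp: abs_mult intro!: mult_right_mono mult_left_mono order_trans[OF B abs_ge_self]\<close>)
  qed
  have "(\<lambda>n. (LINT x|lborel. G x * (real (Suc n) * step_bump (real (Suc n) * (x - s) + 0)))
      - (LINT x|lborel. G x * (real (Suc n) * step_bump (real (Suc n) * (x - t) + 1))))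
      \<longlonglongrightarrow> g s * step_mass - g t * step_mass"
    by (rule tendsto_diff[OF L1 L2])
  \<comment> \<open>This is the definition of the weak derivative for the test function
    \<open>\<eta> n\<close>. Replacing \<open>g\<close> by its cut-off \<open>G\<close> changes
    nothing, since \<delta> vanishes off [s,t].\<close>
  moreover have "(LINT x|lborel. G x * (real (Suc n) * step_bump (real (Suc n) * (x - s) + 0)))
      - (LINT x|lborel. G x * (real (Suc n) * step_bump (real (Suc n) * (x - t) + 1)))
      = - (LINT x|lebesgue. indicator {s..t} x * k x * \<eta> n x)" if n: "n \<ge> N" for n
  proof -
    have "(LINT x|lborel. G x * (real (Suc n) * step_bump (real (Suc n) * (x - s) + 0)))
      - (LINT x|lborel. G x * (real (Suc n) * step_bump (real (Suc n) * (x - t) + 1)))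
      = (LINT x|lborel. G x * (real (Suc n) * step_bump (real (Suc n) * (x - s) + 0))
          - G x * (real (Suc n) * step_bump (real (Suc n) * (x - t) + 1)))"
      by (rule Bochner_Integration.integral_diff[symmetric, OF int int])
    also have "\<dots> = (LINT x|lborel. G x * \<delta> n x)" by (simp add: \<delta>_def right_diff_distrib)
    also have "\<dots> = (LINT x|lebesgue. G x * \<delta> n x)"
      using borel_measurable_times[OF Gm \<delta>m[of n]] by (intro integral_completion[symmetric]) simp
    also have "\<dots> = (LINT x|lebesgue. indicator I x * (g x * partial 1 (\<eta> n) x))"
    proof (intro Bochner_Integration.integral_cong refl)
      fix x
      show "G x * \<delta> n x = indicator I x * (g x * partial 1 (\<eta> n) x)"
        using \<delta>0[OF _ Nn[OF n], of x] st
        by (cases "x \<in> {s..t}") (auto simp: G_def partial_real[OF d\<eta>] split: split_indicator)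
    qed
    also have "\<dots> = (LINT x|lebesgue_on I. g x * partial 1 (\<eta> n) x)"
      by (rule integral_lebesgue_on_indicator[OF I', symmetric])
    also have "\<dots> = - (LINT x|lebesgue_on I. k x * \<eta> n x)"
      using w test[OF n] by (auto simp: has_weak_partial_def)
    also have "(LINT x|lebesgue_on I. k x * \<eta> n x) = (LINT x|lebesgue. indicator I x * (k x * \<eta> n x))"
      by (rule integral_lebesgue_on_indicator[OF I'])
    also have "\<dots> = (LINT x|lebesgue. indicator {s..t} x * k x * \<eta> n x)"
    proof (intro Bochner_Integration.integral_cong refl)
      fix x
      show "indicator I x * (k x * \<eta> n x) = indicator {s..t} x * k x * \<eta> n x"
        using \<eta>0[OF _ Nn[OF n], of x] st by (cases "x \<in> {s..t}") (auto split: split_indicator)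
    qed
    finally show ?thesis .
  qed
  then have "eventually (\<lambda>n. (LINT x|lborel. G x * (real (Suc n) * step_bump (real (Suc n) * (x - s) + 0)))
      - (LINT x|lborel. G x * (real (Suc n) * step_bump (real (Suc n) * (x - t) + 1)))
      = - (LINT x|lebesgue. indicator {s..t} x * k x * \<eta> n x)) sequentially"
    using eventually_sequentially by blast
  ultimately have lhs: "(\<lambda>n. - (LINT x|lebesgue. indicator {s..t} x * k x * \<eta> n x)) \<longlonglongrightarrow> g s * step_mass - g t * step_mass"
    by (rule Lim_transform_eventually)
  have ki: "integrable lebesgue (\<lambda>x. indicator {s..t} x * k x)"
    by (rule locally_integrableD[of I]) (use w st in \<open>auto simp: has_weak_partial_def\<close>)
  have rhs: "(\<lambda>n. LINT x|lebesgue. indicator {s..t} x * k x * \<eta> n x)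
      \<longlonglongrightarrow> (LINT x|lebesgue. indicator {s..t} x * k x * step_mass)"
  proof (rule integral_dominated_convergence[where w = "\<lambda>x. \<bar>indicator {s..t} x * k x\<bar> * step_mass"])
    have "continuous_on UNIV (\<eta> n)" for n
      using DERIV_isCont[OF d\<eta>] by (auto intro!: continuous_at_imp_continuous_on)
    then show "(\<lambda>x. indicator {s..t} x * k x * \<eta> n x) \<in> borel_measurable lebesgue" for n
      by (rule borel_measurable_times[OF borel_measurable_integrable[OF ki] continuous_imp_lebesgue_measurable])
    \<comment> \<open>At the endpoints the ramps need not tend to \<open>step_mass\<close>; they
      form a null set.\<close>
    have "AE x in lborel. x \<notin> {s, t}" by (intro AE_not_in) (auto simp: finite_imp_null_set_lborel)
    then have "AE x in lebesgue. x \<notin> {s, t}" by (rule AE_completion)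
    then show "AE x in lebesgue. (\<lambda>n. indicator {s..t} x * k x * \<eta> n x) \<longlonglongrightarrow> indicator {s..t} x * k x * step_mass"
    proof eventually_elim
      case (elim x)
      show ?case
      proof (cases "x \<in> {s<..<t}")
        case True
        obtain N1 :: nat where N1: "1 / (x - s) < real N1" using reals_Archimedean2 by blast
        obtain N2 :: nat where N2: "1 / (t - x) < real N2" using reals_Archimedean2 by blast
        have "eventually (\<lambda>n. \<eta> n x = step_mass) sequentially"
          using eventually_ge_at_top[of "max N1 N2"]
        proof eventually_elim
          case (elim n)
          have "1 / (x - s) \<le> real (Suc n)" "1 / (t - x) \<le> real (Suc n)" using N1 N2 elim by linarith+
          then have "real (Suc n) * (x - s) \<ge> 1" "real (Suc n) * (t - x) \<ge> 1"
            using True by (simp_all add: field_simps)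
          then show ?case by (simp add: \<eta>_def smooth_step_ge_1 smooth_step_le_0 algebra_simps)
        qed
        then show ?thesis by (intro tendsto_mult tendsto_const tendsto_eventually)
      next
        case False
        then show ?thesis using elim by auto
      qed
    qed
    show "AE x in lebesgue. norm (indicator {s..t} x * k x * \<eta> n x) \<le> \<bar>indicator {s..t} x * k x\<bar> * step_mass" for n
    proof (rule AE_I2)
      fix x
      have "\<bar>\<eta> n x\<bar> \<le> step_mass" unfolding \<eta>_def
        using smooth_step_bounds[of "real (Suc n) * (x - s)"] smooth_step_bounds[of "real (Suc n) * (x - t) + 1"] by linarith
      then show "norm (indicator {s..t} x * k x * \<eta> n x) \<le> \<bar>indicator {s..t} x * k x\<bar> * step_mass"
        by (simp only: real_norm_def abs_mult[of _ "\<eta> n x"]) (intro mult_left_mono, auto)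
    qed
  qed (use ki borel_measurable_integrable[OF ki] in auto)
  have "g s * step_mass - g t * step_mass = - (LINT x|lebesgue. indicator {s..t} x * k x * step_mass)"
    by (rule LIMSEQ_unique[OF lhs tendsto_minus[OF rhs]])
  then have "(g t - g s) * step_mass = (LINT x|lebesgue_on {s..t}. k x) * step_mass"
    by (simp add: integral_lebesgue_on_indicator algebra_simps)
  then show ?thesis using step_mass_pos by simp
qed

lemma weak_partial_increment_le:
  fixes g k :: "real \<Rightarrow> real"
  assumes "open I" and w: "has_weak_partial I 1 g k" and "continuous_on I g"
    and st: "s \<le> t" "{s..t} \<subseteq> I" and B: "AE x in lebesgue_on {s..t}. k x \<le> B"
  shows "g t - g s \<le> B * (t - s)"
proof (cases "s = t")
  case False
  have "integrable (lebesgue_on {s..t}) k"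
    using w st by (auto simp: has_weak_partial_def locally_integrable_def)
  then have "(LINT x|lebesgue_on {s..t}. k x) \<le> (LINT x|lebesgue_on {s..t}. B)"
    using B by (intro integral_mono_AE) (auto simp: integrable_const_ivl)
  also have "\<dots> = B * (t - s)" using st by (simp add: measure_restrict_space)
  finally show ?thesis using weak_partial_FTC[OF assms(1-3)] st False by auto
qed simp

lemma weak_partial_increment_abs_le:
  fixes g k :: "real \<Rightarrow> real"
  assumes "open I" and w: "has_weak_partial I 1 g k" and g: "continuous_on I g"
    and st: "s \<le> t" "{s..t} \<subseteq> I" and B: "AE x in lebesgue_on {s..t}. \<bar>k x\<bar> \<le> B"
  shows "\<bar>g t - g s\<bar> \<le> B * (t - s)"
proof -
  have "g t - g s \<le> B * (t - s)"
    using B by (intro weak_partial_increment_le[OF assms(1-5)]) (auto elim!: eventually_mono)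
  moreover have "has_weak_partial I 1 (\<lambda>x. - g x) (\<lambda>x. - k x)"
    using w by (auto simp: has_weak_partial_def locally_integrable_def)
  then have "(- g t) - (- g s) \<le> B * (t - s)"
    using B g by (intro weak_partial_increment_le[OF assms(1) _ _ st, of _ "\<lambda>x. - k x"])
        (auto elim!: eventually_mono intro: continuous_intros)
  ultimately show ?thesis by linarith
qed

section \<open>Test functions and integration by parts\<close>

text \<open>\<open>smooth\<close> controls derivatives along \<open>Basis\<close> only; this reaches
  the arbitrary directions that occur in translations.\<close>

lemma partial_expand:
  assumes "f differentiable (at x)"
  shows "partial y f x = (\<Sum>b\<in>Basis. (y \<bullet> b) * partial b f x)"
proof -
  let ?D = "frechet_derivative f (at x)"
  have l: "linear ?D" by (rule linear_frechet_derivative[OF assms])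
  have "?D (\<Sum>b\<in>Basis. (y \<bullet> b) *\<^sub>R b) = (\<Sum>b\<in>Basis. (y \<bullet> b) * ?D b)"
    by (simp add: linear_sum[OF l] linear_scale[OF l])
  then show ?thesis by (simp add: partial_def euclidean_representation)
qed

section \<open>Algebra of test functions\<close>

lemma test_functionsI:
  assumes "smooth \<phi>" "compact K" "K \<subseteq> \<Omega>" "\<And>x. x \<notin> K \<Longrightarrow> \<phi> x = 0"
  shows "\<phi> \<in> test_functions \<Omega>"
proof -
  have sub: "closure {x. \<phi> x \<noteq> 0} \<subseteq> K"
    by (rule closure_minimal) (use assms(4) compact_imp_closed[OF assms(2)] in blast)+
  have "compact (closure {x. \<phi> x \<noteq> 0})"
    unfolding compact_eq_bounded_closed
    by (rule conjI[OF bounded_subset[OF compact_imp_bounded[OF assms(2)] sub] closed_closure])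
  moreover have "closure {x. \<phi> x \<noteq> 0} \<subseteq> \<Omega>" using sub assms(3) by (rule order_trans)
  ultimately show ?thesis
    unfolding test_functions_def using assms(1) by (intro CollectI conjI)
qed

lemma partial_test_function:
  assumes \<phi>: "\<phi> \<in> test_functions \<Omega>" and b: "b \<in> Basis"
  shows "partial b \<phi> \<in> test_functions \<Omega>"
proof -
  let ?K = "closure {x. \<phi> x \<noteq> 0}"
  have "partial b \<phi> x = 0" if "x \<notin> ?K" for x
  proof -
    have "(\<phi> has_derivative (\<lambda>_. 0)) (at x)"
    proof (rule has_derivative_transform_within_open[of "\<lambda>_. 0"])
      show "open (- ?K)" by (intro open_Compl closed_closure)
      show "x \<in> - ?K" unfolding Compl_iff by (rule that)
      fix y assume "y \<in> - ?K"
      then show "0 = \<phi> y" by (intro test_functionsD(5)[OF \<phi>, symmetric]) (rule ComplD)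
    qed (rule has_derivative_const)
    then show ?thesis by (rule partial_eqI)
  qed
  then show ?thesis
    by (rule test_functionsI[OF smooth_partial[OF test_functionsD(1)[OF \<phi>] b]
          test_functionsD(3,4)[OF \<phi>]])
qed

lemma test_function_bounded:
  assumes "\<phi> \<in> test_functions \<Omega>" obtains B where "\<And>x. \<bar>\<phi> x\<bar> \<le> B" "0 \<le> B"
proof -
  let ?K = "closure {x. \<phi> x \<noteq> 0}"
  have "bounded (\<phi> ` ?K)"
    using test_functionsD(3)[OF assms] smooth_continuous[OF test_functionsD(1)[OF assms]]
    by (intro compact_imp_bounded compact_continuous_image) auto
  then obtain B where B: "\<forall>x\<in>?K. \<bar>\<phi> x\<bar> \<le> B" unfolding bounded_iff by auto
  have "\<bar>\<phi> x\<bar> \<le> max B 0" for x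
    using B test_functionsD(5)[OF assms, of x] by (cases "x \<in> ?K") fastforce+
  then show ?thesis by (intro that[of "max B 0"]) auto
qed

lemma test_function_measurable:
  "\<phi> \<in> test_functions \<Omega> \<Longrightarrow> \<phi> \<in> borel_measurable borel"
  using smooth_continuous test_functionsD(1) by (blast intro: borel_measurable_continuous_onI)

lemma test_function_integrable:
  assumes "\<phi> \<in> test_functions \<Omega>" shows "integrable lborel \<phi>"
proof -
  let ?K = "closure {x. \<phi> x \<noteq> 0}"
  obtain B where B: "\<And>x. \<bar>\<phi> x\<bar> \<le> B" "0 \<le> B" using test_function_bounded[OF assms] by blast
  have K: "compact ?K" using test_functionsD(3)[OF assms] .
  have "integrable lborel (\<lambda>x. B * indicator ?K x)"
    using emeasure_compact_finite[OF K] compact_imp_closed[OF K]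
    by (intro integrable_mult_right integrable_real_indicator) auto
  then show ?thesis
  proof (rule Bochner_Integration.integrable_bound)
    show "\<phi> \<in> borel_measurable lborel" using test_function_measurable[OF assms] by simp
    show "AE x in lborel. norm (\<phi> x) \<le> norm (B * indicator ?K x)"
    proof (rule AE_I2)
      fix x show "norm (\<phi> x) \<le> norm (B * indicator ?K x :: real)"
        using B test_functionsD(5)[OF assms, of x] by (cases "x \<in> ?K") auto
    qed
  qed
qed

lemma test_function_mult:
  assumes "\<phi> \<in> test_functions \<Omega>" "smooth \<zeta>"
  shows "(\<lambda>x. \<phi> x * \<zeta> x) \<in> test_functions \<Omega>"
  by (rule test_functionsI[OF smooth_mult[OF test_functionsD(1)[OF assms(1)] assms(2)]
        test_functionsD(3,4)[OF assms(1)]]) (drule test_functionsD(5)[OF assms(1)], simp only: mult_zero_left)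

lemma test_function_scale:
  assumes "\<phi> \<in> test_functions \<Omega>" shows "(\<lambda>x. c * \<phi> x) \<in> test_functions \<Omega>"
  using test_function_mult[OF assms smooth_const[of c]] by (simp add: mult.commute)

lemma test_function_add:
  assumes "\<phi> \<in> test_functions \<Omega>" "\<zeta> \<in> test_functions \<Omega>"
  shows "(\<lambda>x. \<phi> x + \<zeta> x) \<in> test_functions \<Omega>"
proof (rule test_functionsI)
  show "smooth (\<lambda>x. \<phi> x + \<zeta> x)"
    by (rule smooth_add[OF test_functionsD(1)[OF assms(1)] test_functionsD(1)[OF assms(2)]])
  show "compact (closure {x. \<phi> x \<noteq> 0} \<union> closure {x. \<zeta> x \<noteq> 0})"
    by (rule compact_Un[OF test_functionsD(3)[OF assms(1)] test_functionsD(3)[OF assms(2)]])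
  show "closure {x. \<phi> x \<noteq> 0} \<union> closure {x. \<zeta> x \<noteq> 0} \<subseteq> \<Omega>"
    by (rule Un_least[OF test_functionsD(4)[OF assms(1)] test_functionsD(4)[OF assms(2)]])
  fix x assume "x \<notin> closure {x. \<phi> x \<noteq> 0} \<union> closure {x. \<zeta> x \<noteq> 0}"
  then show "\<phi> x + \<zeta> x = 0"
    using test_functionsD(5)[OF assms(1), of x] test_functionsD(5)[OF assms(2), of x] by (simp only: Un_iff) auto
qed

lemma test_function_zero: "(\<lambda>x. 0) \<in> test_functions \<Omega>"
  by (rule test_functionsI[where K = "{}"]) (auto simp: smooth_const)

lemma test_functions_mono: "\<phi> \<in> test_functions \<Omega> \<Longrightarrow> \<Omega> \<subseteq> \<Omega>' \<Longrightarrow> \<phi> \<in> test_functions \<Omega>'"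
  by (rule test_functionsI[OF test_functionsD(1,3) order_trans[OF test_functionsD(4)] test_functionsD(5)])

section \<open>Line integrals, translations and integration by parts\<close>

lemma continuous_partial: "smooth f \<Longrightarrow> continuous_on UNIV (partial y f)"
proof -
  assume f: "smooth f"
  have "partial y f = (\<lambda>x. \<Sum>b\<in>Basis. (y \<bullet> b) * partial b f x)"
    by (rule ext) (rule partial_expand[OF smooth_differentiable[OF f]])
  moreover have "continuous_on UNIV (\<lambda>x. \<Sum>b\<in>Basis. (y \<bullet> b) * partial b f x)"
    by (intro continuous_on_sum continuous_on_mult_left smooth_continuous smooth_partial f)
  ultimately show ?thesis by (simp only:)
qed

text \<open>Written over \<open>lborel\<close> with an indicator, so that it can be fed to Fubini
  together with an integral in \<open>x\<close>.\<close>

lemma smooth_FTC_line: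
  fixes f :: "'a::euclidean_space \<Rightarrow> real"
  assumes f: "smooth f"
  shows "(LINT s|lborel. indicator {0..1} s * partial y f (x + s *\<^sub>R y)) = f (x + y) - f x"
proof -
  have d: "((\<lambda>s. f (x + s *\<^sub>R y)) has_vector_derivative partial y f (x + s *\<^sub>R y)) (at s within {0..1})" for s :: real
  proof -
    let ?D = "frechet_derivative f (at (x + s *\<^sub>R y))"
    have D: "(f has_derivative ?D) (at (x + s *\<^sub>R y))"
      by (rule has_derivative_frechet[OF smooth_differentiable[OF f]])
    have "((\<lambda>s. x + s *\<^sub>R y) has_derivative (\<lambda>h. h *\<^sub>R y)) (at s)"
      by (auto intro!: derivative_eq_intros)
    from has_derivative_compose[OF this D]
    have "((\<lambda>s. f (x + s *\<^sub>R y)) has_derivative (\<lambda>h. ?D (h *\<^sub>R y))) (at s)" .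
    moreover have "(\<lambda>h. ?D (h *\<^sub>R y)) = (\<lambda>h. h *\<^sub>R ?D y)"
      using linear_scale[OF linear_frechet_derivative[OF smooth_differentiable[OF f]]] by blast
    ultimately show ?thesis
      by (simp add: has_vector_derivative_def partial_def has_derivative_at_withinI)
  qed
  have "continuous_on {0..1} (\<lambda>s. partial y f (x + s *\<^sub>R y))"
    by (intro continuous_on_compose2[OF continuous_partial[OF f]] continuous_intros) auto
  from integral_FTC_atLeastAtMost[OF _ d this]
  show ?thesis by simp
qed

lemma lborel_integral_translate:
  fixes f :: "'a::euclidean_space \<Rightarrow> real"
  assumes "f \<in> borel_measurable borel"
  shows "(LINT x|lborel. f (x + c)) = (LINT x|lborel. f x)"
    and "integrable lborel (\<lambda>x. f (x + c)) \<longleftrightarrow> integrable lborel f"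
proof -
  have d: "distr lborel lborel ((+) c) = lborel"
    using lborel_distr_plus[of c] by (simp cong: distr_cong)
  have "(LINT x|distr lborel lborel ((+) c). f x) = (LINT x|lborel. f (c + x))"
    using assms by (intro integral_distr) auto
  then show "(LINT x|lborel. f (x + c)) = (LINT x|lborel. f x)"
    unfolding d by (simp add: add.commute)
  have "integrable (distr lborel lborel ((+) c)) f \<longleftrightarrow> integrable lborel (\<lambda>x. f (c + x))"
    using assms by (intro integrable_distr_eq) auto
  then show "integrable lborel (\<lambda>x. f (x + c)) \<longleftrightarrow> integrable lborel f"
    unfolding d by (simp add: add.commute)
qed

lemma lborel_nn_integral_translate:
  fixes f :: "'a::euclidean_space \<Rightarrow> ennreal"
  assumes "f \<in> borel_measurable borel"
  shows "(\<integral>\<^sup>+x. f (x + c) \<partial>lborel) = (\<integral>\<^sup>+x. f x \<partial>lborel)"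
proof -
  have d: "distr lborel lborel ((+) c) = lborel"
    using lborel_distr_plus[of c] by (simp cong: distr_cong)
  have "(\<integral>\<^sup>+x. f x \<partial>distr lborel lborel ((+) c)) = (\<integral>\<^sup>+x. f (c + x) \<partial>lborel)"
    using assms by (intro nn_integral_distr) auto
  then show ?thesis unfolding d by (simp add: add.commute)
qed

text \<open>Integrate \<phi>(x+b) - \<phi>(x), the integral of the derivative along the segment,
  over all \<open>x\<close>. The left side vanishes by translation invariance. By Fubini and the
  same invariance the right side is the integral of the derivative. No splitting of the space into
  coordinates occurs.\<close>

lemma integral_partial_test_function:
  fixes \<phi> :: "'a::euclidean_space \<Rightarrow> real"
  assumes \<phi>: "\<phi> \<in> test_functions UNIV" and b: "b \<in> Basis"
  shows "(LINT x|lborel. partial b \<phi> x) = 0"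
proof -
  let ?p = "partial b \<phi>"
  have pt: "?p \<in> test_functions UNIV" by (rule partial_test_function[OF \<phi> b])
  have pm[measurable]: "?p \<in> borel_measurable borel" by (rule test_function_measurable[OF pt])
  have pi: "integrable lborel ?p" by (rule test_function_integrable[OF pt])
  let ?f = "\<lambda>s x. indicator {0..1::real} s * ?p (x + s *\<^sub>R b)"
  have int: "integrable (lborel \<Otimes>\<^sub>M lborel) (case_prod ?f)"
  proof (rule lborel_pair.Fubini_integrable)
    show "case_prod ?f \<in> borel_measurable (lborel \<Otimes>\<^sub>M lborel)" by measurable
    have "(LINT x|lborel. norm (?f s x)) = indicator {0..1} s * (LINT x|lborel. \<bar>?p x\<bar>)" for s
      using lborel_integral_translate(1)[of "\<lambda>x. \<bar>?p x\<bar>" "s *\<^sub>R b"] by (simp add: abs_mult)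
    then show "integrable lborel (\<lambda>s. LINT x|lborel. norm (case (s, x) of (s, x) \<Rightarrow> ?f s x))"
      by (simp add: integrable_real_indicator)
    show "AE s in lborel. integrable lborel (\<lambda>x. case (s, x) of (s, x) \<Rightarrow> ?f s x)"
      using lborel_integral_translate(2)[OF pm] pi by simp
  qed
  have "(LINT x|lborel. (LINT s|lborel. ?f s x)) = (LINT s|lborel. (LINT x|lborel. ?f s x))"
    by (rule lborel_pair.Fubini_integral[OF int])
  also have "\<dots> = (LINT s|lborel. indicator {0..1::real} s * (LINT x|lborel. ?p x))"
    using lborel_integral_translate(1)[OF pm] by simp
  also have "\<dots> = (LINT x|lborel. ?p x)" by simp
  finally have "(LINT x|lborel. ?p x) = (LINT x|lborel. \<phi> (x + b) - \<phi> x)"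
    by (simp add: smooth_FTC_line[OF test_functionsD(1)[OF \<phi>]])
  also have "\<dots> = 0"
    using lborel_integral_translate[OF test_function_measurable[OF \<phi>], of b]
      test_function_integrable[OF \<phi>] by simp
  finally show ?thesis .
qed

lemma lborel_eq_lebesgue_on_integral:
  fixes f :: "'a::euclidean_space \<Rightarrow> real"
  assumes "\<Omega> \<in> sets lebesgue" "f \<in> borel_measurable borel" "\<And>x. x \<notin> \<Omega> \<Longrightarrow> f x = 0"
  shows "(LINT x|lebesgue_on \<Omega>. f x) = (LINT x|lborel. f x)"
    and "integrable (lebesgue_on \<Omega>) f \<longleftrightarrow> integrable lborel f"
proof -
  have eq: "(\<lambda>x. indicator \<Omega> x * f x) = f" using assms(3) by (auto split: split_indicator)
  show "(LINT x|lebesgue_on \<Omega>. f x) = (LINT x|lborel. f x)"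
    using assms(2) by (simp add: integral_lebesgue_on_indicator[OF assms(1)] eq integral_completion)
  show "integrable (lebesgue_on \<Omega>) f \<longleftrightarrow> integrable lborel f"
    using assms(2) by (simp add: integrable_lebesgue_on_indicator[OF assms(1)] eq integrable_completion)
qed

lemma continuous_locally_integrable:
  fixes f :: "'a::euclidean_space \<Rightarrow> real"
  assumes "continuous_on \<Omega> f" shows "locally_integrable \<Omega> f"
  unfolding locally_integrable_def
proof (intro allI impI)
  fix K assume K: "compact K \<and> K \<subseteq> \<Omega>"
  then have i: "integrable lborel (\<lambda>x. indicator K x *\<^sub>R f x)"
    using assms by (intro borel_integrable_compact) (auto intro: continuous_on_subset)
  then have "integrable lebesgue (\<lambda>x. indicator K x *\<^sub>R f x)"
    by (subst integrable_completion) (rule borel_measurable_integrable[OF i])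
  then show "integrable (lebesgue_on K) f"
    using K lmeasurable_compact by (subst integrable_lebesgue_on_indicator) auto
qed

text \<open>The product of a test function with a smooth one is again a test function, so the
  integral of its derivative is zero; Leibniz' rule splits that integral into the two sides.\<close>

lemma has_weak_partial_smooth:
  fixes f :: "'a::euclidean_space \<Rightarrow> real"
  assumes \<Omega>: "open \<Omega>" and f: "smooth f" and b: "b \<in> Basis"
  shows "has_weak_partial \<Omega> b f (partial b f)"
  unfolding has_weak_partial_def
proof (intro conjI ballI)
  show "locally_integrable \<Omega> f" "locally_integrable \<Omega> (partial b f)"
    using f b by (auto intro!: continuous_locally_integrable smooth_continuous smooth_partial)
  fix \<eta> assume \<eta>: "\<eta> \<in> test_functions \<Omega>"
  have \<Omega>': "\<Omega> \<in> sets lebesgue" using \<Omega> by auto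
  have sm: "smooth \<eta>" using test_functionsD(1)[OF \<eta>] .
  have "(\<lambda>x. \<eta> x * f x) \<in> test_functions UNIV"
    by (rule test_functions_mono[OF test_function_mult[OF \<eta> f]]) simp
  from integral_partial_test_function[OF this b]
  have 0: "(LINT x|lborel. partial b \<eta> x * f x + \<eta> x * partial b f x) = 0"
    using f sm by (simp add: partial_mult smooth_differentiable)
  have t1: "(\<lambda>x. partial b \<eta> x * f x) \<in> test_functions \<Omega>"
    by (intro test_function_mult partial_test_function \<eta> b f)
  have t2: "(\<lambda>x. \<eta> x * partial b f x) \<in> test_functions \<Omega>"
    by (intro test_function_mult smooth_partial \<eta> b f)
  have "(LINT x|lebesgue_on \<Omega>. partial b \<eta> x * f x) = (LINT x|lborel. partial b \<eta> x * f x)"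
    by (intro lborel_eq_lebesgue_on_integral \<Omega>' test_function_measurable[OF t1] test_functionsD(2)[OF t1])
  moreover have "(LINT x|lebesgue_on \<Omega>. \<eta> x * partial b f x) = (LINT x|lborel. \<eta> x * partial b f x)"
    by (intro lborel_eq_lebesgue_on_integral \<Omega>' test_function_measurable[OF t2] test_functionsD(2)[OF t2])
  ultimately show "(LINT x|lebesgue_on \<Omega>. f x * partial b \<eta> x) = - (LINT x|lebesgue_on \<Omega>. partial b f x * \<eta> x)"
    using 0 test_function_integrable[OF t1] test_function_integrable[OF t2] by (simp add: mult.commute)
qed

section \<open>The spaces $L^2$, $H^1$ and $H^1_0$\<close>

text \<open>Functions equal almost everywhere are not identified, so \<open>B v v\<close> may vanish
  for nonzero \<open>v\<close>. The locale is used for L2, for the gradient form, and for the H1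
  product both on \<open>H_k \<Omega> 1\<close> and on \<open>H10 \<Omega>\<close>;
  \<open>nrm\<close> then becomes \<open>L2_norm\<close> or \<open>H1_norm\<close>.\<close>

locale semi_inner_space =
  fixes X :: "('a \<Rightarrow> real) set" and B :: "('a \<Rightarrow> real) \<Rightarrow> ('a \<Rightarrow> real) \<Rightarrow> real"
  assumes add_closed: "v \<in> X \<Longrightarrow> w \<in> X \<Longrightarrow> (\<lambda>x. v x + w x) \<in> X"
    and scale_closed: "v \<in> X \<Longrightarrow> (\<lambda>x. c * v x) \<in> X"
    and B_add: "v \<in> X \<Longrightarrow> w \<in> X \<Longrightarrow> z \<in> X \<Longrightarrow> B (\<lambda>x. v x + w x) z = B v z + B w z"
    and B_scale: "v \<in> X \<Longrightarrow> z \<in> X \<Longrightarrow> B (\<lambda>x. c * v x) z = c * B v z"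
    and B_sym: "B v w = B w v"
    and B_nonneg: "v \<in> X \<Longrightarrow> 0 \<le> B v v"
begin

definition nrm :: "('a \<Rightarrow> real) \<Rightarrow> real" where "nrm v = sqrt (B v v)"

lemma diff_closed: "v \<in> X \<Longrightarrow> w \<in> X \<Longrightarrow> (\<lambda>x. v x - w x) \<in> X"
  using add_closed[of v "\<lambda>x. (-1) * w x"] scale_closed[of w "-1"] by simp

lemma B_diff: "v \<in> X \<Longrightarrow> w \<in> X \<Longrightarrow> z \<in> X \<Longrightarrow> B (\<lambda>x. v x - w x) z = B v z - B w z"
  using B_add[of v "\<lambda>x. (-1) * w x" z] B_scale[of w z "-1"] scale_closed[of w "-1"] by simp

lemma B_add2: "v \<in> X \<Longrightarrow> w \<in> X \<Longrightarrow> z \<in> X \<Longrightarrow> B z (\<lambda>x. v x + w x) = B z v + B z w"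
  using B_add[of v w z] by (simp only: B_sym[of z])

lemma B_diff2: "v \<in> X \<Longrightarrow> w \<in> X \<Longrightarrow> z \<in> X \<Longrightarrow> B z (\<lambda>x. v x - w x) = B z v - B z w"
  using B_diff[of v w z] by (simp only: B_sym[of z])

lemma B_scale2: "v \<in> X \<Longrightarrow> z \<in> X \<Longrightarrow> B z (\<lambda>x. c * v x) = c * B z v"
  using B_scale[of v z c] by (simp only: B_sym[of z])

lemma B_add_self:
  "v \<in> X \<Longrightarrow> w \<in> X \<Longrightarrow> B (\<lambda>x. v x + w x) (\<lambda>x. v x + w x) = B v v + 2 * B v w + B w w"
  using B_sym[of v w] by (simp add: B_add B_add2 add_closed)

lemma B_diff_self:
  "v \<in> X \<Longrightarrow> w \<in> X \<Longrightarrow> B (\<lambda>x. v x - w x) (\<lambda>x. v x - w x) = B v v - 2 * B v w + B w w"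
  using B_sym[of v w] by (simp add: B_diff B_diff2 diff_closed)

lemma B_scale_self: "v \<in> X \<Longrightarrow> B (\<lambda>x. c * v x) (\<lambda>x. c * v x) = c\<^sup>2 * B v v"
  by (simp add: B_scale B_scale2 scale_closed power2_eq_square)

lemma nrm_nonneg: "v \<in> X \<Longrightarrow> 0 \<le> nrm v"
  by (simp add: nrm_def B_nonneg)

lemma nrm_sq: "v \<in> X \<Longrightarrow> (nrm v)\<^sup>2 = B v v"
  by (simp add: nrm_def B_nonneg)

lemma nrm_scale: "v \<in> X \<Longrightarrow> nrm (\<lambda>x. c * v x) = \<bar>c\<bar> * nrm v"
  by (simp add: nrm_def B_scale_self real_sqrt_mult)

lemma Cauchy_Schwarz_sq:
  assumes "v \<in> X" "w \<in> X" shows "(B v w)\<^sup>2 \<le> B v v * B w w"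
proof -
  have q: "0 \<le> B v v + 2 * t * B v w + t\<^sup>2 * B w w" for t
    using B_nonneg[OF add_closed[OF assms(1) scale_closed[OF assms(2), of t]]]
      B_add_self[OF assms(1) scale_closed[OF assms(2), of t]] assms
    by (simp add: B_scale_self B_scale2)
  show ?thesis
  proof (cases "B w w = 0")
    case True
    have "B v w = 0"
    proof (rule ccontr)
      assume n: "B v w \<noteq> 0"
      \<comment> \<open>With \<open>B w w = 0\<close> the quadratic is affine in \<open>t\<close>;
        at this \<open>t\<close> its value is -1.\<close>
      show False using q[of "- (B v v + 1) / (2 * B v w)"] n True by (simp add: field_simps)
    qed
    then show ?thesis using True by simp
  next
    case False
    then have p: "B w w > 0" using B_nonneg[OF assms(2)] by simp
    \<comment> \<open>The minimiser of the quadratic.\<close>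
    then show ?thesis using q[of "- B v w / B w w"] by (simp add: field_simps power2_eq_square)
  qed
qed

lemma Cauchy_Schwarz: "v \<in> X \<Longrightarrow> w \<in> X \<Longrightarrow> \<bar>B v w\<bar> \<le> nrm v * nrm w"
  using Cauchy_Schwarz_sq[of v w] real_le_rsqrt[of "\<bar>B v w\<bar>" "B v v * B w w"]
  by (simp add: nrm_def real_sqrt_mult)

lemma nrm_triangle:
  assumes "v \<in> X" "w \<in> X" shows "nrm (\<lambda>x. v x + w x) \<le> nrm v + nrm w"
proof (rule power2_le_imp_le)
  have "B v w \<le> nrm v * nrm w" using Cauchy_Schwarz[OF assms] by linarith
  then show "(nrm (\<lambda>x. v x + w x))\<^sup>2 \<le> (nrm v + nrm w)\<^sup>2"
    using assms by (simp add: nrm_sq add_closed B_add_self power2_sum)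
  show "0 \<le> nrm v + nrm w" using assms by (simp add: nrm_nonneg)
qed

lemma nrm_minus_commute: "v \<in> X \<Longrightarrow> w \<in> X \<Longrightarrow> nrm (\<lambda>x. v x - w x) = nrm (\<lambda>x. w x - v x)"
  using nrm_scale[OF diff_closed[of v w], of "-1"] by simp

lemma nrm_triangle_diff:
  assumes "v \<in> X" "w \<in> X" shows "nrm v \<le> nrm w + nrm (\<lambda>x. v x - w x)"
  using nrm_triangle[OF assms(2) diff_closed[OF assms]] by simp

end

section \<open>The space L2\<close>

lemma open_lebesgue: "open S \<Longrightarrow> S \<in> sets lebesgue"
  by auto

lemma L2_D:
  "f \<in> L2 \<Omega> \<Longrightarrow> f \<in> borel_measurable (lebesgue_on \<Omega>)"
  "f \<in> L2 \<Omega> \<Longrightarrow> integrable (lebesgue_on \<Omega>) (\<lambda>x. (f x)\<^sup>2)"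
  by (simp_all add: L2_def)

lemma L2_mult_integrable:
  assumes "v \<in> L2 \<Omega>" "w \<in> L2 \<Omega>" shows "integrable (lebesgue_on \<Omega>) (\<lambda>x. v x * w x)"
proof (rule Bochner_Integration.integrable_bound)
  show "integrable (lebesgue_on \<Omega>) (\<lambda>x. (v x)\<^sup>2 + (w x)\<^sup>2)"
    using assms by (intro Bochner_Integration.integrable_add L2_D)
  show "(\<lambda>x. v x * w x) \<in> borel_measurable (lebesgue_on \<Omega>)"
    using assms by (intro borel_measurable_times L2_D)
  have "\<bar>a * b\<bar> \<le> a\<^sup>2 + b\<^sup>2" for a b :: real
  proof -
    have "0 \<le> (\<bar>a\<bar> - \<bar>b\<bar>)\<^sup>2" by simp
    then have "2 * \<bar>a * b\<bar> \<le> a\<^sup>2 + b\<^sup>2" by (simp add: power2_diff abs_mult)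
    then show ?thesis using abs_ge_zero[of "a * b"] by linarith
  qed
  then show "AE x in lebesgue_on \<Omega>. norm (v x * w x) \<le> norm ((v x)\<^sup>2 + (w x)\<^sup>2)"
    by (intro AE_I2) (simp add: order_trans[OF _ abs_ge_self])
qed

lemma L2_add: assumes "v \<in> L2 \<Omega>" "w \<in> L2 \<Omega>" shows "(\<lambda>x. v x + w x) \<in> L2 \<Omega>"
proof -
  have "integrable (lebesgue_on \<Omega>) (\<lambda>x. (v x)\<^sup>2 + (w x)\<^sup>2 + 2 * (v x * w x))"
    using assms by (intro Bochner_Integration.integrable_add integrable_mult_right L2_D L2_mult_integrable)
  moreover have "(\<lambda>x. v x + w x) \<in> borel_measurable (lebesgue_on \<Omega>)"
    using assms by (intro borel_measurable_add L2_D)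
  ultimately show ?thesis by (simp add: L2_def power2_sum mult.assoc)
qed

lemma L2_scale: "v \<in> L2 \<Omega> \<Longrightarrow> (\<lambda>x. c * v x) \<in> L2 \<Omega>"
  using borel_measurable_times[OF borel_measurable_const L2_D(1)[of v \<Omega>], of c]
  by (simp add: L2_def power_mult_distrib)

interpretation L2: semi_inner_space "L2 \<Omega>" "L2_inner \<Omega>" for \<Omega> :: "'a::euclidean_space set"
proof
  show "L2_inner \<Omega> v w = L2_inner \<Omega> w v" for v w by (simp add: L2_inner_def mult.commute)
qed (auto simp: L2_add L2_scale L2_inner_def L2_mult_integrable distrib_right
      mult.assoc intro!: Bochner_Integration.integral_nonneg)

lemma L2_nrm: "L2.nrm \<Omega> v = L2_norm \<Omega> v"
  by (simp add: L2.nrm_def L2_norm_def)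

lemma L2_norm_sq: "(L2_norm \<Omega> v)\<^sup>2 = (LINT x|lebesgue_on \<Omega>. (v x)\<^sup>2)"
  by (simp add: L2_norm_def L2_inner_def power2_eq_square Bochner_Integration.integral_nonneg)

text \<open>Lebesgue measure is complete. Extension by zero reduces the restricted measure to the
  full one.\<close>

lemma borel_measurable_lebesgue_on_AE:
  fixes f g :: "'a::euclidean_space \<Rightarrow> real"
  assumes "S \<in> sets lebesgue" "f \<in> borel_measurable (lebesgue_on S)"
    and "AE x in lebesgue_on S. f x = g x"
  shows "g \<in> borel_measurable (lebesgue_on S)"
proof -
  have "(\<lambda>x. if x \<in> S then f x else 0) \<in> borel_measurable lebesgue"
    by (rule borel_measurable_if[OF assms(1), THEN iffD2, OF assms(2)])
  moreover have "AE x in lebesgue. (if x \<in> S then f x else 0) = (if x \<in> S then g x else 0)"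
    using assms(3) unfolding AE_lebesgue_on_iff[OF assms(1)] by eventually_elim auto
  ultimately have "(\<lambda>x. if x \<in> S then g x else 0) \<in> borel_measurable lebesgue"
    by (rule borel_measurable_AE)
  then show ?thesis by (rule borel_measurable_if[OF assms(1), THEN iffD1])
qed

lemma L2_cong_AE:
  assumes "S \<in> sets lebesgue" "f \<in> L2 S" "AE x in lebesgue_on S. f x = g x"
  shows "g \<in> L2 S"
proof -
  have m: "g \<in> borel_measurable (lebesgue_on S)"
    using borel_measurable_lebesgue_on_AE[OF assms(1) L2_D(1)[OF assms(2)] assms(3)] .
  have "integrable (lebesgue_on S) (\<lambda>x. (g x)\<^sup>2)"
    by (rule integrable_cong_AE_imp[OF L2_D(2)[OF assms(2)]])
      (use assms(3) m in \<open>auto elim!: eventually_mono\<close>)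
  with m show ?thesis by (simp add: L2_def)
qed

lemma L2_inner_cong_AE:
  assumes "v \<in> L2 \<Omega>" "v' \<in> L2 \<Omega>" "w \<in> L2 \<Omega>" "w' \<in> L2 \<Omega>"
    and "AE x in lebesgue_on \<Omega>. v x = v' x" "AE x in lebesgue_on \<Omega>. w x = w' x"
  shows "L2_inner \<Omega> v w = L2_inner \<Omega> v' w'"
  unfolding L2_inner_def
proof (intro integral_cong_AE borel_measurable_times L2_D assms(1-4))
  show "AE x in lebesgue_on \<Omega>. v x * w x = v' x * w' x"
    using assms(5,6) by eventually_elim simp
qed

text \<open>On a compact set, which has finite measure, \<bar>f\<bar> is at most 1 + f^2.\<close>

lemma L2_locally_integrable:
  fixes f :: "'a::euclidean_space \<Rightarrow> real"
  assumes \<Omega>: "\<Omega> \<in> sets lebesgue" and f: "f \<in> L2 \<Omega>" shows "locally_integrable \<Omega> f"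
  unfolding locally_integrable_def
proof (intro allI impI)
  fix K assume K: "compact K \<and> K \<subseteq> \<Omega>"
  then have Km: "K \<in> lmeasurable" using lmeasurable_compact by blast
  then have Ks: "K \<in> sets lebesgue" by blast
  have f2: "integrable lebesgue (\<lambda>x. indicator \<Omega> x * (f x)\<^sup>2)"
    by (rule integrable_lebesgue_on_indicator[OF \<Omega>, THEN iffD1, OF L2_D(2)[OF f]])
  have fm: "(\<lambda>x. if x \<in> \<Omega> then f x else 0) \<in> borel_measurable lebesgue"
    by (rule borel_measurable_if[OF \<Omega>, THEN iffD2, OF L2_D(1)[OF f]])
  have "integrable lebesgue (\<lambda>x. indicator K x * (if x \<in> \<Omega> then f x else 0))"
  proof (rule Bochner_Integration.integrable_bound)
    show "integrable lebesgue (\<lambda>x. indicator K x + indicator \<Omega> x * (f x)\<^sup>2)"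
      using f2 Km by (intro Bochner_Integration.integrable_add integrable_real_indicator)
        (auto simp: fmeasurable_def)
    show "(\<lambda>x. indicator K x * (if x \<in> \<Omega> then f x else 0)) \<in> borel_measurable lebesgue"
      using fm Ks by (intro borel_measurable_times borel_measurable_indicator)
    have "\<bar>a\<bar> \<le> \<bar>1 + a\<^sup>2\<bar>" for a :: real
    proof -
      have "0 \<le> (\<bar>a\<bar> - 1)\<^sup>2" by simp
      then have "2 * \<bar>a\<bar> \<le> 1 + a\<^sup>2" by (simp add: power2_diff)
      then show ?thesis using zero_le_power2[of a] by linarith
    qed
    then show "AE x in lebesgue. norm (indicator K x * (if x \<in> \<Omega> then f x else 0))
        \<le> norm (indicator K x + indicator \<Omega> x * (f x)\<^sup>2)"
      using K by (intro AE_I2) (auto split: split_indicator)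
  qed
  moreover have "(\<lambda>x. indicator K x * (if x \<in> \<Omega> then f x else 0)) = (\<lambda>x. indicator K x * f x)"
    using K by (auto intro!: ext split: split_indicator)
  ultimately show "integrable (lebesgue_on K) f"
    by (simp add: integrable_lebesgue_on_indicator[OF Ks])
qed

section \<open>Linearity of weak derivatives and the space H1\<close>

lemma has_weak_partial_add:
  assumes \<Omega>: "open \<Omega>" and b: "b \<in> Basis"
    and f: "has_weak_partial \<Omega> b f f'" and g: "has_weak_partial \<Omega> b g g'"
  shows "has_weak_partial \<Omega> b (\<lambda>x. f x + g x) (\<lambda>x. f' x + g' x)"
  unfolding has_weak_partial_def
proof (intro conjI ballI)
  have li: "locally_integrable \<Omega> f" "locally_integrable \<Omega> g" "locally_integrable \<Omega> f'" "locally_integrable \<Omega> g'"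
    using f g by (auto simp: has_weak_partial_def)
  then show "locally_integrable \<Omega> (\<lambda>x. f x + g x)" "locally_integrable \<Omega> (\<lambda>x. f' x + g' x)"
    by (auto simp: locally_integrable_def)
  fix \<phi> assume \<phi>: "\<phi> \<in> test_functions \<Omega>"
  note p = partial_test_function[OF \<phi> b]
  show "(LINT x|lebesgue_on \<Omega>. (f x + g x) * partial b \<phi> x) = - (LINT x|lebesgue_on \<Omega>. (f' x + g' x) * \<phi> x)"
    using f g \<phi> integrable_mult_test_function[OF \<Omega> li(1) p] integrable_mult_test_function[OF \<Omega> li(2) p]
      integrable_mult_test_function[OF \<Omega> li(3) \<phi>] integrable_mult_test_function[OF \<Omega> li(4) \<phi>]
    by (auto simp: has_weak_partial_def distrib_right)
qed

lemma has_weak_partial_scale: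
  assumes "has_weak_partial \<Omega> b f f'"
  shows "has_weak_partial \<Omega> b (\<lambda>x. c * f x) (\<lambda>x. c * f' x)"
  using assms by (auto simp: has_weak_partial_def locally_integrable_def mult.assoc)

lemma has_weak_partial_cong_AE:
  assumes \<Omega>: "open \<Omega>" and f: "has_weak_partial \<Omega> b f f'"
    and g: "locally_integrable \<Omega> g" "locally_integrable \<Omega> g'" and b: "b \<in> Basis"
    and ae: "AE x in lebesgue_on \<Omega>. f x = g x" "AE x in lebesgue_on \<Omega>. f' x = g' x"
  shows "has_weak_partial \<Omega> b g g'"
  unfolding has_weak_partial_def
proof (intro conjI ballI g)
  have li: "locally_integrable \<Omega> f" "locally_integrable \<Omega> f'"
    using f by (auto simp: has_weak_partial_def)
  fix \<phi> assume \<phi>: "\<phi> \<in> test_functions \<Omega>"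
  note p = partial_test_function[OF \<phi> b]
  have "(LINT x|lebesgue_on \<Omega>. g x * partial b \<phi> x) = (LINT x|lebesgue_on \<Omega>. f x * partial b \<phi> x)"
    using integrable_mult_test_function[OF \<Omega> g(1) p] integrable_mult_test_function[OF \<Omega> li(1) p] ae(1)
    by (intro integral_cong_AE) (auto elim!: eventually_mono)
  moreover have "(LINT x|lebesgue_on \<Omega>. g' x * \<phi> x) = (LINT x|lebesgue_on \<Omega>. f' x * \<phi> x)"
    using integrable_mult_test_function[OF \<Omega> g(2) \<phi>] integrable_mult_test_function[OF \<Omega> li(2) \<phi>] ae(2)
    by (intro integral_cong_AE) (auto elim!: eventually_mono)
  ultimately show "(LINT x|lebesgue_on \<Omega>. g x * partial b \<phi> x) = - (LINT x|lebesgue_on \<Omega>. g' x * \<phi> x)"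
    using f \<phi> by (auto simp: has_weak_partial_def)
qed

lemma weak_partialI: "has_weak_partial \<Omega> b f g \<Longrightarrow> has_weak_partial \<Omega> b f (weak_partial \<Omega> b f)"
  unfolding weak_partial_def by (rule someI[where P = "has_weak_partial \<Omega> b f"])

text \<open>The bridge from the arbitrary choice in \<open>weak_partial\<close> to any derivative
  that can be exhibited.\<close>

lemma weak_partial_AE:
  "open \<Omega> \<Longrightarrow> has_weak_partial \<Omega> b f g \<Longrightarrow> AE x in lebesgue_on \<Omega>. weak_partial \<Omega> b f x = g x"
  using has_weak_partial_unique weak_partialI by blast

lemma H_k_1: "H_k \<Omega> 1 = {f \<in> L2 \<Omega>. \<forall>b\<in>Basis. \<exists>g\<in>L2 \<Omega>. has_weak_partial \<Omega> b f g}"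
  by (simp only: One_nat_def H_k.simps)

lemma H1_L2: "v \<in> H_k \<Omega> 1 \<Longrightarrow> v \<in> L2 \<Omega>"
  unfolding H_k_1 by blast

lemma H1_weak_partial:
  assumes "open \<Omega>" "v \<in> H_k \<Omega> 1" "b \<in> Basis"
  shows "has_weak_partial \<Omega> b v (weak_partial \<Omega> b v)" "weak_partial \<Omega> b v \<in> L2 \<Omega>"
proof -
  obtain g where g: "g \<in> L2 \<Omega>" "has_weak_partial \<Omega> b v g" using assms unfolding H_k_1 by blast
  show "has_weak_partial \<Omega> b v (weak_partial \<Omega> b v)" by (rule weak_partialI[OF g(2)])
  have "AE x in lebesgue_on \<Omega>. g x = weak_partial \<Omega> b v x"
    using weak_partial_AE[OF assms(1) g(2)] by eventually_elim simp
  then show "weak_partial \<Omega> b v \<in> L2 \<Omega>"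
    by (rule L2_cong_AE[OF open_lebesgue[OF assms(1)] g(1)])
qed

lemma H1_add: "open \<Omega> \<Longrightarrow> v \<in> H_k \<Omega> 1 \<Longrightarrow> w \<in> H_k \<Omega> 1 \<Longrightarrow> (\<lambda>x. v x + w x) \<in> H_k \<Omega> 1"
  unfolding H_k_1 by (fast intro: L2_add has_weak_partial_add)

lemma H1_scale: "v \<in> H_k \<Omega> 1 \<Longrightarrow> (\<lambda>x. c * v x) \<in> H_k \<Omega> 1"
  unfolding H_k_1 by (fast intro: L2_scale has_weak_partial_scale)

lemma weak_partial_add_AE:
  assumes "open \<Omega>" "v \<in> H_k \<Omega> 1" "w \<in> H_k \<Omega> 1" "b \<in> Basis"
  shows "AE x in lebesgue_on \<Omega>. weak_partial \<Omega> b (\<lambda>x. v x + w x) x = weak_partial \<Omega> b v x + weak_partial \<Omega> b w x"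
  using assms by (intro weak_partial_AE has_weak_partial_add H1_weak_partial)

lemma weak_partial_scale_AE:
  assumes "open \<Omega>" "v \<in> H_k \<Omega> 1" "b \<in> Basis"
  shows "AE x in lebesgue_on \<Omega>. weak_partial \<Omega> b (\<lambda>x. c * v x) x = c * weak_partial \<Omega> b v x"
  using assms by (intro weak_partial_AE has_weak_partial_scale H1_weak_partial)

text \<open>The representative chosen for a sum is not the sum of the chosen representatives. The
  two agree almost everywhere, and the L2 product does not see the difference.\<close>

lemma grad_inner_space:
  assumes \<Omega>: "open \<Omega>" shows "semi_inner_space (H_k \<Omega> 1) (grad_inner \<Omega>)"
proof
  fix v w z c assume v: "v \<in> H_k \<Omega> 1"
  show "(\<lambda>x. c * v x) \<in> H_k \<Omega> 1" by (rule H1_scale[OF v])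
  show "0 \<le> grad_inner \<Omega> v v"
    unfolding grad_inner_def by (intro sum_nonneg L2.B_nonneg H1_weak_partial \<Omega> v)
  { assume z: "z \<in> H_k \<Omega> 1"
    have "L2_inner \<Omega> (weak_partial \<Omega> b (\<lambda>x. c * v x)) (weak_partial \<Omega> b z)
      = c * L2_inner \<Omega> (weak_partial \<Omega> b v) (weak_partial \<Omega> b z)" if b: "b \<in> Basis" for b
    proof -
      have "L2_inner \<Omega> (weak_partial \<Omega> b (\<lambda>x. c * v x)) (weak_partial \<Omega> b z)
        = L2_inner \<Omega> (\<lambda>x. c * weak_partial \<Omega> b v x) (weak_partial \<Omega> b z)"
        using \<Omega> v z b by (intro L2_inner_cong_AE weak_partial_scale_AE H1_weak_partial H1_scale L2_scale) auto
      then show ?thesis using \<Omega> v z b by (simp add: L2.B_scale H1_weak_partial)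
    qed
    then show "grad_inner \<Omega> (\<lambda>x. c * v x) z = c * grad_inner \<Omega> v z"
      by (simp add: grad_inner_def sum_distrib_left) }
  assume w: "w \<in> H_k \<Omega> 1"
  show "(\<lambda>x. v x + w x) \<in> H_k \<Omega> 1" by (rule H1_add[OF \<Omega> v w])
  assume z: "z \<in> H_k \<Omega> 1"
  have "L2_inner \<Omega> (weak_partial \<Omega> b (\<lambda>x. v x + w x)) (weak_partial \<Omega> b z)
    = L2_inner \<Omega> (weak_partial \<Omega> b v) (weak_partial \<Omega> b z) + L2_inner \<Omega> (weak_partial \<Omega> b w) (weak_partial \<Omega> b z)"
    if b: "b \<in> Basis" for b
  proof -
    have "L2_inner \<Omega> (weak_partial \<Omega> b (\<lambda>x. v x + w x)) (weak_partial \<Omega> b z)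
      = L2_inner \<Omega> (\<lambda>x. weak_partial \<Omega> b v x + weak_partial \<Omega> b w x) (weak_partial \<Omega> b z)"
      using \<Omega> v w z b by (intro L2_inner_cong_AE weak_partial_add_AE H1_weak_partial H1_add L2_add) auto
    then show ?thesis using \<Omega> v w z b by (simp add: L2.B_add H1_weak_partial)
  qed
  then show "grad_inner \<Omega> (\<lambda>x. v x + w x) z = grad_inner \<Omega> v z + grad_inner \<Omega> w z"
    by (simp add: grad_inner_def sum.distrib)
next
  fix v w show "grad_inner \<Omega> v w = grad_inner \<Omega> w v"
    by (simp add: grad_inner_def L2.B_sym)
qed

definition H1_inner :: "'a::euclidean_space set \<Rightarrow> ('a \<Rightarrow> real) \<Rightarrow> ('a \<Rightarrow> real) \<Rightarrow> real" where
  "H1_inner \<Omega> v w = L2_inner \<Omega> v w + grad_inner \<Omega> v w"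

lemma H1_inner_space:
  assumes \<Omega>: "open \<Omega>" shows "semi_inner_space (H_k \<Omega> 1) (H1_inner \<Omega>)"
proof -
  interpret g: semi_inner_space "H_k \<Omega> 1" "grad_inner \<Omega>" by (rule grad_inner_space[OF \<Omega>])
  show ?thesis
  proof
    fix v w z c assume v: "v \<in> H_k \<Omega> 1"
    show "(\<lambda>x. c * v x) \<in> H_k \<Omega> 1" by (rule H1_scale[OF v])
    show "0 \<le> H1_inner \<Omega> v v"
      unfolding H1_inner_def by (intro add_nonneg_nonneg L2.B_nonneg g.B_nonneg v H1_L2[OF v])
    { assume z: "z \<in> H_k \<Omega> 1"
      show "H1_inner \<Omega> (\<lambda>x. c * v x) z = c * H1_inner \<Omega> v z"
        unfolding H1_inner_def L2.B_scale[OF H1_L2[OF v] H1_L2[OF z]] g.B_scale[OF v z]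
        by (simp add: distrib_left) }
    assume w: "w \<in> H_k \<Omega> 1"
    show "(\<lambda>x. v x + w x) \<in> H_k \<Omega> 1" by (rule H1_add[OF \<Omega> v w])
    assume z: "z \<in> H_k \<Omega> 1"
    show "H1_inner \<Omega> (\<lambda>x. v x + w x) z = H1_inner \<Omega> v z + H1_inner \<Omega> w z"
      unfolding H1_inner_def L2.B_add[OF H1_L2[OF v] H1_L2[OF w] H1_L2[OF z]] g.B_add[OF v w z]
      by simp
  next
    fix v w show "H1_inner \<Omega> v w = H1_inner \<Omega> w v"
      unfolding H1_inner_def L2.B_sym[of \<Omega> v w] g.B_sym[of v w] by (rule refl)
  qed
qed

lemma test_function_H1:
  assumes \<Omega>: "open \<Omega>" and \<phi>: "\<phi> \<in> test_functions \<Omega>"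
  shows "\<phi> \<in> H_k \<Omega> 1" and "\<phi> \<in> L2 \<Omega>"
proof -
  have L2: "\<zeta> \<in> L2 \<Omega>" if \<zeta>: "\<zeta> \<in> test_functions \<Omega>" for \<zeta>
  proof -
    have \<Omega>': "\<Omega> \<in> sets lebesgue" using \<Omega> by auto
    have "\<zeta> \<in> borel_measurable lebesgue"
      by (intro continuous_imp_lebesgue_measurable smooth_continuous test_functionsD(1)[OF \<zeta>])
    then have "\<zeta> \<in> borel_measurable (lebesgue_on \<Omega>)" by (rule measurable_restrict_space1)
    moreover have "integrable (lebesgue_on \<Omega>) (\<lambda>x. \<zeta> x * \<zeta> x)"
      by (intro integrable_mult_test_function \<Omega> continuous_locally_integrable smooth_continuous test_functionsD(1)[OF \<zeta>] \<zeta>)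
    ultimately show ?thesis by (simp add: L2_def power2_eq_square)
  qed
  show "\<phi> \<in> L2 \<Omega>" by (rule L2[OF \<phi>])
  show "\<phi> \<in> H_k \<Omega> 1"
    unfolding H_k_1
  proof (intro CollectI conjI ballI)
    fix b :: 'a assume b: "b \<in> Basis"
    show "\<exists>g\<in>L2 \<Omega>. has_weak_partial \<Omega> b \<phi> g"
      using L2[OF partial_test_function[OF \<phi> b]] has_weak_partial_smooth[OF \<Omega> test_functionsD(1)[OF \<phi>] b] by blast
  qed (rule L2[OF \<phi>])
qed

lemma weak_partial_test_function_AE:
  assumes \<Omega>: "open \<Omega>" and \<phi>: "\<phi> \<in> test_functions \<Omega>" and b: "b \<in> Basis"
  shows "AE x in lebesgue_on \<Omega>. weak_partial \<Omega> b \<phi> x = partial b \<phi> x"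
  by (intro weak_partial_AE has_weak_partial_smooth \<Omega> b test_functionsD(1)[OF \<phi>])

lemma H1_nrm:
  assumes "open \<Omega>" shows "semi_inner_space.nrm (H1_inner \<Omega>) = H1_norm \<Omega>"
  by (rule ext) (simp add: semi_inner_space.nrm_def[OF H1_inner_space[OF assms]] H1_norm_def H1_inner_def)

section \<open>The closure of the test functions in H1\<close>

lemma H10_D:
  assumes "v \<in> H10 \<Omega>" shows "v \<in> H_k \<Omega> 1" and "v \<in> L2 \<Omega>"
  using assms H1_L2 unfolding H10_def by blast+

lemma H10_approxE:
  assumes "v \<in> H10 \<Omega>" "0 < \<epsilon>"
  obtains \<phi> where "\<phi> \<in> test_functions \<Omega>" "H1_norm \<Omega> (\<lambda>x. v x - \<phi> x) < \<epsilon>"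
proof -
  have "\<exists>\<phi>\<in>test_functions \<Omega>. H1_norm \<Omega> (\<lambda>x. v x - \<phi> x) < \<epsilon>"
    using assms(1) unfolding H10_def by (elim CollectE conjE allE[of _ \<epsilon>] impE) (rule assms(2))
  then show ?thesis using that by (elim bexE) 
qed

lemma H10_approx:
  assumes "v \<in> H10 \<Omega>"
  obtains \<phi> where "\<And>n. \<phi> n \<in> test_functions \<Omega>" "(\<lambda>n. H1_norm \<Omega> (\<lambda>x. v x - \<phi> n x)) \<longlonglongrightarrow> 0"
proof -
  have "\<forall>n. \<exists>\<phi>\<in>test_functions \<Omega>. H1_norm \<Omega> (\<lambda>x. v x - \<phi> x) < inverse (real (Suc n))"
    using assms by (auto simp: H10_def simp del: of_nat_Suc)
  then obtain \<phi> where \<phi>: "\<And>n. \<phi> n \<in> test_functions \<Omega>" "\<And>n. H1_norm \<Omega> (\<lambda>x. v x - \<phi> n x) < inverse (real (Suc n))"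
    by metis
  have "(\<lambda>n. H1_norm \<Omega> (\<lambda>x. v x - \<phi> n x)) \<longlonglongrightarrow> 0"
  proof (rule Lim_null_comparison[OF _ LIMSEQ_inverse_real_of_nat])
    show "eventually (\<lambda>n. norm (H1_norm \<Omega> (\<lambda>x. v x - \<phi> n x)) \<le> inverse (real (Suc n))) sequentially"
    proof (rule always_eventually, rule allI)
      fix n
      have "0 \<le> L2_inner \<Omega> w w" "0 \<le> grad_inner \<Omega> w w" for w
        by (auto simp: L2_inner_def grad_inner_def intro!: Bochner_Integration.integral_nonneg sum_nonneg)
      then have "0 \<le> H1_norm \<Omega> w" for w by (simp add: H1_norm_def)
      then show "norm (H1_norm \<Omega> (\<lambda>x. v x - \<phi> n x)) \<le> inverse (real (Suc n))"
        using \<phi>(2)[of n] by (simp del: of_nat_Suc)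
    qed
  qed
  then show ?thesis using that \<phi>(1) by blast
qed

lemma H10_add:
  assumes \<Omega>: "open \<Omega>" and v: "v \<in> H10 \<Omega>" and w: "w \<in> H10 \<Omega>"
  shows "(\<lambda>x. v x + w x) \<in> H10 \<Omega>"
proof -
  interpret H: semi_inner_space "H_k \<Omega> 1" "H1_inner \<Omega>" by (rule H1_inner_space[OF \<Omega>])
  show ?thesis
    unfolding H10_def
  proof (intro CollectI conjI allI impI)
    show "(\<lambda>x. v x + w x) \<in> H_k \<Omega> 1" by (intro H1_add \<Omega> H10_D v w)
    fix \<epsilon> :: real assume e: "\<epsilon> > 0"
    obtain \<phi> where \<phi>: "\<phi> \<in> test_functions \<Omega>" "H1_norm \<Omega> (\<lambda>x. v x - \<phi> x) < \<epsilon> / 2"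
      by (rule H10_approxE[OF v half_gt_zero[OF e]])
    obtain \<zeta> where \<zeta>: "\<zeta> \<in> test_functions \<Omega>" "H1_norm \<Omega> (\<lambda>x. w x - \<zeta> x) < \<epsilon> / 2"
      by (rule H10_approxE[OF w half_gt_zero[OF e]])
    have "H1_norm \<Omega> (\<lambda>x. (v x - \<phi> x) + (w x - \<zeta> x)) \<le> H1_norm \<Omega> (\<lambda>x. v x - \<phi> x) + H1_norm \<Omega> (\<lambda>x. w x - \<zeta> x)"
      unfolding H1_nrm[OF \<Omega>, symmetric]
      by (intro H.nrm_triangle H.diff_closed test_function_H1 \<Omega> \<phi> \<zeta> H10_D v w)
    then have "H1_norm \<Omega> (\<lambda>x. (v x + w x) - (\<phi> x + \<zeta> x)) < \<epsilon>"
      using \<phi>(2) \<zeta>(2) by (simp add: algebra_simps)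
    then show "\<exists>\<phi>\<in>test_functions \<Omega>. H1_norm \<Omega> (\<lambda>x. v x + w x - \<phi> x) < \<epsilon>"
      by (rule bexI[where x = "\<lambda>x. \<phi> x + \<zeta> x"]) (rule test_function_add[OF \<phi>(1) \<zeta>(1)])
  qed
qed

lemma H10_scale:
  assumes \<Omega>: "open \<Omega>" and v: "v \<in> H10 \<Omega>"
  shows "(\<lambda>x. c * v x) \<in> H10 \<Omega>"
proof -
  interpret H: semi_inner_space "H_k \<Omega> 1" "H1_inner \<Omega>" by (rule H1_inner_space[OF \<Omega>])
  show ?thesis
    unfolding H10_def
  proof (intro CollectI conjI allI impI)
    show "(\<lambda>x. c * v x) \<in> H_k \<Omega> 1" by (intro H1_scale H10_D v)
    fix \<epsilon> :: real assume e: "\<epsilon> > 0"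
    have "\<epsilon> / (\<bar>c\<bar> + 1) > 0" using e by simp
    then obtain \<phi> where \<phi>: "\<phi> \<in> test_functions \<Omega>" "H1_norm \<Omega> (\<lambda>x. v x - \<phi> x) < \<epsilon> / (\<bar>c\<bar> + 1)"
      by (rule H10_approxE[OF v])
    have d: "(\<lambda>x. v x - \<phi> x) \<in> H_k \<Omega> 1"
      by (intro H.diff_closed test_function_H1 \<Omega> \<phi> H10_D v)
    have "H1_norm \<Omega> (\<lambda>x. c * (v x - \<phi> x)) = \<bar>c\<bar> * H1_norm \<Omega> (\<lambda>x. v x - \<phi> x)"
      unfolding H1_nrm[OF \<Omega>, symmetric] by (rule H.nrm_scale[OF d])
    also have "\<dots> \<le> (\<bar>c\<bar> + 1) * H1_norm \<Omega> (\<lambda>x. v x - \<phi> x)"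
      using H.nrm_nonneg[OF d] unfolding H1_nrm[OF \<Omega>] by (intro mult_right_mono) auto
    also have "\<dots> < \<epsilon>" using \<phi>(2) by (simp add: field_simps)
    finally have "H1_norm \<Omega> (\<lambda>x. c * v x - c * \<phi> x) < \<epsilon>" by (simp add: right_diff_distrib)
    then show "\<exists>\<phi>\<in>test_functions \<Omega>. H1_norm \<Omega> (\<lambda>x. c * v x - \<phi> x) < \<epsilon>"
      by (rule bexI[where x = "\<lambda>x. c * \<phi> x"]) (rule test_function_scale[OF \<phi>(1)])
  qed
qed

lemma H10_diff:
  assumes \<Omega>: "open \<Omega>" and v: "v \<in> H10 \<Omega>" and w: "w \<in> H10 \<Omega>"
  shows "(\<lambda>x. v x - w x) \<in> H10 \<Omega>"
  using H10_add[OF \<Omega> v H10_scale[OF \<Omega> w, of "-1"]] by simp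

lemma H1_norm_bounds:
  assumes \<Omega>: "open \<Omega>" and v: "v \<in> H_k \<Omega> 1"
  shows "0 \<le> H1_norm \<Omega> v" "L2_norm \<Omega> v \<le> H1_norm \<Omega> v"
    and "(H1_norm \<Omega> v)\<^sup>2 = L2_inner \<Omega> v v + grad_inner \<Omega> v v"
    and "grad_inner \<Omega> v v \<ge> 0" "L2_inner \<Omega> v v \<ge> 0" "0 \<le> L2_norm \<Omega> v"
proof -
  interpret g: semi_inner_space "H_k \<Omega> 1" "grad_inner \<Omega>" by (rule grad_inner_space[OF \<Omega>])
  have L: "v \<in> L2 \<Omega>" by (rule H1_L2[OF v])
  note * = g.B_nonneg[OF v] L2.B_nonneg[OF L]
  show "0 \<le> H1_norm \<Omega> v" "L2_norm \<Omega> v \<le> H1_norm \<Omega> v"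
    "(H1_norm \<Omega> v)\<^sup>2 = L2_inner \<Omega> v v + grad_inner \<Omega> v v"
    using * by (simp_all add: H1_norm_def L2_norm_def)
  show "grad_inner \<Omega> v v \<ge> 0" "L2_inner \<Omega> v v \<ge> 0" "0 \<le> L2_norm \<Omega> v" using * by (simp_all add: L2_norm_def)
qed

section \<open>The subcritical Sobolev embedding\<close>

definition grad_sq :: "('a::euclidean_space \<Rightarrow> real) \<Rightarrow> 'a \<Rightarrow> real" where
  "grad_sq f x = (\<Sum>b\<in>Basis. (partial b f x)\<^sup>2)"

lemma grad_sq_nonneg: "0 \<le> grad_sq f x"
  by (simp add: grad_sq_def sum_nonneg)

lemma grad_sq_continuous: "smooth f \<Longrightarrow> continuous_on S (grad_sq f)"
  unfolding grad_sq_def[abs_def]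
  by (intro continuous_on_sum continuous_on_power smooth_continuous smooth_partial)

lemma partial_sq_le:
  assumes "smooth f" shows "(partial y f x)\<^sup>2 \<le> (norm y)\<^sup>2 * grad_sq f x"
proof -
  have "partial y f x = (\<Sum>b\<in>Basis. (y \<bullet> b) * partial b f x)"
    by (rule partial_expand[OF smooth_differentiable[OF assms]])
  also have "\<dots>\<^sup>2 \<le> (\<Sum>b\<in>Basis. (y \<bullet> b)\<^sup>2) * (\<Sum>b\<in>Basis. (partial b f x)\<^sup>2)"
    by (rule Cauchy_Schwarz_ineq_sum)
  also have "(\<Sum>b\<in>Basis. (y \<bullet> b)\<^sup>2) = (norm y)\<^sup>2"
    unfolding power2_norm_eq_inner euclidean_inner[of y y] by (simp add: power2_eq_square)
  finally show ?thesis by (simp add: grad_sq_def)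
qed

text \<open>Jensen's inequality on the unit interval: with m the mean of \<open>p\<close>, expand
  the nonnegative integral of (p - m)^2.\<close>

lemma integral_unit_interval_sq_le:
  fixes p :: "real \<Rightarrow> real"
  assumes "continuous_on {0..1} p"
  shows "(LINT s|lborel. indicator {0..1} s * p s)\<^sup>2 \<le> (LINT s|lborel. indicator {0..1} s * (p s)\<^sup>2)"
    and "integrable lborel (\<lambda>s. indicator {0..1} s * (p s)\<^sup>2)"
proof -
  let ?m = "LINT s|lborel. indicator {0..1} s * p s"
  have i1: "integrable lborel (\<lambda>s. indicator {0..1} s * p s)"
    using borel_integrable_compact[OF compact_Icc assms] by simp
  show i2: "integrable lborel (\<lambda>s. indicator {0..1} s * (p s)\<^sup>2)"
    using borel_integrable_compact[OF compact_Icc continuous_on_power[OF assms], of 2] by simp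
  have i3: "integrable lborel (\<lambda>s. ?m\<^sup>2 * indicator {0..1::real} s)"
    by (intro integrable_mult_right integrable_real_indicator) auto
  have "0 \<le> (LINT s|lborel. indicator {0..1} s * (p s - ?m)\<^sup>2)"
    by (intro Bochner_Integration.integral_nonneg) auto
  also have "\<dots> = (LINT s|lborel. indicator {0..1} s * (p s)\<^sup>2 - 2 * ?m * (indicator {0..1} s * p s) + ?m\<^sup>2 * indicator {0..1} s)"
    by (intro Bochner_Integration.integral_cong) (auto simp: power2_diff algebra_simps)
  also have "\<dots> = (LINT s|lborel. indicator {0..1} s * (p s)\<^sup>2) - 2 * ?m * ?m + ?m\<^sup>2"
    using i1 i2 i3 by simp
  finally show "?m\<^sup>2 \<le> (LINT s|lborel. indicator {0..1} s * (p s)\<^sup>2)" by (simp add: power2_eq_square)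
qed

text \<open>Write the increment as an integral along the segment from x to x + y, apply Jensen, and
  exchange the integrals. Translation invariance then removes the dependence on the position along
  the segment. Nonnegative integrals are used, so either side may be infinite.\<close>

lemma translation_estimate:
  fixes \<phi> :: "'a::euclidean_space \<Rightarrow> real"
  assumes \<phi>: "smooth \<phi>"
  shows "(\<integral>\<^sup>+x. ennreal ((\<phi> (x + y) - \<phi> x)\<^sup>2) \<partial>lborel)
    \<le> ennreal ((norm y)\<^sup>2) * (\<integral>\<^sup>+x. ennreal (grad_sq \<phi> x) \<partial>lborel)"
proof -
  have [measurable]: "grad_sq \<phi> \<in> borel_measurable borel"
    by (intro borel_measurable_continuous_onI grad_sq_continuous \<phi>)
  have "(\<integral>\<^sup>+x. ennreal ((\<phi> (x + y) - \<phi> x)\<^sup>2) \<partial>lborel)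
    \<le> (\<integral>\<^sup>+x. (\<integral>\<^sup>+s. ennreal ((norm y)\<^sup>2) * (indicator {0..1::real} s * ennreal (grad_sq \<phi> (x + s *\<^sub>R y))) \<partial>lborel) \<partial>lborel)"
  proof (rule nn_integral_mono)
    fix x
    let ?p = "\<lambda>s. partial y \<phi> (x + s *\<^sub>R y)"
    have c: "continuous_on {0..1} ?p"
      by (intro continuous_on_compose2[OF continuous_partial[OF \<phi>]] continuous_intros) auto
    have "ennreal ((\<phi> (x + y) - \<phi> x)\<^sup>2) \<le> ennreal (LINT s|lborel. indicator {0..1} s * (?p s)\<^sup>2)"
      using integral_unit_interval_sq_le(1)[OF c] smooth_FTC_line[OF \<phi>, of y x]
      by (intro ennreal_leI) simp
    also have "\<dots> = (\<integral>\<^sup>+s. ennreal (indicator {0..1} s * (?p s)\<^sup>2) \<partial>lborel)"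
      by (rule nn_integral_eq_integral[symmetric, OF integral_unit_interval_sq_le(2)[OF c]]) auto
    also have "\<dots> \<le> (\<integral>\<^sup>+s. ennreal ((norm y)\<^sup>2) * (indicator {0..1::real} s * ennreal (grad_sq \<phi> (x + s *\<^sub>R y))) \<partial>lborel)"
    proof (rule nn_integral_mono)
      fix s
      have "ennreal ((?p s)\<^sup>2) \<le> ennreal ((norm y)\<^sup>2) * ennreal (grad_sq \<phi> (x + s *\<^sub>R y))"
        using ennreal_leI[OF partial_sq_le[OF \<phi>, of y "x + s *\<^sub>R y"]]
        by (simp add: ennreal_mult grad_sq_nonneg)
      then show "ennreal (indicator {0..1} s * (?p s)\<^sup>2)
          \<le> ennreal ((norm y)\<^sup>2) * (indicator {0..1::real} s * ennreal (grad_sq \<phi> (x + s *\<^sub>R y)))"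
        by (auto split: split_indicator)
    qed
    finally show "ennreal ((\<phi> (x + y) - \<phi> x)\<^sup>2)
      \<le> (\<integral>\<^sup>+s. ennreal ((norm y)\<^sup>2) * (indicator {0..1::real} s * ennreal (grad_sq \<phi> (x + s *\<^sub>R y))) \<partial>lborel)" .
  qed
  also have "\<dots> = (\<integral>\<^sup>+s. (\<integral>\<^sup>+x. ennreal ((norm y)\<^sup>2) * (indicator {0..1::real} s * ennreal (grad_sq \<phi> (x + s *\<^sub>R y))) \<partial>lborel) \<partial>lborel)"
    by (rule lborel_pair.Fubini') measurable
  also have "\<dots> = (\<integral>\<^sup>+s. ennreal ((norm y)\<^sup>2) * (indicator {0..1::real} s * (\<integral>\<^sup>+x. ennreal (grad_sq \<phi> x) \<partial>lborel)) \<partial>lborel)"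
  proof (rule nn_integral_cong)
    fix s :: real
    have "(\<integral>\<^sup>+x. ennreal (grad_sq \<phi> (x + s *\<^sub>R y)) \<partial>lborel) = (\<integral>\<^sup>+x. ennreal (grad_sq \<phi> x) \<partial>lborel)"
      by (rule lborel_nn_integral_translate) measurable
    then show "(\<integral>\<^sup>+x. ennreal ((norm y)\<^sup>2) * (indicator {0..1::real} s * ennreal (grad_sq \<phi> (x + s *\<^sub>R y))) \<partial>lborel)
      = ennreal ((norm y)\<^sup>2) * (indicator {0..1::real} s * (\<integral>\<^sup>+x. ennreal (grad_sq \<phi> x) \<partial>lborel))"
      by (simp add: nn_integral_cmult)
  qed
  also have "\<dots> = ennreal ((norm y)\<^sup>2) * (\<integral>\<^sup>+x. ennreal (grad_sq \<phi> x) \<partial>lborel)"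
    by (simp add: nn_integral_cmult nn_integral_multc)
  finally show ?thesis .
qed

text \<open>
  The radius \<open>\<rho>\<close> is such that, by Chebyshev, \<open>\<bar>\<phi>\<bar>\<close> exceeds \<open>\<kappa> / 2\<close> on at most half of each ball of radius
  \<open>\<rho>\<close>. At a point where \<open>\<bar>\<phi>\<bar> > \<kappa>\<close>, half of the translates by \<open>y \<in> ball 0 \<rho>\<close> then change \<open>\<phi>\<close> by
  at least \<open>\<kappa> / 2\<close>, and the translation estimate bounds the measure of such points.
\<close>

lemma superlevel_set_bound:
  fixes \<phi> :: "'a::euclidean_space \<Rightarrow> real"
  assumes \<phi>: "smooth \<phi>" and r: "r > 0" and C: "C > 0" and \<kappa>: "\<kappa> > 0" and \<rho>: "\<rho> > 0"
    and Cr: "(\<integral>\<^sup>+x. ennreal (\<bar>\<phi> x\<bar> powr r) \<partial>lborel) \<le> ennreal C"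
    and grad: "(\<integral>\<^sup>+x. ennreal (grad_sq \<phi> x) \<partial>lborel) \<le> 1"
    and vol: "unit_ball_vol DIM('a) * \<rho> ^ DIM('a) = 2 * C * (2 / \<kappa>) powr r"
  shows "emeasure lborel {x. \<kappa> < \<bar>\<phi> x\<bar>} \<le> ennreal (8 * \<rho>\<^sup>2 / \<kappa>\<^sup>2)"
proof -
  have [measurable]: "\<phi> \<in> borel_measurable borel"
    by (intro borel_measurable_continuous_onI smooth_continuous \<phi>)
  define v where "v = unit_ball_vol DIM('a) * \<rho> ^ DIM('a)"
  have v: "v > 0" unfolding v_def using \<rho> by simp
  have ball: "emeasure lborel (ball (0::'a) \<rho>) = ennreal v"
    using emeasure_ball[of \<rho> "0::'a"] \<rho> by (simp add: v_def)
  let ?B = "ball (0::'a) \<rho>"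
  have [measurable]: "?B \<in> sets borel" by simp
  let ?J = "\<lambda>x. \<integral>\<^sup>+y. indicator ?B y * ennreal ((\<phi> (x + y) - \<phi> x)\<^sup>2) \<partial>lborel"
  have point: "ennreal (v / 2) * indicator {x. \<kappa> < \<bar>\<phi> x\<bar>} x \<le> ennreal (4 / \<kappa>\<^sup>2) * ?J x" for x
  proof (cases "\<kappa> < \<bar>\<phi> x\<bar>")
    case True
    \<comment> \<open>Either the translated value is at least \<kappa>/2 in modulus, and the first
      summand is at least 1, or the increment is, and the second one is.\<close>
    have one: "1 \<le> (2 / \<kappa>) powr r * \<bar>\<phi> (x + y)\<bar> powr r + 4 / \<kappa>\<^sup>2 * (\<phi> (x + y) - \<phi> x)\<^sup>2" for y
    proof (cases "\<bar>\<phi> (x + y)\<bar> \<ge> \<kappa> / 2")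
      case True
      have "1 powr r \<le> (2 / \<kappa> * \<bar>\<phi> (x + y)\<bar>) powr r"
        using True \<kappa> r by (intro powr_mono2) (auto simp: field_simps)
      also have "\<dots> = (2 / \<kappa>) powr r * \<bar>\<phi> (x + y)\<bar> powr r" using \<kappa> by (intro powr_mult)
      finally show ?thesis by (simp add: add_increasing2)
    next
      case False
      then have "\<bar>\<phi> (x + y) - \<phi> x\<bar> \<ge> \<kappa> / 2" using True by linarith
      then have "(\<kappa> / 2)\<^sup>2 \<le> (\<phi> (x + y) - \<phi> x)\<^sup>2" using \<kappa> by (metis abs_le_square_iff abs_of_pos half_gt_zero)
      then have "1 \<le> 4 / \<kappa>\<^sup>2 * (\<phi> (x + y) - \<phi> x)\<^sup>2" using \<kappa> by (simp add: field_simps power2_eq_square)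
      then show ?thesis by (simp add: add_increasing)
    qed
    \<comment> \<open>The volume is split into halves because the first integral on the right will
      be bounded by one half, which can then be cancelled among finite extended reals.\<close>
    have "ennreal (v / 2) + ennreal (v / 2) = (\<integral>\<^sup>+y. indicator ?B y \<partial>lborel)"
      using v ball by (simp add: ennreal_plus[symmetric] del: ennreal_plus)
    also have "\<dots> \<le> (\<integral>\<^sup>+y. ennreal ((2 / \<kappa>) powr r) * ennreal (\<bar>\<phi> (y + x)\<bar> powr r)
        + ennreal (4 / \<kappa>\<^sup>2) * (indicator ?B y * ennreal ((\<phi> (x + y) - \<phi> x)\<^sup>2)) \<partial>lborel)"
    proof (rule nn_integral_mono)
      fix y
      have "ennreal 1 \<le> ennreal ((2 / \<kappa>) powr r * \<bar>\<phi> (x + y)\<bar> powr r + 4 / \<kappa>\<^sup>2 * (\<phi> (x + y) - \<phi> x)\<^sup>2)"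
        using one by (intro ennreal_leI)
      also have "\<dots> = ennreal ((2 / \<kappa>) powr r) * ennreal (\<bar>\<phi> (x + y)\<bar> powr r) + ennreal (4 / \<kappa>\<^sup>2) * ennreal ((\<phi> (x + y) - \<phi> x)\<^sup>2)"
        by (simp add: ennreal_plus ennreal_mult del: times_divide_eq_left times_divide_eq_right)
      finally show "indicator ?B y \<le> ennreal ((2 / \<kappa>) powr r) * ennreal (\<bar>\<phi> (y + x)\<bar> powr r)
        + ennreal (4 / \<kappa>\<^sup>2) * (indicator ?B y * ennreal ((\<phi> (x + y) - \<phi> x)\<^sup>2))"
        by (auto split: split_indicator simp: add.commute)
    qed
    also have "\<dots> = ennreal ((2 / \<kappa>) powr r) * (\<integral>\<^sup>+y. ennreal (\<bar>\<phi> (y + x)\<bar> powr r) \<partial>lborel) + ennreal (4 / \<kappa>\<^sup>2) * ?J x"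
      by (subst nn_integral_add, measurable, subst (1 2) nn_integral_cmult, measurable)
    also have "(\<integral>\<^sup>+y. ennreal (\<bar>\<phi> (y + x)\<bar> powr r) \<partial>lborel) = (\<integral>\<^sup>+y. ennreal (\<bar>\<phi> y\<bar> powr r) \<partial>lborel)"
      by (rule lborel_nn_integral_translate) measurable
    \<comment> \<open>Chebyshev's half: \<open>vol\<close> is chosen so that C (2/\<kappa>)^r is
      exactly v/2.\<close>
    also have "ennreal ((2 / \<kappa>) powr r) * (\<integral>\<^sup>+y. ennreal (\<bar>\<phi> y\<bar> powr r) \<partial>lborel) \<le> ennreal (v / 2)"
    proof -
      have "ennreal ((2 / \<kappa>) powr r) * (\<integral>\<^sup>+y. ennreal (\<bar>\<phi> y\<bar> powr r) \<partial>lborel) \<le> ennreal ((2 / \<kappa>) powr r) * ennreal C"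
        by (intro mult_left_mono Cr) simp
      also have "\<dots> = ennreal (v / 2)" unfolding v_def vol using C by (simp add: ennreal_mult[symmetric] mult_ac)
      finally show ?thesis .
    qed
    finally have "ennreal (v / 2) + ennreal (v / 2) \<le> ennreal (v / 2) + ennreal (4 / \<kappa>\<^sup>2) * ?J x"
      by (meson add_right_mono order_trans)
    then have "ennreal (v / 2) \<le> ennreal (4 / \<kappa>\<^sup>2) * ?J x" by (simp add: ennreal_add_left_cancel_le)
    then show ?thesis using True by simp
  qed simp
  have "ennreal (v / 2) * emeasure lborel {x. \<kappa> < \<bar>\<phi> x\<bar>}
    = (\<integral>\<^sup>+x. ennreal (v / 2) * indicator {x. \<kappa> < \<bar>\<phi> x\<bar>} x \<partial>lborel)"
    by (simp add: nn_integral_cmult)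
  also have "\<dots> \<le> (\<integral>\<^sup>+x. ennreal (4 / \<kappa>\<^sup>2) * ?J x \<partial>lborel)"
    by (intro nn_integral_mono point)
  also have "\<dots> = ennreal (4 / \<kappa>\<^sup>2) * (\<integral>\<^sup>+x. ?J x \<partial>lborel)"
    by (rule nn_integral_cmult) measurable
  also have "(\<integral>\<^sup>+x. ?J x \<partial>lborel) = (\<integral>\<^sup>+y. (\<integral>\<^sup>+x. indicator ?B y * ennreal ((\<phi> (x + y) - \<phi> x)\<^sup>2) \<partial>lborel) \<partial>lborel)"
    by (rule lborel_pair.Fubini') measurable
  also have "\<dots> \<le> (\<integral>\<^sup>+y. ennreal (\<rho>\<^sup>2) * indicator ?B y \<partial>lborel)"
  proof (rule nn_integral_mono)
    fix y :: 'a
    have "(\<integral>\<^sup>+x. ennreal ((\<phi> (x + y) - \<phi> x)\<^sup>2) \<partial>lborel) \<le> ennreal ((norm y)\<^sup>2) * 1"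
      using translation_estimate[OF \<phi>, of y] mult_left_mono[OF grad, of "ennreal ((norm y)\<^sup>2)"]
      by (meson order_trans zero_le)
    also have "ennreal ((norm y)\<^sup>2) * 1 \<le> ennreal (\<rho>\<^sup>2)" if "y \<in> ?B"
      using that by (auto intro!: ennreal_leI power_mono)
    finally have "y \<in> ?B \<Longrightarrow> (\<integral>\<^sup>+x. ennreal ((\<phi> (x + y) - \<phi> x)\<^sup>2) \<partial>lborel) \<le> ennreal (\<rho>\<^sup>2)" .
    then show "(\<integral>\<^sup>+x. indicator ?B y * ennreal ((\<phi> (x + y) - \<phi> x)\<^sup>2) \<partial>lborel) \<le> ennreal (\<rho>\<^sup>2) * indicator ?B y"
      by (cases "y \<in> ?B") auto
  qed
  also have "\<dots> = ennreal (\<rho>\<^sup>2) * ennreal v" by (simp add: nn_integral_cmult ball)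
  finally have le: "ennreal (v / 2) * emeasure lborel {x. \<kappa> < \<bar>\<phi> x\<bar>} \<le> ennreal (4 / \<kappa>\<^sup>2) * (ennreal (\<rho>\<^sup>2) * ennreal v)"
    by (meson mult_left_mono order_trans zero_le)
  \<comment> \<open>Division by v/2, carried out as a multiplication; the constant 8 is 2 times the
    4 from the squared threshold \<kappa>/2.\<close>
  have "emeasure lborel {x. \<kappa> < \<bar>\<phi> x\<bar>} = ennreal (2 / v) * (ennreal (v / 2) * emeasure lborel {x. \<kappa> < \<bar>\<phi> x\<bar>})"
    using v by (simp add: mult.assoc[symmetric] ennreal_mult[symmetric])
  also have "\<dots> \<le> ennreal (2 / v) * (ennreal (4 / \<kappa>\<^sup>2) * (ennreal (\<rho>\<^sup>2) * ennreal v))"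
    by (intro mult_left_mono le) simp
  also have "\<dots> = ennreal (8 * \<rho>\<^sup>2 / \<kappa>\<^sup>2)"
    using v by (simp add: ennreal_mult[symmetric])
  finally show ?thesis .
qed

text \<open>The embedding into L^r in normalised form, on the whole space and for smooth functions.
  The type argument carries nothing but the dimension.\<close>

definition sobolev_bound :: "'a::euclidean_space itself \<Rightarrow> real \<Rightarrow> bool" where
  "sobolev_bound _ r \<longleftrightarrow> (\<exists>C>0. \<forall>\<phi>::'a \<Rightarrow> real. smooth \<phi> \<longrightarrow>
     (\<integral>\<^sup>+x. ennreal ((\<phi> x)\<^sup>2) \<partial>lborel) \<le> 1 \<longrightarrow> (\<integral>\<^sup>+x. ennreal (grad_sq \<phi> x) \<partial>lborel) \<le> 1 \<longrightarrow>
     (\<integral>\<^sup>+x. ennreal (\<bar>\<phi> x\<bar> powr r) \<partial>lborel) \<le> ennreal C)"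

section \<open>Bootstrapping the exponent\<close>

lemma abs_powr_2: "\<bar>a\<bar> powr 2 = (a::real)\<^sup>2"
  by (cases "a = 0") (auto simp: powr_numeral)

lemma sobolev_bound_2: "sobolev_bound TYPE('a::euclidean_space) 2"
  unfolding sobolev_bound_def by (rule exI[of _ 1]) (simp add: abs_powr_2)

text \<open>A dyadic layer-cake bound. For \<open>t\<close> at most 1 the square suffices. Otherwise
  2^k < t with t at most 2^(k+1) for some \<open>k\<close>, and this single term of the series is
  already large enough.\<close>

lemma powr_le_dyadic_sum:
  fixes t r :: real
  assumes "r \<ge> 2" "t \<ge> 0"
  shows "ennreal (t powr r) \<le> ennreal (t\<^sup>2) + (\<Sum>k. ennreal (2 powr ((real k + 1) * r)) * indicator {2 ^ k<..} t)"
proof (cases "t \<le> 1")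
  case True
  have "t powr r \<le> t\<^sup>2"
  proof (cases "t = 0")
    case False
    then have "t powr r \<le> t powr 2" using True assms by (intro powr_mono') auto
    then show ?thesis using False assms by (simp add: powr_numeral)
  qed simp
  then have "ennreal (t powr r) \<le> ennreal (t\<^sup>2)" by (rule ennreal_leI)
  then show ?thesis by (rule order_trans) simp
next
  case False
  obtain n where n: "t \<le> 2 ^ n" using real_arch_pow[of 2 t] by (auto intro: less_imp_le)
  define m where "m = (LEAST n. t \<le> 2 ^ n)"
  have m: "t \<le> 2 ^ m" unfolding m_def using n by (rule LeastI)
  have "m \<noteq> 0" using m False by (intro notI) simp
  then obtain k where k: "m = Suc k" using not0_implies_Suc by blast
  have "2 ^ k < t"
  proof (rule ccontr)
    assume "\<not> 2 ^ k < t"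
    then have "t \<le> 2 ^ k" by simp
    then have "m \<le> k" unfolding m_def by (rule Least_le)
    then show False using k by simp
  qed
  have "t powr r \<le> (2 ^ m) powr r" using m assms by (intro powr_mono2) auto
  also have "\<dots> = 2 powr ((real k + 1) * r)"
    by (simp add: k powr_realpow[symmetric] powr_powr add.commute del: power_Suc)
  finally have "ennreal (t powr r) \<le> ennreal (2 powr ((real k + 1) * r)) * indicator {2 ^ k<..} t"
    using \<open>2 ^ k < t\<close> by (simp add: ennreal_leI)
  also have "\<dots> \<le> (\<Sum>k. ennreal (2 powr ((real k + 1) * r)) * indicator {2 ^ k<..} t)"
  proof -
    let ?f = "\<lambda>k. ennreal (2 powr ((real k + 1) * r)) * indicator {2 ^ k<..} t"
    have "sum ?f {k} \<le> suminf ?f" by (rule sum_le_suminf) auto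
    then show ?thesis by (simp only: sum.insert[OF finite.emptyI] empty_iff not_False_eq_True sum.empty add_0_right)
  qed
  finally show ?thesis by (rule order_trans) simp
qed

text \<open>The superlevel estimate, with radius adapted to the level \<kappa>, gives a weak-type
  bound of exponent m = 2 + 2r/d. For an exponent below m the dyadic sum of these bounds is a
  convergent geometric series.\<close>

lemma sobolev_bound_step:
  assumes b: "sobolev_bound TYPE('a::euclidean_space) r" and r: "r \<ge> 2" and r': "2 \<le> r'" "r' < 2 + 2 * r / real DIM('a)"
  shows "sobolev_bound TYPE('a) r'"
proof -
  obtain C where C: "C > 0" and Cb: "\<And>\<phi>::'a \<Rightarrow> real. smooth \<phi> \<Longrightarrow>
     (\<integral>\<^sup>+x. ennreal ((\<phi> x)\<^sup>2) \<partial>lborel) \<le> 1 \<Longrightarrow> (\<integral>\<^sup>+x. ennreal (grad_sq \<phi> x) \<partial>lborel) \<le> 1 \<Longrightarrow>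
     (\<integral>\<^sup>+x. ennreal (\<bar>\<phi> x\<bar> powr r) \<partial>lborel) \<le> ennreal C"
    using b unfolding sobolev_bound_def by blast
  define d where "d = real DIM('a)"
  have d: "d > 0" by (simp add: d_def)
  define V where "V = unit_ball_vol (real DIM('a))"
  have V: "V > 0" unfolding V_def by simp
  define M where "M = 2 * C * 2 powr r / V"
  have M: "M > 0" unfolding M_def using C V by simp
  define m where "m = 2 + 2 * r / d"
  have weak: "emeasure lborel {x. \<kappa> < \<bar>\<phi> x\<bar>} \<le> ennreal (8 * M powr (2 / d) * \<kappa> powr (- m))"
    if \<kappa>: "\<kappa> > 0" and \<phi>: "smooth \<phi>" "(\<integral>\<^sup>+x. ennreal ((\<phi> x)\<^sup>2) \<partial>lborel) \<le> 1" "(\<integral>\<^sup>+x. ennreal (grad_sq \<phi> x) \<partial>lborel) \<le> 1"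
    for \<phi> :: "'a \<Rightarrow> real" and \<kappa> :: real
  proof -
    \<comment> \<open>The solution of the volume condition in \<open>superlevel_set_bound\<close>:
      it makes \<rho>^d equal to M \<kappa>^(-r).\<close>
    define \<rho> where "\<rho> = (M * \<kappa> powr (- r)) powr (1 / d)"
    have \<rho>: "\<rho> > 0" unfolding \<rho>_def using M \<kappa> by simp
    have "\<rho> ^ DIM('a) = \<rho> powr d" using \<rho> by (simp add: d_def powr_realpow)
    also have "\<dots> = M * \<kappa> powr (- r)" unfolding \<rho>_def using d M \<kappa> by (simp add: powr_powr)
    finally have "unit_ball_vol DIM('a) * \<rho> ^ DIM('a) = 2 * C * (2 / \<kappa>) powr r"
      using V \<kappa> by (simp add: V_def[symmetric] M_def powr_divide powr_minus field_simps)
    from superlevel_set_bound[OF \<phi>(1) _ C \<kappa> \<rho> Cb[OF \<phi>] \<phi>(3) this]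
    have "emeasure lborel {x. \<kappa> < \<bar>\<phi> x\<bar>} \<le> ennreal (8 * \<rho>\<^sup>2 / \<kappa>\<^sup>2)" using r by simp
    also have "\<rho>\<^sup>2 = \<rho> powr 2" using \<rho> by (simp add: powr_numeral)
    also have "\<dots> = M powr (2 / d) * \<kappa> powr (- (2 * r / d))"
      unfolding \<rho>_def using M \<kappa> by (simp add: powr_powr powr_mult mult.commute[of r 2])
    also have "8 * (M powr (2 / d) * \<kappa> powr (- (2 * r / d))) / \<kappa>\<^sup>2 = 8 * M powr (2 / d) * \<kappa> powr (- m)"
    proof -
      have "\<kappa> powr (- m) = \<kappa> powr (- (2 * r / d)) * \<kappa> powr (- 2)"
      proof -
        have "- m = - (2 * r / d) + (- 2)" by (simp add: m_def)
        then show ?thesis by (simp only: powr_add)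
      qed
      also have "\<kappa> powr (- 2) = inverse (\<kappa>\<^sup>2)" using \<kappa> by (simp add: powr_minus powr_numeral)
      finally show ?thesis by (simp add: divide_inverse)
    qed
    finally show ?thesis .
  qed
  \<comment> \<open>The ratio of the series: level 2^k contributes about 2^(k r') times 2^(-k m). It
    is below 1 because r' < m.\<close>
  define q where "q = 2 powr (r' - m)"
  have q0: "0 < q" unfolding q_def by simp
  have "2 powr (r' - m) < 2 powr (0 :: real)"
    using r' by (intro powr_less_mono) (auto simp: m_def d_def)
  then have q: "0 < q" "q < 1" using q0 by (simp_all add: q_def)
  define K where "K = 2 powr r' * (8 * M powr (2 / d))"
  have K: "K > 0" unfolding K_def using M by simp
  have tm: "2 powr ((real k + 1) * r') * (8 * M powr (2 / d) * (2 ^ k) powr (- m)) = K * q ^ k" for k :: nat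
  proof -
    have "q ^ k = 2 powr ((r' - m) * real k)"
      unfolding q_def by (simp add: powr_realpow[symmetric] powr_powr)
    moreover have "(2 ^ k) powr (- m) = 2 powr (- m * real k)"
      by (simp add: powr_realpow[symmetric] powr_powr mult.commute)
    ultimately show ?thesis
      by (simp add: K_def powr_add[symmetric] algebra_simps)
  qed
  have "(\<integral>\<^sup>+x. ennreal (\<bar>\<phi> x\<bar> powr r') \<partial>lborel) \<le> ennreal (1 + K / (1 - q))"
    if \<phi>: "smooth \<phi>" "(\<integral>\<^sup>+x. ennreal ((\<phi> x)\<^sup>2) \<partial>lborel) \<le> 1" "(\<integral>\<^sup>+x. ennreal (grad_sq \<phi> x) \<partial>lborel) \<le> 1" for \<phi> :: "'a \<Rightarrow> real"
  proof -
    have [measurable]: "\<phi> \<in> borel_measurable borel"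
      by (intro borel_measurable_continuous_onI smooth_continuous \<phi>)
    let ?c = "\<lambda>k::nat. ennreal (2 powr ((real k + 1) * r'))"
    have "(\<integral>\<^sup>+x. ennreal (\<bar>\<phi> x\<bar> powr r') \<partial>lborel)
      \<le> (\<integral>\<^sup>+x. ennreal ((\<phi> x)\<^sup>2) + (\<Sum>k. ?c k * indicator {x. 2 ^ k < \<bar>\<phi> x\<bar>} x) \<partial>lborel)"
    proof (rule nn_integral_mono)
      fix x
      have "indicator {x. 2 ^ k < \<bar>\<phi> x\<bar>} x = (indicator {2 ^ k<..} \<bar>\<phi> x\<bar> :: ennreal)" for k :: nat
        by (auto split: split_indicator)
      then show "ennreal (\<bar>\<phi> x\<bar> powr r') \<le> ennreal ((\<phi> x)\<^sup>2) + (\<Sum>k. ?c k * indicator {x. 2 ^ k < \<bar>\<phi> x\<bar>} x)"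
        using powr_le_dyadic_sum[of r' "\<bar>\<phi> x\<bar>"] r' by simp
    qed
    also have "\<dots> = (\<integral>\<^sup>+x. ennreal ((\<phi> x)\<^sup>2) \<partial>lborel) + (\<Sum>k. \<integral>\<^sup>+x. ?c k * indicator {x. 2 ^ k < \<bar>\<phi> x\<bar>} x \<partial>lborel)"
      by (simp add: nn_integral_add nn_integral_suminf)
    also have "\<dots> \<le> 1 + (\<Sum>k. ennreal (K * q ^ k))"
    proof (rule add_mono[OF \<phi>(2)], rule suminf_le)
      fix k :: nat
      have "(\<integral>\<^sup>+x. ?c k * indicator {x. 2 ^ k < \<bar>\<phi> x\<bar>} x \<partial>lborel) = ?c k * emeasure lborel {x. 2 ^ k < \<bar>\<phi> x\<bar>}"
        by (simp add: nn_integral_cmult)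
      also have "\<dots> \<le> ?c k * ennreal (8 * M powr (2 / d) * (2 ^ k) powr (- m))"
        using weak[OF _ \<phi>, of "2 ^ k"] by (intro mult_left_mono) auto
      also have "\<dots> = ennreal (K * q ^ k)"
        using tm[of k] by (simp add: ennreal_mult[symmetric])
      finally show "(\<integral>\<^sup>+x. ?c k * indicator {x. 2 ^ k < \<bar>\<phi> x\<bar>} x \<partial>lborel) \<le> ennreal (K * q ^ k)" .
    qed auto
    also have "(\<Sum>k. ennreal (K * q ^ k)) = ennreal (K * (1 / (1 - q)))"
      using q K by (intro suminf_ennreal_eq sums_mult geometric_sums) auto
    also have "1 + \<dots> = ennreal (1 + K / (1 - q))"
      using q K by (simp add: ennreal_plus)
    finally show ?thesis .
  qed
  moreover have "1 + K / (1 - q) > 0" using K q by (simp add: add_pos_pos)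
  ultimately show ?thesis unfolding sobolev_bound_def by blast
qed

text \<open>
  The fixed point of $r \mapsto 2 + 2r/d$ is the critical exponent $2d/(d-2)$ for $d \ge 3$, and the
  iterates are unbounded for $d \le 2$.
\<close>

lemma sobolev_bound_subcritical:
  assumes r0: "r0 \<ge> 2" "r0 * (real DIM('a) - 2) < 2 * real DIM('a)"
  shows "sobolev_bound TYPE('a::euclidean_space) r0"
proof -
  define d where "d = real DIM('a)"
  have d: "d \<ge> 1" using DIM_positive[where 'a = 'a] by (simp add: d_def Suc_le_eq)
  \<comment> \<open>The gain of one step at the target exponent, positive exactly by subcriticality.
    Half of it, capped so that d = 1 is covered too, is the uniform step size \<delta>.\<close>
  define g where "g = 2 + 2 * r0 / d - r0"
  have g: "g > 0" using r0(2) d unfolding g_def d_def[symmetric] by (simp add: field_simps)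
  define \<delta> where "\<delta> = min 1 g / 2"
  have \<delta>: "\<delta> > 0" "\<delta> < 1" "\<delta> < g" using g by (auto simp: \<delta>_def)
  \<comment> \<open>For d at least 2 the gain 2 + 2r/d - r does not increase with r, so it is
    smallest at \<open>r0\<close>. For d = 1 it is 2 + r.\<close>
  have gap: "r + \<delta> < 2 + 2 * r / d" if r: "2 \<le> r" "r \<le> r0" for r
  proof (cases "d \<ge> 2")
    case True
    have "(r0 - r) * (1 - 2 / d) \<ge> 0" using True r by (intro mult_nonneg_nonneg) (auto simp: field_simps)
    then have "r0 - 2 * r0 / d - (r - 2 * r / d) \<ge> 0" by (simp add: algebra_simps diff_divide_distrib)
    then show ?thesis using \<delta> unfolding g_def by linarith
  next
    case False
    have "0 < DIM('a)" by (rule DIM_positive)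
    moreover have "DIM('a) < 2" using False by (simp add: d_def)
    ultimately have "DIM('a) = 1" by linarith
    then have "d = 1" by (simp add: d_def)
    then show ?thesis using r \<delta> by simp
  qed
  have "sobolev_bound TYPE('a) (min r0 (2 + real n * \<delta>))" for n :: nat
  proof (induction n)
    case 0
    then show ?case using r0 sobolev_bound_2 by simp
  next
    case (Suc n)
    let ?r = "min r0 (2 + real n * \<delta>)"
    have r: "2 \<le> ?r" "?r \<le> r0" using r0 \<delta> by auto
    have "min r0 (2 + real (Suc n) * \<delta>) \<le> ?r + \<delta>" using \<delta> by (auto simp: algebra_simps)
    then have "min r0 (2 + real (Suc n) * \<delta>) < 2 + 2 * ?r / real DIM('a)"
      using gap[OF r] unfolding d_def by linarith
    moreover have "2 \<le> min r0 (2 + real (Suc n) * \<delta>)" using r0 \<delta> by simp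
    ultimately show ?case using sobolev_bound_step[OF Suc.IH r(1)] by blast
  qed
  moreover obtain n :: nat where "(r0 - 2) / \<delta> < real n" using reals_Archimedean2 by blast
  then have "min r0 (2 + real n * \<delta>) = r0" using \<delta> by (simp add: field_simps)
  ultimately show ?thesis by metis
qed

section \<open>Transfer of the embedding to H10\<close>

lemma test_function_inner_lborel:
  assumes \<Omega>: "open \<Omega>" and \<phi>: "\<phi> \<in> test_functions \<Omega>"
  shows "(\<integral>\<^sup>+x. ennreal ((\<phi> x)\<^sup>2) \<partial>lborel) = ennreal (L2_inner \<Omega> \<phi> \<phi>)"
    and "(\<integral>\<^sup>+x. ennreal (grad_sq \<phi> x) \<partial>lborel) = ennreal (grad_inner \<Omega> \<phi> \<phi>)"
proof -
  have *: "L2_inner \<Omega> \<zeta> \<zeta> = (LINT x|lborel. (\<zeta> x)\<^sup>2) \<and> integrable lborel (\<lambda>x. (\<zeta> x)\<^sup>2)" if \<zeta>: "\<zeta> \<in> test_functions \<Omega>" for \<zeta>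
  proof -
    have t: "(\<lambda>x. \<zeta> x * \<zeta> x) \<in> test_functions \<Omega>"
      by (rule test_function_mult[OF \<zeta> test_functionsD(1)[OF \<zeta>]])
    have "L2_inner \<Omega> \<zeta> \<zeta> = (LINT x|lborel. \<zeta> x * \<zeta> x)"
      unfolding L2_inner_def
      by (intro lborel_eq_lebesgue_on_integral(1) open_lebesgue \<Omega> test_function_measurable[OF t] test_functionsD(2)[OF t])
    then show ?thesis using test_function_integrable[OF t] by (simp add: power2_eq_square)
  qed
  show "(\<integral>\<^sup>+x. ennreal ((\<phi> x)\<^sup>2) \<partial>lborel) = ennreal (L2_inner \<Omega> \<phi> \<phi>)"
    using *[OF \<phi>] by (subst nn_integral_eq_integral) auto
  have p: "L2_inner \<Omega> (weak_partial \<Omega> b \<phi>) (weak_partial \<Omega> b \<phi>) = (LINT x|lborel. (partial b \<phi> x)\<^sup>2)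
      \<and> integrable lborel (\<lambda>x. (partial b \<phi> x)\<^sup>2)" if b: "b \<in> Basis" for b
  proof -
    note pb = partial_test_function[OF \<phi> b]
    have "L2_inner \<Omega> (weak_partial \<Omega> b \<phi>) (weak_partial \<Omega> b \<phi>) = L2_inner \<Omega> (partial b \<phi>) (partial b \<phi>)"
      by (rule L2_inner_cong_AE[OF H1_weak_partial(2)[OF \<Omega> test_function_H1(1)[OF \<Omega> \<phi>] b] test_function_H1(2)[OF \<Omega> pb]
            H1_weak_partial(2)[OF \<Omega> test_function_H1(1)[OF \<Omega> \<phi>] b] test_function_H1(2)[OF \<Omega> pb]
            weak_partial_test_function_AE[OF \<Omega> \<phi> b] weak_partial_test_function_AE[OF \<Omega> \<phi> b]])
    then show ?thesis using *[OF pb] by simp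
  qed
  have "grad_inner \<Omega> \<phi> \<phi> = (\<Sum>b\<in>Basis. LINT x|lborel. (partial b \<phi> x)\<^sup>2)"
    unfolding grad_inner_def using p by (intro sum.cong) auto
  also have "\<dots> = (LINT x|lborel. grad_sq \<phi> x)"
    unfolding grad_sq_def[abs_def] using p by (intro Bochner_Integration.integral_sum[symmetric]) auto
  finally have "grad_inner \<Omega> \<phi> \<phi> = (LINT x|lborel. grad_sq \<phi> x)" .
  moreover have "integrable lborel (grad_sq \<phi>)"
    unfolding grad_sq_def[abs_def] using p by (intro Bochner_Integration.integrable_sum) auto
  ultimately show "(\<integral>\<^sup>+x. ennreal (grad_sq \<phi> x) \<partial>lborel) = ennreal (grad_inner \<Omega> \<phi> \<phi>)"
    by (subst nn_integral_eq_integral) (auto simp: grad_sq_nonneg)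
qed

text \<open>Test functions are divided by \<open>N\<close> to enter the unit ball; since
  \<open>N\<close> only has to dominate the norm, functions of norm zero are covered. A general
  element is an H1 limit of test functions, and Fatou passes to the limit. Approximants eventually
  have norm at most 2N, whence the factor 2^r in the constant.\<close>

lemma sobolev_H10:
  fixes \<Omega> :: "'a::euclidean_space set"
  assumes \<Omega>: "open \<Omega>" and r: "r \<ge> 2" "r * (real DIM('a) - 2) < 2 * real DIM('a)"
  obtains C where "C > 0"
    "\<And>v N. v \<in> H10 \<Omega> \<Longrightarrow> 0 < N \<Longrightarrow> H1_norm \<Omega> v \<le> N \<Longrightarrow> integrable (lebesgue_on \<Omega>) (\<lambda>x. \<bar>v x\<bar> powr r)"
    "\<And>v N. v \<in> H10 \<Omega> \<Longrightarrow> 0 < N \<Longrightarrow> H1_norm \<Omega> v \<le> N \<Longrightarrow> (LINT x|lebesgue_on \<Omega>. \<bar>v x\<bar> powr r) \<le> C * N powr r"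
proof -
  interpret H: semi_inner_space "H_k \<Omega> 1" "H1_inner \<Omega>" by (rule H1_inner_space[OF \<Omega>])
  note nrm = H1_nrm[OF \<Omega>]
  have \<Omega>': "\<Omega> \<in> sets lebesgue" by (rule open_lebesgue[OF \<Omega>])
  obtain C where C: "C > 0" and Cb: "\<And>\<phi>::'a \<Rightarrow> real. smooth \<phi> \<Longrightarrow>
     (\<integral>\<^sup>+x. ennreal ((\<phi> x)\<^sup>2) \<partial>lborel) \<le> 1 \<Longrightarrow> (\<integral>\<^sup>+x. ennreal (grad_sq \<phi> x) \<partial>lborel) \<le> 1 \<Longrightarrow>
     (\<integral>\<^sup>+x. ennreal (\<bar>\<phi> x\<bar> powr r) \<partial>lborel) \<le> ennreal C"
    using sobolev_bound_subcritical[OF r] unfolding sobolev_bound_def by blast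
  have test: "(\<integral>\<^sup>+x. ennreal (\<bar>\<phi> x\<bar> powr r) \<partial>lebesgue_on \<Omega>) \<le> ennreal (C * N powr r)"
    if \<phi>: "\<phi> \<in> test_functions \<Omega>" and N: "N > 0" "H1_norm \<Omega> \<phi> \<le> N" for \<phi> N
  proof -
    define \<zeta> where "\<zeta> = (\<lambda>x. (1 / N) * \<phi> x)"
    have \<zeta>: "\<zeta> \<in> test_functions \<Omega>" unfolding \<zeta>_def by (rule test_function_scale[OF \<phi>])
    note \<zeta>H = test_function_H1(1)[OF \<Omega> \<zeta>]
    have [measurable]: "\<phi> \<in> borel_measurable borel" "\<zeta> \<in> borel_measurable borel"
      by (rule test_function_measurable[OF \<phi>], rule test_function_measurable[OF \<zeta>])
    have "H1_norm \<Omega> \<zeta> = (1 / N) * H1_norm \<Omega> \<phi>"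
      unfolding \<zeta>_def nrm[symmetric] using N by (subst H.nrm_scale[OF test_function_H1(1)[OF \<Omega> \<phi>]]) simp
    also have "\<dots> \<le> 1" using N by (simp add: field_simps)
    finally have "(H1_norm \<Omega> \<zeta>)\<^sup>2 \<le> 1" using H1_norm_bounds(1)[OF \<Omega> \<zeta>H] by (simp add: power_le_one)
    then have le: "L2_inner \<Omega> \<zeta> \<zeta> \<le> 1" "grad_inner \<Omega> \<zeta> \<zeta> \<le> 1"
      using H1_norm_bounds(3-5)[OF \<Omega> \<zeta>H] by linarith+
    have C\<zeta>: "(\<integral>\<^sup>+x. ennreal (\<bar>\<zeta> x\<bar> powr r) \<partial>lborel) \<le> ennreal C"
      using le by (intro Cb test_functionsD(1)[OF \<zeta>]) (simp_all add: test_function_inner_lborel[OF \<Omega> \<zeta>])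
    have "(\<integral>\<^sup>+x. ennreal (\<bar>\<phi> x\<bar> powr r) \<partial>lebesgue_on \<Omega>) = (\<integral>\<^sup>+x. ennreal (\<bar>\<phi> x\<bar> powr r) * indicator \<Omega> x \<partial>lebesgue)"
      using \<Omega>' by (subst nn_integral_restrict_space) auto
    also have "\<dots> \<le> (\<integral>\<^sup>+x. ennreal (N powr r) * ennreal (\<bar>\<zeta> x\<bar> powr r) \<partial>lebesgue)"
    proof (rule nn_integral_mono)
      fix x
      have "\<bar>\<phi> x\<bar> powr r = (N * \<bar>\<zeta> x\<bar>) powr r" using N by (simp add: \<zeta>_def abs_mult)
      also have "\<dots> = N powr r * \<bar>\<zeta> x\<bar> powr r" using N by (simp add: powr_mult)
      finally show "ennreal (\<bar>\<phi> x\<bar> powr r) * indicator \<Omega> x \<le> ennreal (N powr r) * ennreal (\<bar>\<zeta> x\<bar> powr r)"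
        by (auto split: split_indicator simp: ennreal_mult)
    qed
    also have "\<dots> = (\<integral>\<^sup>+x. ennreal (N powr r) * ennreal (\<bar>\<zeta> x\<bar> powr r) \<partial>lborel)"
      by (rule nn_integral_completion)
    also have "\<dots> = ennreal (N powr r) * (\<integral>\<^sup>+x. ennreal (\<bar>\<zeta> x\<bar> powr r) \<partial>lborel)"
      by (rule nn_integral_cmult) measurable
    also have "\<dots> \<le> ennreal (N powr r) * ennreal C" by (intro mult_left_mono C\<zeta>) simp
    also have "\<dots> = ennreal (C * N powr r)" using C by (simp add: ennreal_mult[symmetric] mult.commute)
    finally show ?thesis .
  qed
  have main: "(\<integral>\<^sup>+x. ennreal (\<bar>v x\<bar> powr r) \<partial>lebesgue_on \<Omega>) \<le> ennreal (C * 2 powr r * N powr r)"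
    if v: "v \<in> H10 \<Omega>" and N: "N > 0" "H1_norm \<Omega> v \<le> N" for v N
  proof -
    obtain \<phi> where \<phi>: "\<And>n. \<phi> n \<in> test_functions \<Omega>" "(\<lambda>n. H1_norm \<Omega> (\<lambda>x. v x - \<phi> n x)) \<longlonglongrightarrow> 0"
      using H10_approx[OF v] by blast
    have vH: "v \<in> H_k \<Omega> 1" by (rule H10_D(1)[OF v])
    have \<phi>H: "\<phi> n \<in> H_k \<Omega> 1" for n by (rule test_function_H1(1)[OF \<Omega> \<phi>(1)])
    have dH: "(\<lambda>x. v x - \<phi> n x) \<in> H_k \<Omega> 1" for n by (rule H.diff_closed[OF vH \<phi>H])
    have dL: "(\<lambda>x. v x - \<phi> n x) \<in> L2 \<Omega>" for n by (rule H1_L2[OF dH])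
    have "(\<lambda>n. (LINT x|lebesgue_on \<Omega>. norm ((v x - \<phi> n x)\<^sup>2))) \<longlonglongrightarrow> 0"
    proof (rule Lim_null_comparison)
      show "(\<lambda>n. (H1_norm \<Omega> (\<lambda>x. v x - \<phi> n x))\<^sup>2) \<longlonglongrightarrow> 0"
        using tendsto_power[OF \<phi>(2), of 2] by simp
      have "norm (LINT x|lebesgue_on \<Omega>. norm ((v x - \<phi> n x)\<^sup>2)) \<le> (H1_norm \<Omega> (\<lambda>x. v x - \<phi> n x))\<^sup>2" for n
        using H1_norm_bounds(3-5)[OF \<Omega> dH[of n]] by (simp add: L2_inner_def power2_eq_square)
      then show "eventually (\<lambda>n. norm (LINT x|lebesgue_on \<Omega>. norm ((v x - \<phi> n x)\<^sup>2)) \<le> (H1_norm \<Omega> (\<lambda>x. v x - \<phi> n x))\<^sup>2) sequentially"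
        by (intro always_eventually allI)
    qed
    \<comment> \<open>The squares of the differences tend to 0 in L1, so a subsequence converges
      almost everywhere, as Fatou requires.\<close>
    from tendsto_L1_AE_subseq[OF L2_D(2)[OF dL] this]
    obtain s where s: "strict_mono s" "AE x in lebesgue_on \<Omega>. (\<lambda>n. (v x - \<phi> (s n) x)\<^sup>2) \<longlonglongrightarrow> 0" by blast
    have "eventually (\<lambda>n. H1_norm \<Omega> (\<lambda>x. v x - \<phi> n x) < N) sequentially"
      using order_tendstoD(2)[OF \<phi>(2) N(1)] .
    then obtain n0 where n0: "\<And>n. n \<ge> n0 \<Longrightarrow> H1_norm \<Omega> (\<lambda>x. v x - \<phi> n x) < N"
      unfolding eventually_sequentially by blast
    have le: "H1_norm \<Omega> (\<phi> n) \<le> 2 * N" if "n \<ge> n0" for n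
      using H.nrm_triangle_diff[OF \<phi>H vH, of n] H.nrm_minus_commute[OF vH \<phi>H, of n] n0[OF that] N(2)
      unfolding nrm by linarith
    \<comment> \<open>The shift by \<open>n0\<close> puts every member, not just the later ones,
      under the bound 2N.\<close>
    define u where "u n x = \<phi> (s (n + n0)) x" for n x
    have u: "u n \<in> test_functions \<Omega>" "H1_norm \<Omega> (u n) \<le> 2 * N" for n
    proof -
      show "u n \<in> test_functions \<Omega>" unfolding u_def by (rule \<phi>(1))
      have "s (n + n0) \<ge> n0" using seq_suble[OF s(1), of "n + n0"] by linarith
      then show "H1_norm \<Omega> (u n) \<le> 2 * N" unfolding u_def by (rule le)
    qed
    have "AE x in lebesgue_on \<Omega>. ennreal (\<bar>v x\<bar> powr r) = liminf (\<lambda>n. ennreal (\<bar>u n x\<bar> powr r))"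
      using s(2)
    proof eventually_elim
      case (elim x)
      have "(\<lambda>n. \<bar>v x - \<phi> (s n) x\<bar>) \<longlonglongrightarrow> 0" using tendsto_real_sqrt[OF elim] by simp
      then have "(\<lambda>n. v x - \<phi> (s n) x) \<longlonglongrightarrow> 0" by (rule tendsto_rabs_zero_cancel)
      then have "(\<lambda>n. v x - (v x - \<phi> (s n) x)) \<longlonglongrightarrow> v x - 0" by (intro tendsto_diff tendsto_const)
      then have "(\<lambda>n. u n x) \<longlonglongrightarrow> v x" unfolding u_def using LIMSEQ_ignore_initial_segment[of "\<lambda>n. \<phi> (s n) x" _ n0] by simp
      then have "(\<lambda>n. \<bar>u n x\<bar> powr r) \<longlonglongrightarrow> \<bar>v x\<bar> powr r"
        using r by (intro tendsto_powr' tendsto_rabs tendsto_const) auto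
      then have "(\<lambda>n. ennreal (\<bar>u n x\<bar> powr r)) \<longlonglongrightarrow> ennreal (\<bar>v x\<bar> powr r)" by (rule tendsto_ennrealI)
      then show ?case by (intro lim_imp_Liminf[symmetric]) auto
    qed
    then have "(\<integral>\<^sup>+x. ennreal (\<bar>v x\<bar> powr r) \<partial>lebesgue_on \<Omega>) = (\<integral>\<^sup>+x. liminf (\<lambda>n. ennreal (\<bar>u n x\<bar> powr r)) \<partial>lebesgue_on \<Omega>)"
      by (rule nn_integral_cong_AE)
    also have "\<dots> \<le> liminf (\<lambda>n. \<integral>\<^sup>+x. ennreal (\<bar>u n x\<bar> powr r) \<partial>lebesgue_on \<Omega>)"
    proof (rule nn_integral_liminf)
      fix n
      have [measurable]: "u n \<in> borel_measurable (lebesgue_on \<Omega>)" by (rule L2_D(1)[OF test_function_H1(2)[OF \<Omega> u(1)]])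
      show "(\<lambda>x. ennreal (\<bar>u n x\<bar> powr r)) \<in> borel_measurable (lebesgue_on \<Omega>)" by measurable
    qed
    also have "\<dots> \<le> liminf (\<lambda>n::nat. ennreal (C * (2 * N) powr r))"
      using N by (intro Liminf_mono always_eventually allI test u) auto
    also have "\<dots> = ennreal (C * 2 powr r * N powr r)"
      using N by (simp add: Liminf_const powr_mult mult.assoc)
    finally show ?thesis .
  qed
  show ?thesis
  proof (rule that[of "C * 2 powr r"])
    show "C * 2 powr r > 0" using C by simp
    fix v N assume v: "v \<in> H10 \<Omega>" and N: "0 < N" "H1_norm \<Omega> v \<le> N"
    have [measurable]: "v \<in> borel_measurable (lebesgue_on \<Omega>)" by (rule L2_D(1)[OF H10_D(2)[OF v]])
    show i: "integrable (lebesgue_on \<Omega>) (\<lambda>x. \<bar>v x\<bar> powr r)"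
      using main[OF v N] by (intro integrableI_bounded) (auto intro: le_less_trans)
    show "(LINT x|lebesgue_on \<Omega>. \<bar>v x\<bar> powr r) \<le> C * 2 powr r * N powr r"
      using main[OF v N] C by (subst (asm) nn_integral_eq_integral[OF i]) auto
  qed
qed

section \<open>The nonlinearity and the energy\<close>

text \<open>Between \<open>a\<close> and \<open>b\<close> both 1 and \<bar>s\<bar>^p are at most (1
  + \<bar>a\<bar> + \<bar>b\<bar>)^p, hence the factor 2; the increment bound for weak derivatives
  does the rest.\<close>

lemma weak_derivative_growth:
  fixes f f' :: "real \<Rightarrow> real"
  assumes f: "continuous_on UNIV f" and w: "has_weak_partial UNIV 1 f f'"
    and C: "C > 0" and p: "p \<ge> 0" and ae: "AE s in lebesgue. \<bar>f' s\<bar> \<le> C * (1 + rpow \<bar>s\<bar> p)"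
  shows "\<bar>f a - f b\<bar> \<le> 2 * C * (1 + \<bar>a\<bar> + \<bar>b\<bar>) powr p * \<bar>a - b\<bar>"
proof -
  have le: "\<bar>f b - f a\<bar> \<le> 2 * C * (1 + \<bar>a\<bar> + \<bar>b\<bar>) powr p * (b - a)" if ab: "a \<le> b" for a b
  proof (rule weak_partial_increment_abs_le[OF open_UNIV w f ab])
    have ivl: "{a..b} \<in> sets lebesgue" by simp
    show "AE x in lebesgue_on {a..b}. \<bar>f' x\<bar> \<le> 2 * C * (1 + \<bar>a\<bar> + \<bar>b\<bar>) powr p"
      unfolding AE_lebesgue_on_iff[OF ivl]
    proof (rule eventually_mono[OF ae], rule impI)
      fix x assume fx: "\<bar>f' x\<bar> \<le> C * (1 + rpow \<bar>x\<bar> p)" and x: "x \<in> {a..b}"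
      let ?X = "1 + \<bar>a\<bar> + \<bar>b\<bar>"
      have "rpow \<bar>x\<bar> p \<le> ?X powr p"
        using x p by (auto simp: rpow_def intro!: powr_mono2)
      moreover have "1 \<le> ?X powr p" using p by (intro ge_one_powr_ge_zero) auto
      ultimately have "C * (1 + rpow \<bar>x\<bar> p) \<le> C * (2 * ?X powr p)" using C by (intro mult_left_mono) auto
      then show "\<bar>f' x\<bar> \<le> 2 * C * ?X powr p" using fx by simp
    qed
  qed simp
  show ?thesis
  proof (cases "a \<le> b")
    case True
    then show ?thesis using le[OF True] by (simp add: abs_minus_commute)
  next
    case False
    then show ?thesis using le[of b a] by (simp add: add_ac)
  qed
qed

lemma antideriv_has_derivative:
  assumes f: "continuous_on UNIV f"
  shows "(antideriv f has_real_derivative f x) (at x)"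
proof -
  \<comment> \<open>A window that contains both the base point 0 and \<open>x\<close> in its
    interior, so the one-sided derivative is two-sided.\<close>
  let ?a = "min 0 x - 1" and ?b = "max 0 x + 1"
  have "((\<lambda>u. LBINT y=0..u. f y) has_vector_derivative f x) (at x within {?a..?b})"
    using interval_integral_FTC2[of ?a 0 ?b f x] continuous_on_subset[OF f subset_UNIV]
    by (auto simp: zero_ereal_def)
  moreover have "at x within {?a..?b} = at x"
    by (intro at_within_interior) auto
  ultimately show ?thesis
    by (simp add: antideriv_def[abs_def] has_real_derivative_iff_has_vector_derivative)
qed

lemma antideriv_0: "antideriv f 0 = 0"
  by (simp add: antideriv_def zero_ereal_def)

text \<open>The liminf bounds f(s)/s from below for large \<bar>s\<bar>. This is a lower bound on
  \<open>f\<close> for positive \<open>s\<close> and an upper bound for negative \<open>s\<close>,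
  and both make the integral from 0 at worst quadratically negative.\<close>

lemma antideriv_lower_bound:
  assumes f: "continuous_on UNIV f"
    and lim: "Liminf at_infinity (\<lambda>s. ereal (f s / s)) \<ge> ereal (- \<mu>)"
  obtains k where "k \<ge> 0" "\<And>s. antideriv f s \<ge> - k * (1 + s\<^sup>2)"
proof -
  \<comment> \<open>Giving away 1 creates the strict inequality that turns a liminf into an eventual
    bound.\<close>
  have "ereal (- \<mu> - 1) < ereal (- \<mu>)" by simp
  also note lim
  finally have "eventually (\<lambda>s. ereal (- \<mu> - 1) < ereal (f s / s)) at_infinity" by (rule less_LiminfD)
  then obtain R0 where R0: "\<And>s. norm s \<ge> R0 \<Longrightarrow> - \<mu> - 1 < f s / s"
    unfolding eventually_at_infinity by auto
  define R where "R = max R0 1"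
  define m where "m = \<bar>\<mu>\<bar> + 1"
  have m: "m > 0" unfolding m_def by simp
  have R: "R > 0" "\<And>s. \<bar>s\<bar> \<ge> R \<Longrightarrow> - m \<le> f s / s"
  proof -
    show "R > 0" unfolding R_def by simp
    fix s assume "\<bar>s\<bar> \<ge> R"
    then have "- \<mu> - 1 < f s / s" using R0[of s] by (simp add: R_def)
    then show "- m \<le> f s / s" unfolding m_def by linarith
  qed
  have "bounded (f ` {-R..R})"
    by (intro compact_imp_bounded compact_continuous_image continuous_on_subset[OF f]) auto
  then obtain B where B: "\<forall>s\<in>{-R..R}. \<bar>f s\<bar> \<le> B" unfolding bounded_iff by auto
  have B0: "B \<ge> 0" using bspec[OF B, of 0] R(1) by simp
  have fp: "f s \<ge> - B - m * s" if "s \<ge> 0" for s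
  proof (cases "s \<le> R")
    case True
    then have "\<bar>f s\<bar> \<le> B" using B R that by auto
    moreover have "0 \<le> m * s" using m that by simp
    ultimately show ?thesis by linarith
  next
    case False
    then have s: "s > 0" using R(1) by linarith
    then have "- m * s \<le> f s" using R(2)[of s] False by (simp add: field_simps)
    then show ?thesis using B0 by simp
  qed
  have fn: "f s \<le> B - m * s" if "s \<le> 0" for s
  proof (cases "- R \<le> s")
    case True
    then have "\<bar>f s\<bar> \<le> B" using B R that by auto
    moreover have "m * s \<le> 0" using m that by (simp add: mult_nonneg_nonpos)
    ultimately show ?thesis by linarith
  next
    case False
    then have s: "s < 0" using R(1) by linarith
    then have "f s \<le> - m * s" using R(2)[of s] False by (simp add: field_simps)
    then show ?thesis using B0 by simp
  qed
  note d = antideriv_has_derivative[OF f]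
  have low: "antideriv f s \<ge> - (B * \<bar>s\<bar> + m * s\<^sup>2 / 2)" for s
  proof (cases "s \<ge> 0")
    case True
    \<comment> \<open>The added terms are the primitive of B + m s, so the derivative is nonnegative
      by \<open>fp\<close>.\<close>
    have "(\<lambda>s. antideriv f s + B * s + m * s\<^sup>2 / 2) 0 \<le> (\<lambda>s. antideriv f s + B * s + m * s\<^sup>2 / 2) s"
    proof (rule DERIV_nonneg_imp_nondecreasing[OF True])
      fix x assume "0 \<le> x" "x \<le> s"
      moreover have "((\<lambda>s. antideriv f s + B * s + m * s\<^sup>2 / 2) has_real_derivative f x + B + m * x) (at x)"
        by (auto intro!: derivative_eq_intros d)
      ultimately show "\<exists>y. ((\<lambda>s. antideriv f s + B * s + m * s\<^sup>2 / 2) has_real_derivative y) (at x) \<and> 0 \<le> y"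
        using fp[of x] by (intro exI[of _ "f x + B + m * x"]) auto
    qed
    then show ?thesis using True by (simp add: antideriv_0)
  next
    case False
    then have s: "s \<le> 0" by simp
    have "(\<lambda>s. antideriv f s - B * s + m * s\<^sup>2 / 2) s \<ge> (\<lambda>s. antideriv f s - B * s + m * s\<^sup>2 / 2) 0"
    proof (rule DERIV_nonpos_imp_nonincreasing[OF s])
      fix x assume "s \<le> x" "x \<le> 0"
      moreover have "((\<lambda>s. antideriv f s - B * s + m * s\<^sup>2 / 2) has_real_derivative f x - B + m * x) (at x)"
        by (auto intro!: derivative_eq_intros d)
      ultimately show "\<exists>y. ((\<lambda>s. antideriv f s - B * s + m * s\<^sup>2 / 2) has_real_derivative y) (at x) \<and> y \<le> 0"
        using fn[of x] by (intro exI[of _ "f x - B + m * x"]) auto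
    qed
    then show ?thesis using s by (simp add: antideriv_0)
  qed
  show ?thesis
  proof (rule that[of "B + m"])
    show "B + m \<ge> 0" using B0 m by simp
    fix s :: real
    have "0 \<le> (\<bar>s\<bar> - 1)\<^sup>2" by simp
    then have "\<bar>s\<bar> \<le> 1 + s\<^sup>2" using zero_le_power2[of s] by (simp add: power2_diff)
    then have "B * \<bar>s\<bar> \<le> B * (1 + s\<^sup>2)" using B0 by (intro mult_left_mono) auto
    moreover have "m * s\<^sup>2 / 2 \<le> m * (1 + s\<^sup>2)" using m by (simp add: field_simps)
    ultimately show "antideriv f s \<ge> - (B + m) * (1 + s\<^sup>2)" using low[of s] by (simp add: algebra_simps)
  qed
qed

text \<open>The form in which the growth part of (I-1) enters the estimates: a weighted Lipschitz
  bound instead of a derivative. The condition on \<open>p\<close> says that 2(p+1) is a subcritical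
  exponent.\<close>

locale subcritical_nonlinearity =
  fixes \<Omega> :: "'a::euclidean_space set" and f :: "real \<Rightarrow> real" and p L :: real
  assumes open_\<Omega>: "open \<Omega>" and bounded_\<Omega>: "bounded \<Omega>"
    and p: "p \<ge> 0" "(real DIM('a) - 2) * p < 2"
    and f_cont: "continuous_on UNIV f" and L: "L > 0"
    and f_growth: "\<And>a b. \<bar>f a - f b\<bar> \<le> L * (1 + \<bar>a\<bar> + \<bar>b\<bar>) powr p * \<bar>a - b\<bar>"
begin

sublocale grad: semi_inner_space "H_k \<Omega> 1" "grad_inner \<Omega>" by (rule grad_inner_space[OF open_\<Omega>])
sublocale H1: semi_inner_space "H_k \<Omega> 1" "H1_inner \<Omega>" by (rule H1_inner_space[OF open_\<Omega>])

lemma H1_nrm_eq: "H1.nrm = H1_norm \<Omega>"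
  by (rule H1_nrm[OF open_\<Omega>])

lemmas H1_norm_facts = H1_norm_bounds[OF open_\<Omega>]

lemma \<Omega>_lebesgue: "\<Omega> \<in> sets lebesgue"
  by (rule open_lebesgue[OF open_\<Omega>])

lemma finite_measure_\<Omega>: "finite_measure (lebesgue_on \<Omega>)"
proof -
  have "\<Omega> \<in> lmeasurable"
    using bounded_\<Omega> \<Omega>_lebesgue bounded_set_imp_lmeasurable by blast
  then show ?thesis by (rule finite_measure_lebesgue_on)
qed

lemma integrable_const_\<Omega>: "integrable (lebesgue_on \<Omega>) (\<lambda>x. c::real)"
  using finite_measure.integrable_const[OF finite_measure_\<Omega>] .

lemma const_L2: "(\<lambda>x. c) \<in> L2 \<Omega>"
  by (simp add: L2_def integrable_const_\<Omega>)

lemma L2_integrable: "v \<in> L2 \<Omega> \<Longrightarrow> integrable (lebesgue_on \<Omega>) v"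
  using L2_mult_integrable[OF const_L2[of 1], of v] by simp

section \<open>Composition with \<open>f\<close> on bounded subsets of H10\<close>

lemma f_measurable: "f \<in> borel_measurable borel"
  by (rule borel_measurable_continuous_onI[OF f_cont])

lemma antideriv_measurable: "antideriv f \<in> borel_measurable borel"
  using DERIV_isCont[OF antideriv_has_derivative[OF f_cont]]
  by (intro borel_measurable_continuous_onI continuous_at_imp_continuous_on ballI)

text \<open>As \<open>f\<close> is not assumed differentiable, the mean value theorem is applied
  once: the increment of the primitive is f(z)(b - a), and f(z) - f(a) is bounded by the growth
  condition.\<close>

lemma antideriv_taylor:
  "\<bar>antideriv f b - antideriv f a - f a * (b - a)\<bar> \<le> L * (1 + 2 * \<bar>a\<bar> + 2 * \<bar>b\<bar>) powr p * (b - a)\<^sup>2"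
proof -
  have "\<exists>z. \<bar>z - a\<bar> \<le> \<bar>b - a\<bar> \<and> \<bar>z\<bar> \<le> \<bar>a\<bar> + \<bar>b\<bar> \<and> antideriv f b - antideriv f a = f z * (b - a)"
  proof (cases a b rule: linorder_cases)
    case less
    then obtain z where "z > a" "z < b" "antideriv f b - antideriv f a = (b - a) * f z"
      using MVT2[OF less antideriv_has_derivative[OF f_cont]] by blast
    then show ?thesis by (intro exI[of _ z]) auto
  next
    case greater
    then obtain z where "z > b" "z < a" "antideriv f a - antideriv f b = (a - b) * f z"
      using MVT2[OF greater antideriv_has_derivative[OF f_cont]] by blast
    then show ?thesis by (intro exI[of _ z]) (auto simp: algebra_simps)
  qed auto
  then obtain z where z: "\<bar>z - a\<bar> \<le> \<bar>b - a\<bar>" "\<bar>z\<bar> \<le> \<bar>a\<bar> + \<bar>b\<bar>" "antideriv f b - antideriv f a = f z * (b - a)" by blast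
  have "\<bar>f z - f a\<bar> \<le> L * (1 + \<bar>z\<bar> + \<bar>a\<bar>) powr p * \<bar>z - a\<bar>" by (rule f_growth)
  also have "\<dots> \<le> L * (1 + 2 * \<bar>a\<bar> + 2 * \<bar>b\<bar>) powr p * \<bar>b - a\<bar>"
  proof (intro mult_mono powr_mono2 z)
    show "1 + \<bar>z\<bar> + \<bar>a\<bar> \<le> 1 + 2 * \<bar>a\<bar> + 2 * \<bar>b\<bar>" using z(2) by linarith
  qed (use L p in auto)
  finally have "\<bar>f z - f a\<bar> * \<bar>b - a\<bar> \<le> L * (1 + 2 * \<bar>a\<bar> + 2 * \<bar>b\<bar>) powr p * \<bar>b - a\<bar> * \<bar>b - a\<bar>"
    by (rule mult_right_mono) simp
  moreover have "antideriv f b - antideriv f a - f a * (b - a) = (f z - f a) * (b - a)"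
    by (simp add: z(3) left_diff_distrib)
  ultimately show ?thesis by (simp add: abs_mult power2_eq_square mult.assoc)
qed

text \<open>The factors 2 make it dominate the weight of the growth condition for the pair and also
  the one for an intermediate point z, whose modulus is at most \<bar>a\<bar> +
  \<bar>b\<bar>.\<close>

definition weight :: "('a \<Rightarrow> real) \<Rightarrow> ('a \<Rightarrow> real) \<Rightarrow> 'a \<Rightarrow> real" where
  "weight a b x = 1 + 2 * \<bar>a x\<bar> + 2 * \<bar>b x\<bar>"

text \<open>Takes the place of Hoelder's inequality: both factors are replaced by their maximum and
  the exponents 2p and 2 add up. The bound is not homogeneous in \<open>y\<close>, so it is later
  applied to a normalised function.\<close>

lemma powr_add_split:
  fixes X y :: real
  assumes "X \<ge> 0" "y \<ge> 0"
  shows "X powr (2 * p) * y\<^sup>2 \<le> X powr (2 * (p + 1)) + y powr (2 * (p + 1))"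
proof -
  define m where "m = max X y"
  have m: "m \<ge> 0" "X \<le> m" "y \<le> m" using assms by (auto simp: m_def)
  have "X powr (2 * p) * y\<^sup>2 \<le> m powr (2 * p) * m\<^sup>2"
    using assms m p by (intro mult_mono powr_mono2 power_mono) auto
  also have "m\<^sup>2 = m powr 2" using m abs_powr_2[of m] by simp
  also have "m powr (2 * p) * m powr 2 = m powr (2 * (p + 1))" by (simp add: powr_add[symmetric] algebra_simps)
  also have "\<dots> \<le> X powr (2 * (p + 1)) + y powr (2 * (p + 1))"
    unfolding m_def by (cases "X \<le> y") (auto simp: max_def)
  finally show ?thesis .
qed

lemma weight_powr_le:
  assumes "r \<ge> 0"
  shows "weight a b x powr r \<le> 3 powr r * (1 + 2 powr r * \<bar>a x\<bar> powr r + 2 powr r * \<bar>b x\<bar> powr r)"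
proof -
  define m where "m = max 1 (max (2 * \<bar>a x\<bar>) (2 * \<bar>b x\<bar>))"
  have m: "m \<ge> 1" "weight a b x \<le> 3 * m" by (auto simp: m_def weight_def)
  have "weight a b x powr r \<le> (3 * m) powr r"
    using m assms by (intro powr_mono2) (auto simp: weight_def)
  also have "\<dots> = 3 powr r * m powr r" using m by (simp add: powr_mult)
  also have "m powr r \<le> 1 + (2 * \<bar>a x\<bar>) powr r + (2 * \<bar>b x\<bar>) powr r"
    unfolding m_def by (auto simp: max_def)
  finally show ?thesis by (simp add: powr_mult mult_left_mono)
qed

text \<open>Everything is controlled in L^{2(p+1)}, where the embedding bounds \<open>a\<close> and
  \<open>b\<close> through \<open>M\<close>. Applying the splitting to w/N and multiplying back
  yields the quadratic dependence on \<open>N\<close>.\<close>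

lemma weighted_integral_bound:
  assumes M: "M > 0"
  obtains K where "K > 0"
    "\<And>a b w N. a \<in> H10 \<Omega> \<Longrightarrow> b \<in> H10 \<Omega> \<Longrightarrow> w \<in> H10 \<Omega> \<Longrightarrow> H1_norm \<Omega> a \<le> M \<Longrightarrow> H1_norm \<Omega> b \<le> M \<Longrightarrow>
      0 < N \<Longrightarrow> H1_norm \<Omega> w \<le> N \<Longrightarrow>
      integrable (lebesgue_on \<Omega>) (\<lambda>x. weight a b x powr (2 * p) * (w x)\<^sup>2) \<and>
      (LINT x|lebesgue_on \<Omega>. weight a b x powr (2 * p) * (w x)\<^sup>2) \<le> K * N\<^sup>2"
proof -
  define r where "r = 2 * (p + 1)"
  have r: "r \<ge> 2" using p by (simp add: r_def)
  \<comment> \<open>The product is 2p(d-2) + 2d - 4, and 2p(d-2) < 4.\<close>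
  have "r * (real DIM('a) - 2) < 2 * real DIM('a)" using p by (simp add: r_def algebra_simps)
  from sobolev_H10[OF open_\<Omega> r this] obtain C where C: "C > 0"
    and Ci: "\<And>v N. v \<in> H10 \<Omega> \<Longrightarrow> 0 < N \<Longrightarrow> H1_norm \<Omega> v \<le> N \<Longrightarrow> integrable (lebesgue_on \<Omega>) (\<lambda>x. \<bar>v x\<bar> powr r)"
    and Cb: "\<And>v N. v \<in> H10 \<Omega> \<Longrightarrow> 0 < N \<Longrightarrow> H1_norm \<Omega> v \<le> N \<Longrightarrow> (LINT x|lebesgue_on \<Omega>. \<bar>v x\<bar> powr r) \<le> C * N powr r"
    by blast
  define vol where "vol = (LINT x|lebesgue_on \<Omega>. 1::real)"
  have vol: "vol \<ge> 0" unfolding vol_def by (intro Bochner_Integration.integral_nonneg) auto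
  define K where "K = 3 powr r * (vol + 2 powr r * (C * M powr r) + 2 powr r * (C * M powr r)) + C"
  have K: "K > 0" unfolding K_def using vol C by (intro add_nonneg_pos mult_nonneg_nonneg add_nonneg_nonneg) auto
  show ?thesis
  proof (rule that[OF K])
    fix a b w N
    assume ab: "a \<in> H10 \<Omega>" "b \<in> H10 \<Omega>" and w: "w \<in> H10 \<Omega>"
      and aM: "H1_norm \<Omega> a \<le> M" and bM: "H1_norm \<Omega> b \<le> M" and N: "0 < N" "H1_norm \<Omega> w \<le> N"
    have meas[measurable]: "a \<in> borel_measurable (lebesgue_on \<Omega>)" "b \<in> borel_measurable (lebesgue_on \<Omega>)" "w \<in> borel_measurable (lebesgue_on \<Omega>)"
      using ab w H10_D(2) L2_D(1) by blast+
    define w' where "w' = (\<lambda>x. (1 / N) * w x)"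
    have w': "w' \<in> H10 \<Omega>" unfolding w'_def by (rule H10_scale[OF open_\<Omega> w])
    have "H1_norm \<Omega> w' = (1 / N) * H1_norm \<Omega> w"
      unfolding w'_def H1_nrm_eq[symmetric] using N H1.nrm_scale[OF H10_D(1)[OF w], of "1 / N"] by simp
    then have w'1: "H1_norm \<Omega> w' \<le> 1" using N by (simp add: divide_le_eq)
    let ?g = "\<lambda>x. N\<^sup>2 * (3 powr r * (1 + 2 powr r * \<bar>a x\<bar> powr r + 2 powr r * \<bar>b x\<bar> powr r) + \<bar>w' x\<bar> powr r)"
    have gi: "integrable (lebesgue_on \<Omega>) ?g"
      by (intro integrable_mult_right Bochner_Integration.integrable_add integrable_const_\<Omega>
          Ci[OF ab(1) M aM] Ci[OF ab(2) M bM] Ci[OF w' zero_less_one w'1])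
    have le: "weight a b x powr (2 * p) * (w x)\<^sup>2 \<le> ?g x" for x
    proof -
      have "weight a b x powr (2 * p) * \<bar>w' x\<bar>\<^sup>2 \<le> weight a b x powr r + \<bar>w' x\<bar> powr r"
        unfolding r_def by (rule powr_add_split) (auto simp: weight_def)
      also have "\<dots> \<le> 3 powr r * (1 + 2 powr r * \<bar>a x\<bar> powr r + 2 powr r * \<bar>b x\<bar> powr r) + \<bar>w' x\<bar> powr r"
        using r by (intro add_right_mono weight_powr_le) auto
      finally have "N\<^sup>2 * (weight a b x powr (2 * p) * \<bar>w' x\<bar>\<^sup>2) \<le> ?g x" by (intro mult_left_mono) auto
      moreover have "N\<^sup>2 * (weight a b x powr (2 * p) * \<bar>w' x\<bar>\<^sup>2) = weight a b x powr (2 * p) * (w x)\<^sup>2"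
        using N by (simp add: w'_def power2_eq_square)
      ultimately show ?thesis by (simp only:)
    qed
    have i: "integrable (lebesgue_on \<Omega>) (\<lambda>x. weight a b x powr (2 * p) * (w x)\<^sup>2)"
    proof (rule Bochner_Integration.integrable_bound[OF gi])
      show "(\<lambda>x. weight a b x powr (2 * p) * (w x)\<^sup>2) \<in> borel_measurable (lebesgue_on \<Omega>)"
        unfolding weight_def by measurable
      show "AE x in lebesgue_on \<Omega>. norm (weight a b x powr (2 * p) * (w x)\<^sup>2) \<le> norm (?g x)"
        using le by (intro AE_I2) (simp add: order_trans[OF _ abs_ge_self])
    qed
    have "(LINT x|lebesgue_on \<Omega>. weight a b x powr (2 * p) * (w x)\<^sup>2) \<le> (LINT x|lebesgue_on \<Omega>. ?g x)"
      using i gi le by (intro integral_mono) auto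
    also have "\<dots> = N\<^sup>2 * (3 powr r * (vol + 2 powr r * (LINT x|lebesgue_on \<Omega>. \<bar>a x\<bar> powr r)
        + 2 powr r * (LINT x|lebesgue_on \<Omega>. \<bar>b x\<bar> powr r)) + (LINT x|lebesgue_on \<Omega>. \<bar>w' x\<bar> powr r))"
      using Ci[OF ab(1) M aM] Ci[OF ab(2) M bM] Ci[OF w' zero_less_one w'1] integrable_const_\<Omega>
      by (simp add: vol_def)
    also have "\<dots> \<le> N\<^sup>2 * K"
      unfolding K_def using Cb[OF ab(1) M aM] Cb[OF ab(2) M bM] Cb[OF w' zero_less_one w'1]
      by (intro mult_left_mono add_mono order_refl) auto
    finally show "integrable (lebesgue_on \<Omega>) (\<lambda>x. weight a b x powr (2 * p) * (w x)\<^sup>2) \<and>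
      (LINT x|lebesgue_on \<Omega>. weight a b x powr (2 * p) * (w x)\<^sup>2) \<le> K * N\<^sup>2"
      using i by (simp add: mult.commute)
  qed
qed

lemma f_comp_diff_sq:
  "(f (a x) - f (b x))\<^sup>2 \<le> L\<^sup>2 * (weight a b x powr (2 * p) * (a x - b x)\<^sup>2)"
proof -
  have "\<bar>f (a x) - f (b x)\<bar> \<le> L * (1 + \<bar>a x\<bar> + \<bar>b x\<bar>) powr p * \<bar>a x - b x\<bar>" by (rule f_growth)
  also have "\<dots> \<le> L * weight a b x powr p * \<bar>a x - b x\<bar>"
    unfolding weight_def using L p by (intro mult_mono powr_mono2 order_refl) auto
  finally have "\<bar>f (a x) - f (b x)\<bar>\<^sup>2 \<le> (L * weight a b x powr p * \<bar>a x - b x\<bar>)\<^sup>2"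
    by (rule power_mono) simp
  moreover have "(weight a b x powr p)\<^sup>2 = weight a b x powr (2 * p)"
    by (simp add: power2_eq_square powr_add[symmetric])
  ultimately show ?thesis by (simp add: power_mult_distrib mult.assoc)
qed

lemma f_comp_measurable:
  assumes "a \<in> H10 \<Omega>"
  shows "(\<lambda>x. f (a x)) \<in> borel_measurable (lebesgue_on \<Omega>)"
    and "(\<lambda>x. antideriv f (a x)) \<in> borel_measurable (lebesgue_on \<Omega>)"
proof -
  have a: "a \<in> borel_measurable (lebesgue_on \<Omega>)" by (rule L2_D(1)[OF H10_D(2)[OF assms]])
  show "(\<lambda>x. f (a x)) \<in> borel_measurable (lebesgue_on \<Omega>)"
    by (rule measurable_compose[OF a f_measurable])
  show "(\<lambda>x. antideriv f (a x)) \<in> borel_measurable (lebesgue_on \<Omega>)"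
    by (rule measurable_compose[OF a antideriv_measurable])
qed

text \<open>One constant serves two purposes: the Lipschitz bound of the composition into L2 and the
  second-order remainder of the integrated primitive. Both integrands are dominated by the weighted
  square.\<close>

lemma f_comp_diff:
  assumes M: "M > 0"
  obtains K where "K > 0"
    "\<And>a b N. a \<in> H10 \<Omega> \<Longrightarrow> b \<in> H10 \<Omega> \<Longrightarrow> H1_norm \<Omega> a \<le> M \<Longrightarrow> H1_norm \<Omega> b \<le> M \<Longrightarrow>
      0 < N \<Longrightarrow> H1_norm \<Omega> (\<lambda>x. a x - b x) \<le> N \<Longrightarrow>
      (\<lambda>x. f (a x) - f (b x)) \<in> L2 \<Omega> \<and> L2_norm \<Omega> (\<lambda>x. f (a x) - f (b x)) \<le> K * N \<and>
      integrable (lebesgue_on \<Omega>) (\<lambda>x. antideriv f (b x) - antideriv f (a x) - f (a x) * (b x - a x)) \<and>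
      \<bar>LINT x|lebesgue_on \<Omega>. antideriv f (b x) - antideriv f (a x) - f (a x) * (b x - a x)\<bar> \<le> K * N\<^sup>2"
proof -
  from weighted_integral_bound[OF M] obtain K where K: "K > 0" and
    Kb: "\<And>a b w N. a \<in> H10 \<Omega> \<Longrightarrow> b \<in> H10 \<Omega> \<Longrightarrow> w \<in> H10 \<Omega> \<Longrightarrow> H1_norm \<Omega> a \<le> M \<Longrightarrow> H1_norm \<Omega> b \<le> M \<Longrightarrow>
      0 < N \<Longrightarrow> H1_norm \<Omega> w \<le> N \<Longrightarrow>
      integrable (lebesgue_on \<Omega>) (\<lambda>x. weight a b x powr (2 * p) * (w x)\<^sup>2) \<and>
      (LINT x|lebesgue_on \<Omega>. weight a b x powr (2 * p) * (w x)\<^sup>2) \<le> K * N\<^sup>2" by blast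
  \<comment> \<open>The norm estimate costs the square root of \<open>K\<close>, the remainder
    estimate \<open>K\<close> itself.\<close>
  define K' where "K' = max (L * sqrt K) (L * K)"
  have K': "K' > 0" unfolding K'_def using L K by (simp add: less_max_iff_disj)
  show ?thesis
  proof (rule that[OF K'], intro conjI)
    fix a b N
    assume a: "a \<in> H10 \<Omega>" and b: "b \<in> H10 \<Omega>" and aM: "H1_norm \<Omega> a \<le> M" and bM: "H1_norm \<Omega> b \<le> M"
      and N: "0 < N" "H1_norm \<Omega> (\<lambda>x. a x - b x) \<le> N"
    let ?W = "\<lambda>x. weight a b x powr (2 * p) * (a x - b x)\<^sup>2"
    have w: "(\<lambda>x. a x - b x) \<in> H10 \<Omega>" by (rule H10_diff[OF open_\<Omega> a b])
    have Wi: "integrable (lebesgue_on \<Omega>) ?W" and Wb: "(LINT x|lebesgue_on \<Omega>. ?W x) \<le> K * N\<^sup>2"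
      using Kb[OF a b w aM bM N] by auto
    have am: "a \<in> borel_measurable (lebesgue_on \<Omega>)" "b \<in> borel_measurable (lebesgue_on \<Omega>)"
      by (rule L2_D(1)[OF H10_D(2)[OF a]], rule L2_D(1)[OF H10_D(2)[OF b]])
    note fm = f_comp_measurable[OF a] f_comp_measurable[OF b]
    have dm: "(\<lambda>x. f (a x) - f (b x)) \<in> borel_measurable (lebesgue_on \<Omega>)"
      by (intro borel_measurable_diff fm)
    have di: "integrable (lebesgue_on \<Omega>) (\<lambda>x. (f (a x) - f (b x))\<^sup>2)"
    proof (rule Bochner_Integration.integrable_bound[OF integrable_mult_right[OF Wi, of "L\<^sup>2"]])
      show "AE x in lebesgue_on \<Omega>. norm ((f (a x) - f (b x))\<^sup>2) \<le> norm (L\<^sup>2 * ?W x)"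
        using f_comp_diff_sq[of a _ b] by (intro AE_I2) (simp add: order_trans[OF _ abs_ge_self])
    qed (intro borel_measurable_power dm)
    show dL: "(\<lambda>x. f (a x) - f (b x)) \<in> L2 \<Omega>" using dm di by (simp add: L2_def)
    have "(L2_norm \<Omega> (\<lambda>x. f (a x) - f (b x)))\<^sup>2 = (LINT x|lebesgue_on \<Omega>. (f (a x) - f (b x))\<^sup>2)"
      by (rule L2_norm_sq)
    also have "\<dots> \<le> (LINT x|lebesgue_on \<Omega>. L\<^sup>2 * ?W x)"
      by (intro integral_mono di integrable_mult_right Wi f_comp_diff_sq)
    also have "\<dots> \<le> L\<^sup>2 * (K * N\<^sup>2)" using Wb by (simp add: mult_left_mono)
    also have "\<dots> = (L * sqrt K * N)\<^sup>2" using K by (simp add: power_mult_distrib)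
    finally have "L2_norm \<Omega> (\<lambda>x. f (a x) - f (b x)) \<le> L * sqrt K * N"
      by (rule power2_le_imp_le) (use L K N in auto)
    also have "\<dots> \<le> K' * N" using N unfolding K'_def by (intro mult_right_mono) auto
    finally show "L2_norm \<Omega> (\<lambda>x. f (a x) - f (b x)) \<le> K' * N" .
    let ?T = "\<lambda>x. antideriv f (b x) - antideriv f (a x) - f (a x) * (b x - a x)"
    have T: "\<bar>?T x\<bar> \<le> L * ?W x" for x
    proof -
      have "\<bar>?T x\<bar> \<le> L * weight a b x powr p * (b x - a x)\<^sup>2"
        unfolding weight_def by (rule antideriv_taylor)
      \<comment> \<open>The weight is at least 1, so the larger exponent may be used.\<close>
      also have "\<dots> \<le> L * weight a b x powr (2 * p) * (b x - a x)\<^sup>2"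
        using L p by (intro mult_right_mono mult_left_mono powr_mono) (auto simp: weight_def)
      finally show ?thesis by (simp add: mult.assoc power2_commute)
    qed
    show Ti: "integrable (lebesgue_on \<Omega>) ?T"
    proof (rule Bochner_Integration.integrable_bound[OF integrable_mult_right[OF Wi, of L]])
      show "?T \<in> borel_measurable (lebesgue_on \<Omega>)"
        by (intro borel_measurable_diff borel_measurable_times fm am)
      show "AE x in lebesgue_on \<Omega>. norm (?T x) \<le> norm (L * ?W x)"
        using T by (intro AE_I2) (simp add: order_trans[OF _ abs_ge_self])
    qed
    have "\<bar>LINT x|lebesgue_on \<Omega>. ?T x\<bar> \<le> (LINT x|lebesgue_on \<Omega>. \<bar>?T x\<bar>)"
      using integral_norm_bound[of "lebesgue_on \<Omega>" ?T] by simp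
    also have "\<dots> \<le> (LINT x|lebesgue_on \<Omega>. L * ?W x)"
      by (intro integral_mono integrable_abs Ti integrable_mult_right Wi T)
    also have "\<dots> \<le> L * (K * N\<^sup>2)" using Wb L by simp
    also have "\<dots> \<le> K' * N\<^sup>2" unfolding K'_def mult.assoc[symmetric] by (intro mult_right_mono) auto
    finally show "\<bar>LINT x|lebesgue_on \<Omega>. ?T x\<bar> \<le> K' * N\<^sup>2" .
  qed
qed

lemma zero_H10: "(\<lambda>x. 0) \<in> H10 \<Omega>"
  unfolding H10_def
proof (intro CollectI conjI allI impI)
  show z: "(\<lambda>x. 0) \<in> H_k \<Omega> 1" by (rule test_function_H1(1)[OF open_\<Omega> test_function_zero])
  fix e :: real assume "e > 0"
  have "H1_norm \<Omega> (\<lambda>x. 0) = 0" using H1.nrm_scale[OF z, of 0] unfolding H1_nrm_eq by simp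
  then show "\<exists>\<phi>\<in>test_functions \<Omega>. H1_norm \<Omega> (\<lambda>x. 0 - \<phi> x) < e"
    using \<open>e > 0\<close> by (intro bexI[of _ "\<lambda>x. 0"] test_function_zero) simp
qed

text \<open>Comparison with the zero function; constants are square integrable because \<Omega> is
  bounded.\<close>

lemma f_comp_L2: 
  assumes a: "a \<in> H10 \<Omega>"
  shows "(\<lambda>x. f (a x)) \<in> L2 \<Omega>" "integrable (lebesgue_on \<Omega>) (\<lambda>x. antideriv f (a x))"
proof -
  define M where "M = H1_norm \<Omega> a + 1"
  have M: "M > 0" unfolding M_def using H1_norm_facts(1)[OF H10_D(1)[OF a]] by simp
  have z: "H1_norm \<Omega> (\<lambda>x. 0) \<le> M"
    using H1.nrm_scale[OF H10_D(1)[OF zero_H10], of 0] M unfolding H1_nrm_eq by simp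
  from f_comp_diff[OF M] obtain K where K: "K > 0" and
    Kb: "\<And>a b N. a \<in> H10 \<Omega> \<Longrightarrow> b \<in> H10 \<Omega> \<Longrightarrow> H1_norm \<Omega> a \<le> M \<Longrightarrow> H1_norm \<Omega> b \<le> M \<Longrightarrow>
      0 < N \<Longrightarrow> H1_norm \<Omega> (\<lambda>x. a x - b x) \<le> N \<Longrightarrow>
      (\<lambda>x. f (a x) - f (b x)) \<in> L2 \<Omega> \<and> L2_norm \<Omega> (\<lambda>x. f (a x) - f (b x)) \<le> K * N \<and>
      integrable (lebesgue_on \<Omega>) (\<lambda>x. antideriv f (b x) - antideriv f (a x) - f (a x) * (b x - a x)) \<and>
      \<bar>LINT x|lebesgue_on \<Omega>. antideriv f (b x) - antideriv f (a x) - f (a x) * (b x - a x)\<bar> \<le> K * N\<^sup>2"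
    by blast
  have aM: "H1_norm \<Omega> a \<le> M" by (simp add: M_def)
  have d1: "(\<lambda>x. f (a x) - f 0) \<in> L2 \<Omega>"
    using Kb[OF a zero_H10 aM z M] aM by simp
  from L2_add[OF d1 const_L2[of "f 0"]] show "(\<lambda>x. f (a x)) \<in> L2 \<Omega>" by simp
  have "H1_norm \<Omega> (\<lambda>x. 0 - a x) \<le> M"
    using H1.nrm_minus_commute[OF H10_D(1)[OF zero_H10] H10_D(1)[OF a]] aM unfolding H1_nrm_eq by simp
  \<comment> \<open>Here the zero function is the base point, so the remainder is F(a) - f(0)
    a.\<close>
  from Kb[OF zero_H10 a z aM M this]
  have "integrable (lebesgue_on \<Omega>) (\<lambda>x. antideriv f (a x) - f 0 * a x)" by (simp add: antideriv_0)
  from Bochner_Integration.integrable_add[OF this integrable_mult_right[OF L2_integrable[OF H10_D(2)[OF a]], of "f 0"]]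
  show "integrable (lebesgue_on \<Omega>) (\<lambda>x. antideriv f (a x))" by simp
qed

text \<open>The first bound is Lipschitz continuity of \<open>G\<close> into the dual space. The
  second isolates the Laplacian and pays for the rest with the L2 norm of \<open>w\<close> alone,
  which is how L2 smallness becomes sufficient. The third says that \<open>G\<close> is the
  derivative of \<open>E0\<close> up to a quadratic error.\<close>

lemma G_diff_bound:
  assumes M: "M > 0"
  obtains K where "K > 0"
    "\<And>a b w N. a \<in> H10 \<Omega> \<Longrightarrow> b \<in> H10 \<Omega> \<Longrightarrow> w \<in> H10 \<Omega> \<Longrightarrow> H1_norm \<Omega> a \<le> M \<Longrightarrow> H1_norm \<Omega> b \<le> M \<Longrightarrow>
      0 < N \<Longrightarrow> H1_norm \<Omega> (\<lambda>x. a x - b x) \<le> N \<Longrightarrow> \<bar>G \<Omega> f a w - G \<Omega> f b w\<bar> \<le> K * N * H1_norm \<Omega> w"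
    "\<And>a b w N. a \<in> H10 \<Omega> \<Longrightarrow> b \<in> H10 \<Omega> \<Longrightarrow> w \<in> H10 \<Omega> \<Longrightarrow> H1_norm \<Omega> a \<le> M \<Longrightarrow> H1_norm \<Omega> b \<le> M \<Longrightarrow>
      0 < N \<Longrightarrow> H1_norm \<Omega> (\<lambda>x. a x - b x) \<le> N \<Longrightarrow>
      \<bar>G \<Omega> f a w - G \<Omega> f b w - grad_inner \<Omega> (\<lambda>x. a x - b x) w\<bar> \<le> K * N * L2_norm \<Omega> w"
    "\<And>a b N. a \<in> H10 \<Omega> \<Longrightarrow> b \<in> H10 \<Omega> \<Longrightarrow> H1_norm \<Omega> a \<le> M \<Longrightarrow> H1_norm \<Omega> b \<le> M \<Longrightarrow>
      0 < N \<Longrightarrow> H1_norm \<Omega> (\<lambda>x. a x - b x) \<le> N \<Longrightarrow>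
      \<bar>E0 \<Omega> f b - E0 \<Omega> f a - G \<Omega> f a (\<lambda>x. b x - a x)\<bar> \<le> K * N\<^sup>2"
proof -
  from f_comp_diff[OF M] obtain K where K: "K > 0" and
    Kb: "\<And>a b N. a \<in> H10 \<Omega> \<Longrightarrow> b \<in> H10 \<Omega> \<Longrightarrow> H1_norm \<Omega> a \<le> M \<Longrightarrow> H1_norm \<Omega> b \<le> M \<Longrightarrow>
      0 < N \<Longrightarrow> H1_norm \<Omega> (\<lambda>x. a x - b x) \<le> N \<Longrightarrow>
      (\<lambda>x. f (a x) - f (b x)) \<in> L2 \<Omega> \<and> L2_norm \<Omega> (\<lambda>x. f (a x) - f (b x)) \<le> K * N \<and>
      integrable (lebesgue_on \<Omega>) (\<lambda>x. antideriv f (b x) - antideriv f (a x) - f (a x) * (b x - a x)) \<and>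
      \<bar>LINT x|lebesgue_on \<Omega>. antideriv f (b x) - antideriv f (a x) - f (a x) * (b x - a x)\<bar> \<le> K * N\<^sup>2"
    by blast
  have grad_le: "grad.nrm v \<le> H1_norm \<Omega> v" if "v \<in> H_k \<Omega> 1" for v
    using H1_norm_facts(3-5)[OF that] unfolding grad.nrm_def H1_norm_def by simp
  have G2: "\<bar>G \<Omega> f a w - G \<Omega> f b w - grad_inner \<Omega> (\<lambda>x. a x - b x) w\<bar> \<le> (K + 1) * N * L2_norm \<Omega> w"
    if a: "a \<in> H10 \<Omega>" and b: "b \<in> H10 \<Omega>" and w: "w \<in> H10 \<Omega>" and aM: "H1_norm \<Omega> a \<le> M" "H1_norm \<Omega> b \<le> M"
      and N: "0 < N" "H1_norm \<Omega> (\<lambda>x. a x - b x) \<le> N" for a b w N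
  proof -
    have "G \<Omega> f a w - G \<Omega> f b w - grad_inner \<Omega> (\<lambda>x. a x - b x) w = L2_inner \<Omega> (\<lambda>x. f (a x) - f (b x)) w"
      unfolding G_def using grad.B_diff[OF H10_D(1)[OF a] H10_D(1)[OF b] H10_D(1)[OF w]]
        L2.B_diff[OF f_comp_L2(1)[OF a] f_comp_L2(1)[OF b] H10_D(2)[OF w]] by simp
    also have "\<bar>\<dots>\<bar> \<le> L2_norm \<Omega> (\<lambda>x. f (a x) - f (b x)) * L2_norm \<Omega> w"
      using Kb[OF a b aM N] L2.Cauchy_Schwarz[OF _ H10_D(2)[OF w]] unfolding L2_nrm by blast
    also have "\<dots> \<le> (K * N) * L2_norm \<Omega> w"
      using Kb[OF a b aM N] H1_norm_facts(6)[OF H10_D(1)[OF w]] by (intro mult_right_mono) auto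
    also have "\<dots> \<le> (K + 1) * N * L2_norm \<Omega> w"
      using N H1_norm_facts(6)[OF H10_D(1)[OF w]] by (intro mult_right_mono) auto
    finally show ?thesis .
  qed
  show ?thesis
  proof (rule that[of "K + 2"])
    show "K + 2 > 0" using K by simp
    fix a b w N
    assume a: "a \<in> H10 \<Omega>" and b: "b \<in> H10 \<Omega>" and w: "w \<in> H10 \<Omega>" and aM: "H1_norm \<Omega> a \<le> M" "H1_norm \<Omega> b \<le> M"
      and N: "0 < N" "H1_norm \<Omega> (\<lambda>x. a x - b x) \<le> N"
    have wH: "w \<in> H_k \<Omega> 1" and dH: "(\<lambda>x. a x - b x) \<in> H_k \<Omega> 1"
      using H10_D(1)[OF w] H10_D(1)[OF H10_diff[OF open_\<Omega> a b]] by auto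
    have "\<bar>grad_inner \<Omega> (\<lambda>x. a x - b x) w\<bar> \<le> grad.nrm (\<lambda>x. a x - b x) * grad.nrm w"
      by (rule grad.Cauchy_Schwarz[OF dH wH])
    also have "\<dots> \<le> N * H1_norm \<Omega> w"
      using grad_le[OF dH] grad_le[OF wH] N grad.nrm_nonneg[OF dH] grad.nrm_nonneg[OF wH] H1_norm_facts(1)[OF wH]
      by (intro mult_mono) auto
    finally have "\<bar>grad_inner \<Omega> (\<lambda>x. a x - b x) w\<bar> \<le> N * H1_norm \<Omega> w" .
    moreover have "(K + 1) * N * L2_norm \<Omega> w \<le> (K + 1) * N * H1_norm \<Omega> w"
      using K N H1_norm_facts(2)[OF wH] by (intro mult_left_mono) auto
    ultimately show "\<bar>G \<Omega> f a w - G \<Omega> f b w\<bar> \<le> (K + 2) * N * H1_norm \<Omega> w"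
      using G2[OF a b w aM N] by (simp add: algebra_simps abs_le_iff)
    have "(K + 1) * N * L2_norm \<Omega> w \<le> (K + 2) * N * L2_norm \<Omega> w"
      using N H1_norm_facts(6)[OF wH] by (intro mult_right_mono) auto
    then show "\<bar>G \<Omega> f a w - G \<Omega> f b w - grad_inner \<Omega> (\<lambda>x. a x - b x) w\<bar> \<le> (K + 2) * N * L2_norm \<Omega> w"
      using G2[OF a b w aM N] by linarith
  next
    fix a b N
    assume a: "a \<in> H10 \<Omega>" and b: "b \<in> H10 \<Omega>" and aM: "H1_norm \<Omega> a \<le> M" "H1_norm \<Omega> b \<le> M"
      and N: "0 < N" "H1_norm \<Omega> (\<lambda>x. a x - b x) \<le> N"
    have aH: "a \<in> H_k \<Omega> 1" and bH: "b \<in> H_k \<Omega> 1" using a b H10_D(1) by auto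
    have dH: "(\<lambda>x. b x - a x) \<in> H_k \<Omega> 1" by (rule H1.diff_closed[OF bH aH])
    have dN: "H1_norm \<Omega> (\<lambda>x. b x - a x) \<le> N"
      using N H1.nrm_minus_commute[OF aH bH] unfolding H1_nrm_eq by simp
    let ?T = "\<lambda>x. antideriv f (b x) - antideriv f (a x) - f (a x) * (b x - a x)"
    have "grad_inner \<Omega> (\<lambda>x. b x - a x) (\<lambda>x. b x - a x) = grad_inner \<Omega> b b - 2 * grad_inner \<Omega> b a + grad_inner \<Omega> a a"
      by (rule grad.B_diff_self[OF bH aH])
    moreover have "grad_inner \<Omega> a (\<lambda>x. b x - a x) = grad_inner \<Omega> b a - grad_inner \<Omega> a a"
      using grad.B_diff2[OF bH aH aH] grad.B_sym[of a b] by simp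
    moreover have "(LINT x|lebesgue_on \<Omega>. ?T x) = (LINT x|lebesgue_on \<Omega>. antideriv f (b x)) - (LINT x|lebesgue_on \<Omega>. antideriv f (a x))
        - L2_inner \<Omega> (\<lambda>x. f (a x)) (\<lambda>x. b x - a x)"
      unfolding L2_inner_def using f_comp_L2(2)[OF a] f_comp_L2(2)[OF b] L2_mult_integrable[OF f_comp_L2(1)[OF a] H1_L2[OF dH]]
      by simp
    ultimately have "E0 \<Omega> f b - E0 \<Omega> f a - G \<Omega> f a (\<lambda>x. b x - a x)
        = 1/2 * grad_inner \<Omega> (\<lambda>x. b x - a x) (\<lambda>x. b x - a x) + (LINT x|lebesgue_on \<Omega>. ?T x)"
      unfolding E0_def G_def by (simp add: algebra_simps)
    moreover have "\<bar>LINT x|lebesgue_on \<Omega>. ?T x\<bar> \<le> K * N\<^sup>2" using Kb[OF a b aM N] by blast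
    moreover have "grad_inner \<Omega> (\<lambda>x. b x - a x) (\<lambda>x. b x - a x) \<le> (H1_norm \<Omega> (\<lambda>x. b x - a x))\<^sup>2"
      using H1_norm_facts(3,5)[OF dH] by linarith
    moreover have "(H1_norm \<Omega> (\<lambda>x. b x - a x))\<^sup>2 \<le> N\<^sup>2"
      using dN H1_norm_facts(1)[OF dH] by (rule power_mono)
    moreover have "grad_inner \<Omega> (\<lambda>x. b x - a x) (\<lambda>x. b x - a x) \<ge> 0" by (rule H1_norm_facts(4)[OF dH])
    ultimately show "\<bar>E0 \<Omega> f b - E0 \<Omega> f a - G \<Omega> f a (\<lambda>x. b x - a x)\<bar> \<le> (K + 2) * N\<^sup>2"
      by (simp add: algebra_simps abs_le_iff)
  qed
qed

section \<open>Lower bounds for the dual norm of \<open>G\<close>\<close>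

lemma G_scale: "v \<in> H10 \<Omega> \<Longrightarrow> w \<in> H10 \<Omega> \<Longrightarrow> G \<Omega> f v (\<lambda>x. c * w x) = c * G \<Omega> f v w"
  unfolding G_def using grad.B_scale2[OF H10_D(1) H10_D(1), of w v c] L2.B_scale2[OF H10_D(2) f_comp_L2(1), of w v c]
  by (simp add: distrib_left)

lemma G_bounded:
  assumes v: "v \<in> H10 \<Omega>" and w: "w \<in> H10 \<Omega>"
  shows "\<bar>G \<Omega> f v w\<bar> \<le> (H1_norm \<Omega> v + L2_norm \<Omega> (\<lambda>x. f (v x))) * H1_norm \<Omega> w"
proof -
  have vH: "v \<in> H_k \<Omega> 1" and wH: "w \<in> H_k \<Omega> 1" using v w H10_D(1) by auto
  have grad_le: "grad.nrm v \<le> H1_norm \<Omega> v" if "v \<in> H_k \<Omega> 1" for v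
    using H1_norm_facts(3-5)[OF that] unfolding grad.nrm_def H1_norm_def by simp
  have "\<bar>grad_inner \<Omega> v w\<bar> \<le> grad.nrm v * grad.nrm w" by (rule grad.Cauchy_Schwarz[OF vH wH])
  also have "\<dots> \<le> H1_norm \<Omega> v * H1_norm \<Omega> w"
    using grad_le[OF vH] grad_le[OF wH] grad.nrm_nonneg[OF vH] grad.nrm_nonneg[OF wH] H1_norm_facts(1)[OF vH]
    by (intro mult_mono) auto
  finally have 1: "\<bar>grad_inner \<Omega> v w\<bar> \<le> H1_norm \<Omega> v * H1_norm \<Omega> w" .
  have "\<bar>L2_inner \<Omega> (\<lambda>x. f (v x)) w\<bar> \<le> L2_norm \<Omega> (\<lambda>x. f (v x)) * L2_norm \<Omega> w"
    using L2.Cauchy_Schwarz[OF f_comp_L2(1)[OF v] H10_D(2)[OF w]] unfolding L2_nrm .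
  also have "\<dots> \<le> L2_norm \<Omega> (\<lambda>x. f (v x)) * H1_norm \<Omega> w"
    using H1_norm_facts(2)[OF wH] L2.nrm_nonneg[OF f_comp_L2(1)[OF v]] unfolding L2_nrm by (intro mult_left_mono) auto
  finally show ?thesis using 1 unfolding G_def by (simp add: distrib_right)
qed

text \<open>A real-valued supremum bounds its members only if the set is bounded above;
  \<open>G_bounded\<close> ensures this. The vector is then normalised.\<close>

lemma Hm1_norm_G_ge:
  assumes v: "v \<in> H10 \<Omega>" and w: "w \<in> H10 \<Omega>" and pos: "H1_norm \<Omega> w > 0"
  shows "\<bar>G \<Omega> f v w\<bar> / H1_norm \<Omega> w \<le> Hm1_norm \<Omega> (G \<Omega> f v)"
proof -
  let ?N = "H1_norm \<Omega> w"
  let ?w = "\<lambda>x. (1 / ?N) * w x"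
  let ?C = "H1_norm \<Omega> v + L2_norm \<Omega> (\<lambda>x. f (v x))"
  have C: "?C \<ge> 0" using H1_norm_facts(1)[OF H10_D(1)[OF v]] L2.nrm_nonneg[OF f_comp_L2(1)[OF v]] unfolding L2_nrm by simp
  have w': "?w \<in> H10 \<Omega>" by (rule H10_scale[OF open_\<Omega> w])
  have "H1_norm \<Omega> ?w = \<bar>1 / ?N\<bar> * ?N" unfolding H1_nrm_eq[symmetric] by (rule H1.nrm_scale[OF H10_D(1)[OF w]])
  then have "H1_norm \<Omega> ?w \<le> 1" using pos by simp
  with w' have "\<bar>G \<Omega> f v ?w\<bar> \<le> Hm1_norm \<Omega> (G \<Omega> f v)"
    unfolding Hm1_norm_def
  proof (intro cSUP_upper bdd_aboveI2[where M = ?C])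
    fix z assume z: "z \<in> {w \<in> H10 \<Omega>. H1_norm \<Omega> w \<le> 1}"
    then have "\<bar>G \<Omega> f v z\<bar> \<le> ?C * H1_norm \<Omega> z" using G_bounded[OF v] by blast
    also have "\<dots> \<le> ?C * 1" using z C by (intro mult_left_mono) auto
    finally show "\<bar>G \<Omega> f v z\<bar> \<le> ?C" by simp
  qed auto
  then show ?thesis using G_scale[OF v w, of "1 / ?N"] pos by (simp add: abs_mult)
qed

end

section \<open>Equilibria and weak derivatives in time\<close>

lemma test_function_H10:
  assumes \<Omega>: "open \<Omega>" and \<phi>: "\<phi> \<in> test_functions \<Omega>" shows "\<phi> \<in> H10 \<Omega>"
  unfolding H10_def
proof (intro CollectI conjI allI impI)
  interpret H: semi_inner_space "H_k \<Omega> 1" "H1_inner \<Omega>" by (rule H1_inner_space[OF \<Omega>])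
  show "\<phi> \<in> H_k \<Omega> 1" by (rule test_function_H1(1)[OF \<Omega> \<phi>])
  fix e :: real assume "e > 0"
  have "H1_norm \<Omega> (\<lambda>x. \<phi> x - \<phi> x) = 0"
    using H.nrm_scale[OF test_function_H1(1)[OF \<Omega> \<phi>], of 0] unfolding H1_nrm[OF \<Omega>] by simp
  then show "\<exists>\<zeta>\<in>test_functions \<Omega>. H1_norm \<Omega> (\<lambda>x. \<phi> x - \<zeta> x) < e"
    using \<open>e > 0\<close> by (intro bexI[where x = \<phi>] \<phi>) simp
qed

text \<open>Vector integrals refer to a carrier, and the solution class uses
  \<open>H10 \<Omega>\<close>, so the H1 product is needed on this smaller space.\<close>

lemma H10_inner_space:
  assumes \<Omega>: "open \<Omega>" shows "semi_inner_space (H10 \<Omega>) (H1_inner \<Omega>)"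
proof -
  interpret H: semi_inner_space "H_k \<Omega> 1" "H1_inner \<Omega>" by (rule H1_inner_space[OF \<Omega>])
  show ?thesis
  proof
    fix v w z c assume v: "v \<in> H10 \<Omega>"
    show "(\<lambda>x. c * v x) \<in> H10 \<Omega>" by (rule H10_scale[OF \<Omega> v])
    show "0 \<le> H1_inner \<Omega> v v" by (rule H.B_nonneg[OF H10_D(1)[OF v]])
    { assume z: "z \<in> H10 \<Omega>"
      show "H1_inner \<Omega> (\<lambda>x. c * v x) z = c * H1_inner \<Omega> v z"
        by (rule H.B_scale[OF H10_D(1)[OF v] H10_D(1)[OF z]]) }
    assume w: "w \<in> H10 \<Omega>"
    show "(\<lambda>x. v x + w x) \<in> H10 \<Omega>" by (rule H10_add[OF \<Omega> v w])
    assume z: "z \<in> H10 \<Omega>"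
    show "H1_inner \<Omega> (\<lambda>x. v x + w x) z = H1_inner \<Omega> v z + H1_inner \<Omega> w z"
      by (rule H.B_add[OF H10_D(1)[OF v] H10_D(1)[OF w] H10_D(1)[OF z]])
  next
    fix v w show "H1_inner \<Omega> v w = H1_inner \<Omega> w v" by (rule H.B_sym)
  qed
qed

lemma H_k_2: "H_k \<Omega> 2 = {f \<in> L2 \<Omega>. \<forall>b\<in>Basis. \<exists>g\<in>H_k \<Omega> 1. has_weak_partial \<Omega> b f g}"
  by (simp only: numeral_2_eq_2 One_nat_def H_k.simps)

text \<open>Membership in H^2 provides some first derivative that lies in H^1, while
  \<open>laplacian\<close> differentiates the chosen one. The two agree almost everywhere, and the
  second derivative is transferred.\<close>

lemma second_weak_partial:
  assumes \<Omega>: "open \<Omega>" and \<psi>: "\<psi> \<in> H_k \<Omega> 2" and b: "b \<in> Basis"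
  shows "weak_partial \<Omega> b \<psi> \<in> L2 \<Omega>"
    and "has_weak_partial \<Omega> b (weak_partial \<Omega> b \<psi>) (weak_partial \<Omega> b (weak_partial \<Omega> b \<psi>))"
    and "weak_partial \<Omega> b (weak_partial \<Omega> b \<psi>) \<in> L2 \<Omega>"
proof -
  have \<Omega>': "\<Omega> \<in> sets lebesgue" by (rule open_lebesgue[OF \<Omega>])
  obtain g where g: "g \<in> H_k \<Omega> 1" "has_weak_partial \<Omega> b \<psi> g" using \<psi> b unfolding H_k_2 by blast
  note gL = H1_L2[OF g(1)] and g' = H1_weak_partial[OF \<Omega> g(1) b]
  have "AE x in lebesgue_on \<Omega>. weak_partial \<Omega> b \<psi> x = g x" by (rule weak_partial_AE[OF \<Omega> g(2)])
  then have ae: "AE x in lebesgue_on \<Omega>. g x = weak_partial \<Omega> b \<psi> x" by (rule eventually_mono) simp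
  show L: "weak_partial \<Omega> b \<psi> \<in> L2 \<Omega>" by (rule L2_cong_AE[OF \<Omega>' gL ae])
  have w: "has_weak_partial \<Omega> b (weak_partial \<Omega> b \<psi>) (weak_partial \<Omega> b g)"
    by (rule has_weak_partial_cong_AE[OF \<Omega> g'(1) L2_locally_integrable[OF \<Omega>' L] L2_locally_integrable[OF \<Omega>' g'(2)] b ae]) simp
  then show "has_weak_partial \<Omega> b (weak_partial \<Omega> b \<psi>) (weak_partial \<Omega> b (weak_partial \<Omega> b \<psi>))"
    by (rule weak_partialI)
  have "AE x in lebesgue_on \<Omega>. weak_partial \<Omega> b g x = weak_partial \<Omega> b (weak_partial \<Omega> b \<psi>) x"
    by (rule eventually_mono[OF weak_partial_AE[OF \<Omega> w]]) simp
  then show "weak_partial \<Omega> b (weak_partial \<Omega> b \<psi>) \<in> L2 \<Omega>"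
    by (rule L2_cong_AE[OF \<Omega>' g'(2)])
qed

context subcritical_nonlinearity
begin

lemma G_diff_right: "v \<in> H10 \<Omega> \<Longrightarrow> w \<in> H10 \<Omega> \<Longrightarrow> z \<in> H10 \<Omega> \<Longrightarrow> G \<Omega> f v (\<lambda>x. w x - z x) = G \<Omega> f v w - G \<Omega> f v z"
  unfolding G_def
  using grad.B_diff2[OF H10_D(1) H10_D(1) H10_D(1), of w z v] L2.B_diff2[OF H10_D(2) H10_D(2) f_comp_L2(1), of w z v]
  by simp

text \<open>For test functions this is the definition of the weak derivatives of the gradient,
  followed by the pointwise equation. Density of the test functions and the bound on
  \<open>G\<close> extend it to H10.\<close>

lemma equilibrium_G_eq_0:
  assumes \<psi>: "\<psi> \<in> equilibria \<Omega> f" and w: "w \<in> H10 \<Omega>"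
  shows "G \<Omega> f \<psi> w = 0"
proof -
  have \<psi>2: "\<psi> \<in> H_k \<Omega> 2" and \<psi>H: "\<psi> \<in> H10 \<Omega>" and eq: "AE x in lebesgue_on \<Omega>. - laplacian \<Omega> \<psi> x + f (\<psi> x) = 0"
    using \<psi> unfolding equilibria_def by blast+
  note sw = second_weak_partial[OF open_\<Omega> \<psi>2]
  have test: "G \<Omega> f \<psi> \<phi> = 0" if \<phi>: "\<phi> \<in> test_functions \<Omega>" for \<phi>
  proof -
    have \<phi>L: "\<phi> \<in> L2 \<Omega>" by (rule test_function_H1(2)[OF open_\<Omega> \<phi>])
    have part: "L2_inner \<Omega> (weak_partial \<Omega> b \<psi>) (weak_partial \<Omega> b \<phi>)
      = - (LINT x|lebesgue_on \<Omega>. weak_partial \<Omega> b (weak_partial \<Omega> b \<psi>) x * \<phi> x)" if b: "b \<in> Basis" for b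
    proof -
      have "L2_inner \<Omega> (weak_partial \<Omega> b \<psi>) (weak_partial \<Omega> b \<phi>) = L2_inner \<Omega> (weak_partial \<Omega> b \<psi>) (partial b \<phi>)"
        by (rule L2_inner_cong_AE[OF sw(1)[OF b] sw(1)[OF b]
              H1_weak_partial(2)[OF open_\<Omega> test_function_H1(1)[OF open_\<Omega> \<phi>] b]
              test_function_H1(2)[OF open_\<Omega> partial_test_function[OF \<phi> b]] AE_I2[OF refl]
              weak_partial_test_function_AE[OF open_\<Omega> \<phi> b]])
      then show ?thesis using sw(2)[OF b] \<phi> unfolding has_weak_partial_def L2_inner_def by simp
    qed
    have int: "integrable (lebesgue_on \<Omega>) (\<lambda>x. weak_partial \<Omega> b (weak_partial \<Omega> b \<psi>) x * \<phi> x)" if "b \<in> Basis" for b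
      by (rule L2_mult_integrable[OF sw(3)[OF that] \<phi>L])
    have lapm: "(\<lambda>x. laplacian \<Omega> \<psi> x * \<phi> x) \<in> borel_measurable (lebesgue_on \<Omega>)"
      unfolding laplacian_def
      by (intro borel_measurable_times borel_measurable_sum L2_D(1) sw(3) \<phi>L)
    have "grad_inner \<Omega> \<psi> \<phi> = - (LINT x|lebesgue_on \<Omega>. laplacian \<Omega> \<psi> x * \<phi> x)"
      unfolding grad_inner_def laplacian_def sum_distrib_right
      using part int by (simp add: sum_negf[symmetric])
    also have "(LINT x|lebesgue_on \<Omega>. laplacian \<Omega> \<psi> x * \<phi> x) = L2_inner \<Omega> (\<lambda>x. f (\<psi> x)) \<phi>"
      unfolding L2_inner_def
    proof (rule integral_cong_AE[OF lapm])
      show "(\<lambda>x. f (\<psi> x) * \<phi> x) \<in> borel_measurable (lebesgue_on \<Omega>)"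
        by (intro borel_measurable_times f_comp_measurable(1)[OF \<psi>H] L2_D(1)[OF \<phi>L])
      show "AE x in lebesgue_on \<Omega>. laplacian \<Omega> \<psi> x * \<phi> x = f (\<psi> x) * \<phi> x"
        by (rule eventually_mono[OF eq]) simp
    qed
    finally show ?thesis unfolding G_def by simp
  qed
  obtain \<phi> where \<phi>: "\<And>n. \<phi> n \<in> test_functions \<Omega>" "(\<lambda>n. H1_norm \<Omega> (\<lambda>x. w x - \<phi> n x)) \<longlonglongrightarrow> 0"
    using H10_approx[OF w] by blast
  let ?C = "H1_norm \<Omega> \<psi> + L2_norm \<Omega> (\<lambda>x. f (\<psi> x))"
  have "\<bar>G \<Omega> f \<psi> w\<bar> \<le> ?C * H1_norm \<Omega> (\<lambda>x. w x - \<phi> n x)" for n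
  proof -
    have p: "\<phi> n \<in> H10 \<Omega>" by (rule test_function_H10[OF open_\<Omega> \<phi>(1)])
    show ?thesis
      using G_bounded[OF \<psi>H H10_diff[OF open_\<Omega> w p]] G_diff_right[OF \<psi>H w p] test[OF \<phi>(1)] by simp
  qed
  moreover have "(\<lambda>n. ?C * H1_norm \<Omega> (\<lambda>x. w x - \<phi> n x)) \<longlonglongrightarrow> ?C * 0" by (intro tendsto_mult tendsto_const \<phi>(2))
  ultimately have "\<bar>G \<Omega> f \<psi> w\<bar> \<le> ?C * 0"
    by (intro tendsto_lowerbound[of "\<lambda>n. ?C * H1_norm \<Omega> (\<lambda>x. w x - \<phi> n x)" _ sequentially]) auto
  then show ?thesis by simp
qed

end

section \<open>Testing vector-valued integrals and time derivatives against a fixed vector\<close>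

context semi_inner_space
begin

lemma simple_fun_closed:
  assumes "simple_data X I s" "z \<in> X"
  shows "simple_fun s t \<in> X \<and> B (simple_fun s t) z = (\<Sum>(E, w)\<leftarrow>s. indicator E t * B w z)"
  using assms(1)
proof (induction s)
  case Nil
  \<comment> \<open>The locale does not postulate the zero function; it is obtained as 0 times
    \<open>z\<close>.\<close>
  have "(\<lambda>x. 0) \<in> X" using scale_closed[OF assms(2), of 0] by simp
  moreover have "B (\<lambda>x. 0) z = 0" using B_scale[OF assms(2) assms(2), of 0] by simp
  ultimately show ?case by (simp add: simple_fun_def[abs_def])
next
  case (Cons a s)
  obtain E w where a: "a = (E, w)" by (cases a)
  have w: "w \<in> X" and IH: "simple_fun s t \<in> X" "B (simple_fun s t) z = (\<Sum>(E, w)\<leftarrow>s. indicator E t * B w z)"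
    using Cons a by (auto simp: simple_data_def)
  have eq: "simple_fun (a # s) t = (\<lambda>x. (indicator E t * w x) + simple_fun s t x)"
    by (auto simp: simple_fun_def a)
  show ?case
    unfolding eq using add_closed[OF scale_closed[OF w] IH(1)] B_add[OF scale_closed[OF w] IH(1) assms(2)]
      B_scale[OF w assms(2)] IH(2) by (simp add: a)
qed

lemma simple_int_closed:
  assumes "simple_data X I s" "z \<in> X"
  shows "simple_int s \<in> X \<and> B (simple_int s) z = (\<Sum>(E, w)\<leftarrow>s. measure lebesgue E * B w z)"
  using assms(1)
proof (induction s)
  case Nil
  have "(\<lambda>x. 0) \<in> X" using scale_closed[OF assms(2), of 0] by simp
  moreover have "B (\<lambda>x. 0) z = 0" using B_scale[OF assms(2) assms(2), of 0] by simp
  ultimately show ?case by (simp add: simple_int_def[abs_def])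
next
  case (Cons a s)
  obtain E w where a: "a = (E, w)" by (cases a)
  have w: "w \<in> X" and IH: "simple_int s \<in> X" "B (simple_int s) z = (\<Sum>(E, w)\<leftarrow>s. measure lebesgue E * B w z)"
    using Cons a by (auto simp: simple_data_def)
  have eq: "simple_int (a # s) = (\<lambda>x. (measure lebesgue E * w x) + simple_int s x)"
    by (auto simp: simple_int_def a)
  show ?case
    unfolding eq using add_closed[OF scale_closed[OF w] IH(1)] B_add[OF scale_closed[OF w] IH(1) assms(2)]
      B_scale[OF w assms(2)] IH(2) by (simp add: a)
qed

lemma simple_fun_integral:
  assumes "simple_data X I s" "z \<in> X" "I \<in> sets lebesgue"
  shows "integrable (lebesgue_on I) (\<lambda>t. B (simple_fun s t) z)"
    and "(LINT t|lebesgue_on I. B (simple_fun s t) z) = B (simple_int s) z"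
proof -
  have "integrable (lebesgue_on I) (\<lambda>t. \<Sum>(E, w)\<leftarrow>s. indicator E t * B w z)
    \<and> (LINT t|lebesgue_on I. (\<Sum>(E, w)\<leftarrow>s. indicator E t * B w z)) = (\<Sum>(E, w)\<leftarrow>s. measure lebesgue E * B w z)"
    using assms(1)
  proof (induction s)
    case Nil
    then show ?case by simp
  next
    case (Cons a s)
    obtain E w where a: "a = (E, w)" by (cases a)
    have E: "E \<in> lmeasurable" "E \<subseteq> I" using Cons.prems by (auto simp: a simple_data_def)
    have eq: "indicator I t * indicator E t = (indicator E t :: real)" for t
      using E(2) by (auto split: split_indicator)
    have i: "integrable lebesgue (\<lambda>t. indicator E t :: real)"
      using E(1) by (intro integrable_real_indicator) (auto simp: fmeasurable_def)
    have iE: "integrable (lebesgue_on I) (\<lambda>t. indicator E t :: real)"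
      by (simp add: integrable_lebesgue_on_indicator[OF assms(3)] eq i)
    moreover have "(LINT t|lebesgue_on I. indicator E t) = measure lebesgue E"
      by (simp only: integral_lebesgue_on_indicator[OF assms(3)] eq) (use E(1) in simp)
    moreover have "integrable (lebesgue_on I) (\<lambda>t. \<Sum>(E, w)\<leftarrow>s. indicator E t * B w z)
      \<and> (LINT t|lebesgue_on I. (\<Sum>(E, w)\<leftarrow>s. indicator E t * B w z)) = (\<Sum>(E, w)\<leftarrow>s. measure lebesgue E * B w z)"
      using Cons.prems by (intro Cons.IH) (simp add: simple_data_def)
    ultimately show ?case by (simp add: a)
  qed
  then show "integrable (lebesgue_on I) (\<lambda>t. B (simple_fun s t) z)"
    "(LINT t|lebesgue_on I. B (simple_fun s t) z) = B (simple_int s) z"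
    using simple_fun_closed[OF assms(1,2)] simple_int_closed[OF assms(1,2)] by simp_all
qed

lemma inner_diff_bound: "v \<in> X \<Longrightarrow> w \<in> X \<Longrightarrow> z \<in> X \<Longrightarrow> \<bar>B v z - B w z\<bar> \<le> nrm (\<lambda>x. v x - w x) * nrm z"
  using Cauchy_Schwarz[OF diff_closed[of v w], of z] B_diff[of v w z] by simp

lemma strongly_measurable_inner:
  assumes "strongly_measurable X nrm I v" "z \<in> X" "I \<in> sets lebesgue"
  shows "(\<lambda>t. B (v t) z) \<in> borel_measurable (lebesgue_on I)"
proof -
  obtain s where s: "\<And>n. simple_data X I (s n)"
    and vX: "AE t in lebesgue_on I. v t \<in> X"
    and lim: "AE t in lebesgue_on I. (\<lambda>n. nrm (\<lambda>x. simple_fun (s n) t x - v t x)) \<longlonglongrightarrow> 0"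
    using assms(1) unfolding strongly_measurable_def by blast
  have m: "(\<lambda>t. B (simple_fun (s n) t) z) \<in> borel_measurable (lebesgue_on I)" for n
    by (rule borel_measurable_integrable[OF simple_fun_integral(1)[OF s assms(2,3)]])
  have "AE t in lebesgue_on I. lim (\<lambda>n. B (simple_fun (s n) t) z) = B (v t) z"
    using vX lim
  proof eventually_elim
    case (elim t)
    have "(\<lambda>n. B (simple_fun (s n) t) z - B (v t) z) \<longlonglongrightarrow> 0"
    proof (rule Lim_null_comparison)
      show "eventually (\<lambda>n. norm (B (simple_fun (s n) t) z - B (v t) z) \<le> nrm (\<lambda>x. simple_fun (s n) t x - v t x) * nrm z) sequentially"
        unfolding real_norm_def
        by (intro always_eventually allI inner_diff_bound conjunct1[OF simple_fun_closed[OF s assms(2)]] elim(1) assms(2))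
      show "(\<lambda>n. nrm (\<lambda>x. simple_fun (s n) t x - v t x) * nrm z) \<longlonglongrightarrow> 0"
        by (rule tendsto_mult_left_zero[OF elim(2)])
    qed
    then have "(\<lambda>n. B (simple_fun (s n) t) z) \<longlonglongrightarrow> B (v t) z" by (rule LIM_zero_cancel)
    then show ?case by (rule limI)
  qed
  then show ?thesis
    by (rule borel_measurable_lebesgue_on_AE[OF assms(3) borel_measurable_lim_metric[OF m]])
qed

text \<open>The vector integral commutes with testing: this holds for simple functions by linearity
  and survives the limit by Cauchy-Schwarz.\<close>

lemma vector_integral_inner:
  assumes v: "has_vector_integral X nrm I v y" and z: "z \<in> X" and I: "I \<in> sets lebesgue"
  shows "integrable (lebesgue_on I) (\<lambda>t. B (v t) z)" and "(LINT t|lebesgue_on I. B (v t) z) = B y z"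
proof -
  have sm: "strongly_measurable X nrm I v" and y: "y \<in> X" using v unfolding has_vector_integral_def by auto
  have vX: "AE t in lebesgue_on I. v t \<in> X" using sm unfolding strongly_measurable_def by blast
  obtain s where s: "\<And>n. simple_data X I (s n)"
    and l1: "(\<lambda>n. \<integral>\<^sup>+t. ennreal (nrm (\<lambda>x. simple_fun (s n) t x - v t x)) \<partial>lebesgue_on I) \<longlonglongrightarrow> 0"
    and l2: "(\<lambda>n. nrm (\<lambda>x. simple_int (s n) x - y x)) \<longlonglongrightarrow> 0"
    using v unfolding has_vector_integral_def by blast
  \<comment> \<open>The tested difference is divided by a positive bound of the norm of
    \<open>z\<close>. It is then dominated directly, and no constant has to be pulled out of the
    integral of the norms, whose measurability is not established here.\<close>
  define C where "C = nrm z + 1"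
  have C: "C > 0" "nrm z \<le> C" using nrm_nonneg[OF z] by (auto simp: C_def)
  note si = simple_fun_integral[OF s z I]
  note vm = strongly_measurable_inner[OF sm z I]
  define D where "D n t = (B (simple_fun (s n) t) z - B (v t) z) / C" for n t
  have Dm: "D n \<in> borel_measurable (lebesgue_on I)" for n
    unfolding D_def[abs_def] using borel_measurable_diff[OF borel_measurable_integrable[OF si(1)] vm]
    by (intro borel_measurable_divide) auto
  have Dle: "(\<integral>\<^sup>+t. ennreal (norm (D n t)) \<partial>lebesgue_on I)
      \<le> (\<integral>\<^sup>+t. ennreal (nrm (\<lambda>x. simple_fun (s n) t x - v t x)) \<partial>lebesgue_on I)" for n
  proof (rule nn_integral_mono_AE, rule eventually_mono[OF vX])
    fix t assume vt: "v t \<in> X"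
    have sX: "simple_fun (s n) t \<in> X" using simple_fun_closed[OF s z] by blast
    have "\<bar>B (simple_fun (s n) t) z - B (v t) z\<bar> \<le> nrm (\<lambda>x. simple_fun (s n) t x - v t x) * nrm z"
      by (rule inner_diff_bound[OF sX vt z])
    also have "\<dots> \<le> nrm (\<lambda>x. simple_fun (s n) t x - v t x) * C"
      by (intro mult_left_mono C nrm_nonneg diff_closed sX vt)
    finally have "norm (D n t) \<le> nrm (\<lambda>x. simple_fun (s n) t x - v t x)"
      using C by (simp add: D_def divide_le_eq)
    then show "ennreal (norm (D n t)) \<le> ennreal (nrm (\<lambda>x. simple_fun (s n) t x - v t x))" by (rule ennreal_leI)
  qed
  \<comment> \<open>One simple function at finite distance already makes the tested function
    integrable.\<close>
  have "eventually (\<lambda>n. (\<integral>\<^sup>+t. ennreal (nrm (\<lambda>x. simple_fun (s n) t x - v t x)) \<partial>lebesgue_on I) < 1) sequentially"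
    by (rule order_tendstoD(2)[OF l1]) simp
  then obtain n where n: "(\<integral>\<^sup>+t. ennreal (nrm (\<lambda>x. simple_fun (s n) t x - v t x)) \<partial>lebesgue_on I) < 1"
    unfolding eventually_sequentially by blast
  have "integrable (lebesgue_on I) (D n)"
  proof (rule integrableI_bounded[OF Dm])
    have "(\<integral>\<^sup>+t. ennreal (norm (D n t)) \<partial>lebesgue_on I) < 1" using Dle[of n] n by (rule le_less_trans)
    then show "(\<integral>\<^sup>+t. ennreal (norm (D n t)) \<partial>lebesgue_on I) < \<infinity>" using less_trans by fastforce
  qed
  from Bochner_Integration.integrable_diff[OF si(1)[of n] integrable_mult_right[OF this, of C]]
  have "integrable (lebesgue_on I) (\<lambda>t. B (simple_fun (s n) t) z - C * D n t)" .
  moreover have "(\<lambda>t. B (simple_fun (s n) t) z - C * D n t) = (\<lambda>t. B (v t) z)"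
    using C by (auto simp: D_def)
  ultimately show vi: "integrable (lebesgue_on I) (\<lambda>t. B (v t) z)" by simp
  have Di: "integrable (lebesgue_on I) (D n)" for n
    unfolding D_def[abs_def] by (intro integrable_divide Bochner_Integration.integrable_diff si(1) vi)
  have "(\<lambda>n. ennreal (LINT t|lebesgue_on I. norm (D n t))) \<longlonglongrightarrow> 0"
  proof (rule tendsto_sandwich[OF _ _ tendsto_const l1])
    show "eventually (\<lambda>n. ennreal (LINT t|lebesgue_on I. norm (D n t))
        \<le> (\<integral>\<^sup>+t. ennreal (nrm (\<lambda>x. simple_fun (s n) t x - v t x)) \<partial>lebesgue_on I)) sequentially"
    proof (intro always_eventually allI)
      fix n
      have "ennreal (LINT t|lebesgue_on I. norm (D n t)) = (\<integral>\<^sup>+t. ennreal (norm (D n t)) \<partial>lebesgue_on I)"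
        by (rule nn_integral_eq_integral[symmetric, OF integrable_norm[OF Di]]) simp
      then show "ennreal (LINT t|lebesgue_on I. norm (D n t))
        \<le> (\<integral>\<^sup>+t. ennreal (nrm (\<lambda>x. simple_fun (s n) t x - v t x)) \<partial>lebesgue_on I)" using Dle[of n] by simp
    qed
  qed simp
  then have "(\<lambda>n. LINT t|lebesgue_on I. norm (D n t)) \<longlonglongrightarrow> 0"
    by (subst (asm) ennreal_tendsto_0_iff) (auto intro: Bochner_Integration.integral_nonneg)
  then have "(\<lambda>n. LINT t|lebesgue_on I. D n t) \<longlonglongrightarrow> 0"
    by (rule Lim_null_comparison[rotated]) (intro always_eventually allI integral_norm_bound)
  then have "(\<lambda>n. C * (LINT t|lebesgue_on I. D n t) + (LINT t|lebesgue_on I. B (v t) z)) \<longlonglongrightarrow> C * 0 + (LINT t|lebesgue_on I. B (v t) z)"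
    by (intro tendsto_intros)
  moreover have "C * (LINT t|lebesgue_on I. D n t) + (LINT t|lebesgue_on I. B (v t) z) = B (simple_int (s n)) z" for n
  proof -
    have "C * (LINT t|lebesgue_on I. D n t) = (LINT t|lebesgue_on I. B (simple_fun (s n) t) z - B (v t) z)"
      using C by (simp add: D_def)
    also have "\<dots> = B (simple_int (s n)) z - (LINT t|lebesgue_on I. B (v t) z)"
      using si vi by simp
    finally show ?thesis by simp
  qed
  ultimately have "(\<lambda>n. B (simple_int (s n)) z) \<longlonglongrightarrow> (LINT t|lebesgue_on I. B (v t) z)" by simp
  moreover have "(\<lambda>n. B (simple_int (s n)) z) \<longlonglongrightarrow> B y z"
  proof -
    have "(\<lambda>n. B (simple_int (s n)) z - B y z) \<longlonglongrightarrow> 0"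
    proof (rule Lim_null_comparison)
      show "eventually (\<lambda>n. norm (B (simple_int (s n)) z - B y z) \<le> nrm (\<lambda>x. simple_int (s n) x - y x) * nrm z) sequentially"
        unfolding real_norm_def
        by (intro always_eventually allI inner_diff_bound conjunct1[OF simple_int_closed[OF s z]] y z)
      show "(\<lambda>n. nrm (\<lambda>x. simple_int (s n) x - y x) * nrm z) \<longlonglongrightarrow> 0"
        by (rule tendsto_mult_left_zero[OF l2])
    qed
    then show ?thesis by (rule LIM_zero_cancel)
  qed
  ultimately show "(LINT t|lebesgue_on I. B (v t) z) = B y z" by (rule LIMSEQ_unique)
qed

text \<open>Only the product is known to lie in \<open>X\<close>. Where the scalar vanishes,
  \<open>v\<close> itself may lie outside, but then both sides are 0.\<close>

lemma inner_scale_cancel: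
  assumes "(\<lambda>x. c * v x) \<in> X" "z \<in> X" shows "B (\<lambda>x. c * v x) z = c * B v z"
proof (cases "c = 0")
  case True
  then show ?thesis using B_scale[OF assms(2) assms(2), of 0] by simp
next
  case False
  have "v \<in> X" using scale_closed[OF assms(1), of "1 / c"] False by simp
  then show ?thesis using B_scale assms(2) by blast
qed

lemma vector_integral_scaled_inner:
  assumes v: "has_vector_integral X nrm I (\<lambda>t x. c t * v t x) y" and z: "z \<in> X" and I: "I \<in> sets lebesgue"
  shows "integrable (lebesgue_on I) (\<lambda>t. c t * B (v t) z)" and "(LINT t|lebesgue_on I. c t * B (v t) z) = B y z"
proof -
  have "AE t in lebesgue_on I. (\<lambda>x. c t * v t x) \<in> X"
    using v unfolding has_vector_integral_def strongly_measurable_def by blast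
  then have ae: "AE t in lebesgue_on I. B (\<lambda>x. c t * v t x) z = c t * B (v t) z"
    by (rule eventually_mono) (rule inner_scale_cancel[OF _ z])
  note vi = vector_integral_inner[OF v z I]
  have m: "(\<lambda>t. c t * B (v t) z) \<in> borel_measurable (lebesgue_on I)"
    by (rule borel_measurable_lebesgue_on_AE[OF I borel_measurable_integrable[OF vi(1)] ae])
  show "integrable (lebesgue_on I) (\<lambda>t. c t * B (v t) z)"
    by (rule integrable_cong_AE_imp[OF vi(1) m]) (use ae in \<open>auto elim!: eventually_mono\<close>)
  show "(LINT t|lebesgue_on I. c t * B (v t) z) = B y z"
    using integral_cong_AE[OF borel_measurable_integrable[OF vi(1)] m ae] vi(2) by simp
qed

text \<open>The gateway to the results on the line. Local integrability of the tested function is a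
  premise, supplied by continuity in the applications, while that of the tested derivative is
  extracted from the integrals against test functions.\<close>

lemma weak_time_derivative_inner:
  assumes v: "has_weak_time_derivative X nrm {0..} v v'" and z: "z \<in> X"
    and li: "locally_integrable {0<..} (\<lambda>t. B (v t) z)"
  shows "has_weak_partial {0<..} 1 (\<lambda>t. B (v t) z) (\<lambda>t. B (v' t) z)"
proof -
  have I: "{0..} \<in> sets (lebesgue :: real measure)" "{0<..} \<in> sets (lebesgue :: real measure)" by auto
  have int: "integrable (lebesgue_on {0..}) (\<lambda>t. \<eta> t * B (v' t) z) \<and>
      (LINT t|lebesgue_on {0..}. partial 1 \<eta> t * B (v t) z) = - (LINT t|lebesgue_on {0..}. \<eta> t * B (v' t) z)"
    if \<eta>: "\<eta> \<in> test_functions {0<..}" for \<eta>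
  proof -
    obtain y where y: "has_vector_integral X nrm {0..} (\<lambda>t x. partial 1 \<eta> t * v t x) y"
      "has_vector_integral X nrm {0..} (\<lambda>t x. \<eta> t * v' t x) (\<lambda>x. - y x)"
      using v \<eta> unfolding has_weak_time_derivative_def by (auto simp: interior_real_atLeast)
    have "y \<in> X" using y(1) unfolding has_vector_integral_def by blast
    then have "B (\<lambda>x. - y x) z = - B y z" using B_scale[OF _ z, of y "-1"] by simp
    then show ?thesis
      using vector_integral_scaled_inner[OF y(1) z I(1)] vector_integral_scaled_inner[OF y(2) z I(1)] by simp
  qed
  \<comment> \<open>The vector integrals run over the closed half-line, the scalar weak derivative
    over the open one. Functions vanishing at 0 do not see the difference.\<close>
  have cut: "(LINT t|lebesgue_on {0<..}. g t) = (LINT t|lebesgue_on {0..}. g t)" if "g 0 = 0" for g :: "real \<Rightarrow> real"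
  proof -
    have "(\<lambda>t. indicator {0<..} t * g t) = (\<lambda>t. indicator {0..} t * g t)"
    proof
      fix t show "indicator {0<..} t * g t = indicator {0..} t * g t"
        using that by (cases "t = 0") (auto split: split_indicator)
    qed
    then show ?thesis by (simp add: integral_lebesgue_on_indicator[OF I(1)] integral_lebesgue_on_indicator[OF I(2)])
  qed
  show ?thesis
    unfolding has_weak_partial_def
  proof (intro conjI ballI li)
    fix \<eta> :: "real \<Rightarrow> real" assume \<eta>: "\<eta> \<in> test_functions {0<..}"
    have z0: "\<eta> 0 = 0" by (rule test_functionsD(2)[OF \<eta>]) simp
    have p0: "partial 1 \<eta> 0 = 0" by (rule test_functionsD(2)[OF partial_test_function[OF \<eta>]]) auto
    show "(LINT t|lebesgue_on {0<..}. B (v t) z * partial 1 \<eta> t) = - (LINT t|lebesgue_on {0<..}. B (v' t) z * \<eta> t)"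
      using int[OF \<eta>] cut[of "\<lambda>t. B (v t) z * partial 1 \<eta> t"] cut[of "\<lambda>t. B (v' t) z * \<eta> t"] z0 p0
      by (simp add: mult.commute)
  next
    show "locally_integrable {0<..} (\<lambda>t. B (v' t) z)"
      unfolding locally_integrable_def
    proof (intro allI impI)
      fix K :: "real set" assume K: "compact K \<and> K \<subseteq> {0<..}"
      show "integrable (lebesgue_on K) (\<lambda>t. B (v' t) z)"
      proof (cases "K = {}")
        case True
        then show ?thesis by (simp add: integrable_lebesgue_on_indicator)
      next
        case False
        obtain a where a: "a \<in> K" "\<And>t. t \<in> K \<Longrightarrow> a \<le> t" using compact_attains_inf[of K] K False by blast
        obtain b where b: "b \<in> K" "\<And>t. t \<in> K \<Longrightarrow> t \<le> b" using compact_attains_sup[of K] K False by blast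
        have a0: "a > 0" using a(1) K by auto
        have ab: "a \<le> b" using a(2)[OF b(1)] .
        \<comment> \<open>A test function bounded below by a positive number on \<open>K\<close>:
          dividing by it recovers integrability on \<open>K\<close> from that of the
          product.\<close>
        define \<eta> where "\<eta> = box_bump 1 (a / 2) (b + 1)"
        have \<eta>: "\<eta> \<in> test_functions {0<..}"
          unfolding \<eta>_def by (rule box_bump_test_function) (use a0 in auto)
        have pos: "\<eta> t > 0" if "t \<in> K" for t
          unfolding \<eta>_def using a(2)[OF that] b(2)[OF that] a0 by (intro box_bump_pos) auto
        have c: "continuous_on UNIV \<eta>" by (rule smooth_continuous[OF test_functionsD(1)[OF \<eta>]])
        obtain t0 where t0: "t0 \<in> K" "\<And>t. t \<in> K \<Longrightarrow> \<eta> t0 \<le> \<eta> t"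
          using continuous_attains_inf[of K \<eta>] K False continuous_on_subset[OF c] by blast
        have Ks: "K \<in> sets lebesgue" using K lmeasurable_compact by blast
        have i: "integrable lebesgue (\<lambda>t. indicator {0..} t * (\<eta> t * B (v' t) z))"
          using int[OF \<eta>] by (simp add: integrable_lebesgue_on_indicator[OF I(1)])
        have \<eta>m: "\<eta> \<in> borel_measurable lebesgue" by (rule continuous_imp_lebesgue_measurable[OF c])
        have "integrable lebesgue (\<lambda>t. (indicator K t / \<eta> t) * (indicator {0..} t * (\<eta> t * B (v' t) z)))"
        proof (rule Bochner_Integration.integrable_bound[OF integrable_mult_right[OF i, of "1 / \<eta> t0"]])
          show "(\<lambda>t. (indicator K t / \<eta> t) * (indicator {0..} t * (\<eta> t * B (v' t) z))) \<in> borel_measurable lebesgue"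
            by (rule borel_measurable_times[OF borel_measurable_divide[OF borel_measurable_indicator[OF Ks] \<eta>m] borel_measurable_integrable[OF i]])
          show "AE t in lebesgue. norm ((indicator K t / \<eta> t) * (indicator {0..} t * (\<eta> t * B (v' t) z)))
              \<le> norm (1 / \<eta> t0 * (indicator {0..} t * (\<eta> t * B (v' t) z)))"
          proof (rule AE_I2)
            fix t
            show "norm ((indicator K t / \<eta> t) * (indicator {0..} t * (\<eta> t * B (v' t) z)))
              \<le> norm (1 / \<eta> t0 * (indicator {0..} t * (\<eta> t * B (v' t) z)))"
            proof (cases "t \<in> K")
              case True
              have "\<bar>indicator K t / \<eta> t\<bar> \<le> \<bar>1 / \<eta> t0\<bar>"
                using True pos[OF True] pos[OF t0(1)] t0(2)[OF True] by (simp add: frac_le)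
              then show ?thesis
                unfolding real_norm_def abs_mult[of "indicator K t / \<eta> t"] abs_mult[of "1 / \<eta> t0"]
                by (rule mult_right_mono) simp
            qed simp
          qed
        qed
        moreover have "(\<lambda>t. (indicator K t / \<eta> t) * (indicator {0..} t * (\<eta> t * B (v' t) z))) = (\<lambda>t. indicator K t * B (v' t) z)"
        proof
          fix t
          show "(indicator K t / \<eta> t) * (indicator {0..} t * (\<eta> t * B (v' t) z)) = indicator K t * B (v' t) z"
            using pos[of t] a(2)[of t] a0 by (cases "t \<in> K") auto
        qed
        ultimately show ?thesis by (simp add: integrable_lebesgue_on_indicator[OF Ks])
      qed
    qed
  qed
qed

lemma continuous_into_inner:
  assumes "continuous_into X nrm {0..} v" "z \<in> X"
  shows "continuous_on {0..} (\<lambda>t. B (v t) z)"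
  unfolding continuous_on_def
proof
  fix t :: real assume t: "t \<in> {0..}"
  have vX: "\<And>s. s \<in> {0..} \<Longrightarrow> v s \<in> X" and lim: "((\<lambda>s. nrm (\<lambda>x. v s x - v t x)) \<longlongrightarrow> 0) (at t within {0..})"
    using assms(1) t unfolding continuous_into_def by auto
  have "((\<lambda>s. B (v s) z - B (v t) z) \<longlongrightarrow> 0) (at t within {0..})"
  proof (rule Lim_null_comparison)
    show "eventually (\<lambda>s. norm (B (v s) z - B (v t) z) \<le> nrm (\<lambda>x. v s x - v t x) * nrm z) (at t within {0..})"
      unfolding eventually_at_filter
      using inner_diff_bound[OF vX vX[OF t] assms(2)] by (intro always_eventually) simp
    show "((\<lambda>s. nrm (\<lambda>x. v s x - v t x) * nrm z) \<longlongrightarrow> 0) (at t within {0..})"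
      by (rule tendsto_mult_left_zero[OF lim])
  qed
  then show "((\<lambda>s. B (v s) z) \<longlongrightarrow> B (v t) z) (at t within {0..})" by (rule LIM_zero_cancel)
qed

text \<open>Test with the increment itself: its squared norm is an increment of a scalar function
  whose weak derivative is at most M times the norm of the increment. Cancel one factor.\<close>

lemma Lipschitz_of_weak_derivative:
  assumes c: "continuous_into X nrm {0..} v"
    and w: "\<And>z. z \<in> X \<Longrightarrow> has_weak_partial {0<..} 1 (\<lambda>t. B (v t) z) (\<lambda>t. B (v' t) z)"
    and b: "AE t in lebesgue_on {s..t}. v' t \<in> X \<and> nrm (v' t) \<le> M"
    and st: "0 < s" "s \<le> t" and M: "M \<ge> 0"
  shows "nrm (\<lambda>x. v t x - v s x) \<le> M * (t - s)"
proof -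
  have vX: "v t \<in> X" "v s \<in> X" using c st unfolding continuous_into_def by auto
  define z where "z = (\<lambda>x. v t x - v s x)"
  have z: "z \<in> X" unfolding z_def by (rule diff_closed[OF vX])
  have "AE t in lebesgue_on {s..t}. \<bar>B (v' t) z\<bar> \<le> M * nrm z"
  proof (rule eventually_mono[OF b])
    fix t assume t: "v' t \<in> X \<and> nrm (v' t) \<le> M"
    then have "\<bar>B (v' t) z\<bar> \<le> nrm (v' t) * nrm z" using Cauchy_Schwarz z by blast
    also have "\<dots> \<le> M * nrm z" using t nrm_nonneg[OF z] by (intro mult_right_mono) auto
    finally show "\<bar>B (v' t) z\<bar> \<le> M * nrm z" .
  qed
  then have "\<bar>B (v t) z - B (v s) z\<bar> \<le> M * nrm z * (t - s)"
    by (intro weak_partial_increment_abs_le[OF open_greaterThan w[OF z] _ st(2)]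
        continuous_on_subset[OF continuous_into_inner[OF c z]]) (use st in auto)
  moreover have "B (v t) z - B (v s) z = (nrm z)\<^sup>2"
    using B_diff[OF vX z] nrm_sq[OF z] unfolding z_def by simp
  ultimately have le: "nrm z * nrm z \<le> nrm z * (M * (t - s))" by (simp add: power2_eq_square mult_ac)
  show ?thesis
  proof (cases "nrm z = 0")
    case True
    then show ?thesis using M st unfolding z_def by simp
  next
    case False
    then have "nrm z > 0" using nrm_nonneg[OF z] by simp
    with le have "nrm z \<le> M * (t - s)" by (rule mult_left_le_imp_le)
    then show ?thesis unfolding z_def .
  qed
qed

end

section \<open>The energy inequality and the theorem\<close>

lemma weak_partial_increment_approx:
  fixes g k :: "real \<Rightarrow> real"
  assumes I: "open I" and w: "has_weak_partial I 1 g k" and g: "continuous_on I g"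
    and st: "s \<le> t" "{s..t} \<subseteq> I" and B: "AE x in lebesgue_on {s..t}. \<bar>k x - c\<bar> \<le> \<epsilon>"
  shows "\<bar>g t - g s - c * (t - s)\<bar> \<le> \<epsilon> * (t - s)"
proof -
  have "AE x in lebesgue_on {s..t}. k x \<le> c + \<epsilon>" by (rule eventually_mono[OF B]) linarith
  from weak_partial_increment_le[OF I w g st this] have 1: "g t - g s \<le> (c + \<epsilon>) * (t - s)" .
  have w': "has_weak_partial I 1 (\<lambda>x. (-1) * g x) (\<lambda>x. (-1) * k x)" by (rule has_weak_partial_scale[OF w])
  have "AE x in lebesgue_on {s..t}. (-1) * k x \<le> \<epsilon> - c" by (rule eventually_mono[OF B]) linarith
  from weak_partial_increment_le[OF I w' continuous_on_mult_left[OF g] st this]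
  have "g s - g t \<le> (\<epsilon> - c) * (t - s)" by simp
  with 1 show ?thesis by (simp add: algebra_simps abs_le_iff)
qed

lemma AE_lebesgue_on_subset:
  assumes "AE x in lebesgue_on A. P x" "B \<subseteq> A" "A \<in> sets lebesgue" "B \<in> sets lebesgue"
  shows "AE x in lebesgue_on B. P x"
  unfolding AE_lebesgue_on_iff[OF assms(4)]
  by (rule eventually_mono[OF assms(1)[unfolded AE_lebesgue_on_iff[OF assms(3)]]]) (use assms(2) in blast)

lemma vLinf_loc_bound:
  assumes "v \<in> vLinf_loc X N {0..}" "0 \<le> a"
  obtains M where "M \<ge> 0" "AE t in lebesgue_on {a..b}. v t \<in> X \<and> N (v t) \<le> M"
proof -
  have sm: "AE t in lebesgue_on {0..}. v t \<in> X"
    using assms(1) unfolding vLinf_loc_def strongly_measurable_def by blast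
  have "AE t in lebesgue_on {a..b}. v t \<in> X"
    by (rule AE_lebesgue_on_subset[OF sm]) (use assms(2) in auto)
  moreover have "compact {a..b} \<and> {a..b} \<subseteq> {0..}" using assms(2) by auto
  then obtain M where "AE t in lebesgue_on {a..b}. N (v t) \<le> M"
    using assms(1) unfolding vLinf_loc_def by blast
  ultimately have "AE t in lebesgue_on {a..b}. v t \<in> X \<and> N (v t) \<le> max M 0"
    by eventually_elim auto
  then show ?thesis using that[of "max M 0"] by simp
qed

text \<open>Increments of second order force monotonicity: subdivide the interval into \<open>n\<close> equal parts.\<close>

lemma quadratic_increments_imp_le:
  fixes E :: "real \<Rightarrow> real"
  assumes inc: "\<And>t t'. a \<le> t \<Longrightarrow> t < t' \<Longrightarrow> t' \<le> b \<Longrightarrow> E t' - E t \<le> C * (t' - t)\<^sup>2"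
    and ab: "a \<le> b"
  shows "E b \<le> E a"
proof (cases "a = b")
  case False
  then have ab': "a < b" using ab by simp
  have bound: "E b - E a \<le> C * (b - a)\<^sup>2 * inverse (real (Suc n))" for n
  proof -
    define N where "N = real (Suc n)"
    define x where "x i = a + real i * ((b - a) / N)" for i
    have N: "N > 0" by (simp add: N_def)
    have step: "x (Suc i) - x i = (b - a) / N" for i unfolding x_def of_nat_Suc distrib_right by simp
    have "E (x (Suc i)) - E (x i) \<le> C * ((b - a) / N)\<^sup>2" if i: "i < Suc n" for i
    proof -
      have "a \<le> x i" unfolding x_def using N ab by simp
      moreover have "x i < x (Suc i)" using step[of i] N ab' by (smt (verit) divide_pos_pos)
      moreover have "x (Suc i) \<le> b"
      proof -
        have "real (Suc i) * (b - a) \<le> N * (b - a)" using i ab by (intro mult_right_mono) (auto simp: N_def)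
        then show ?thesis unfolding x_def using N by (simp add: field_simps)
      qed
      ultimately have "E (x (Suc i)) - E (x i) \<le> C * (x (Suc i) - x i)\<^sup>2" by (rule inc)
      then show ?thesis unfolding step .
    qed
    then have "(\<Sum>i<Suc n. E (x (Suc i)) - E (x i)) \<le> (\<Sum>i<Suc n. C * ((b - a) / N)\<^sup>2)"
      by (intro sum_mono) simp
    also have "\<dots> = N * (C * ((b - a) / N)\<^sup>2)" by (simp add: N_def)
    also have "\<dots> = C * (b - a)\<^sup>2 * inverse N" using N by (simp add: field_simps power2_eq_square)
    also have "(\<Sum>i<Suc n. E (x (Suc i)) - E (x i)) = E (x (Suc n)) - E (x 0)" by (rule sum_lessThan_telescope)
    also have "x (Suc n) = b" unfolding x_def N_def[symmetric] using N by simp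
    also have "x 0 = a" by (simp add: x_def)
    finally show ?thesis by (simp add: N_def)
  qed
  have "(\<lambda>n. C * (b - a)\<^sup>2 * inverse (real (Suc n))) \<longlonglongrightarrow> C * (b - a)\<^sup>2 * 0"
    by (intro tendsto_mult tendsto_const LIMSEQ_inverse_real_of_nat)
  then have "E b - E a \<le> C * (b - a)\<^sup>2 * 0"
    using bound by (intro LIMSEQ_le_const) auto
  then show ?thesis by simp
qed simp

context subcritical_nonlinearity
begin

text \<open>The equation at time \<tau> is tested with the fixed vector u(t') - u(t) and integrated
  over [t,t'], so no chain rule for the energy is used. All errors are quadratic in t' - t, and such
  increments force monotonicity.\<close>

lemma energy_bound:
  assumes u: "u \<in> solution_class \<Omega>" and sol: "solves_damped_wave \<Omega> f h u0 u1 u"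
    and hc: "continuous_on {0..} h" and h0: "\<And>t. 0 \<le> t \<Longrightarrow> 0 \<le> h t"
  obtains E where "\<And>t. 1 \<le> t \<Longrightarrow> E0 \<Omega> f (u t) \<le> E"
proof -
  interpret X: semi_inner_space "H10 \<Omega>" "H1_inner \<Omega>" by (rule H10_inner_space[OF open_\<Omega>])
  have Xn: "X.nrm = H1_norm \<Omega>" by (rule H1_nrm[OF open_\<Omega>])
  have Ln: "L2.nrm \<Omega> = L2_norm \<Omega>" by (rule ext) (rule L2_nrm)
  have uX: "u t \<in> H10 \<Omega>" if "t \<ge> 0" for t using sol that unfolding solves_damped_wave_def by blast
  have uH: "u t \<in> H_k \<Omega> 1" and uL: "u t \<in> L2 \<Omega>" if "t \<ge> 0" for t using H10_D[OF uX[OF that]] by auto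
  have uc: "continuous_into (H10 \<Omega>) (H1_norm \<Omega>) {0..} u"
    and c1: "u \<in> vWinf_loc (H10 \<Omega>) (H1_norm \<Omega>) {0..} 1"
    and c2: "u \<in> vWinf_loc (L2 \<Omega>) (L2_norm \<Omega>) {0..} 2"
    using u unfolding solution_class_def by blast+
  obtain v1 where v1: "v1 \<in> vLinf_loc (H10 \<Omega>) (H1_norm \<Omega>) {0..}"
    "has_weak_time_derivative (H10 \<Omega>) (H1_norm \<Omega>) {0..} u v1"
    using c1 unfolding One_nat_def vWinf_loc.simps by blast
  obtain a1 a2 where a: "a2 \<in> vLinf_loc (L2 \<Omega>) (L2_norm \<Omega>) {0..}"
    "has_weak_time_derivative (L2 \<Omega>) (L2_norm \<Omega>) {0..} u a1"
    "has_weak_time_derivative (L2 \<Omega>) (L2_norm \<Omega>) {0..} a1 a2"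
    using c2 unfolding numeral_2_eq_2 vWinf_loc.simps by blast
  obtain ut utt where ut: "has_weak_time_derivative (L2 \<Omega>) (L2_norm \<Omega>) {0..} u ut"
    and utt: "has_weak_time_derivative (L2 \<Omega>) (L2_norm \<Omega>) {0..} ut utt"
    and utc: "continuous_into (L2 \<Omega>) (L2_norm \<Omega>) {0..} ut"
    and eq: "AE t in lebesgue_on {0..}. \<forall>w\<in>H10 \<Omega>.
           L2_inner \<Omega> (utt t) w + h t * L2_inner \<Omega> (ut t) w + G \<Omega> f (u t) w = 0"
    using sol unfolding solves_damped_wave_def by blast
  have utL: "ut t \<in> L2 \<Omega>" if "t \<ge> 0" for t using utc that unfolding continuous_into_def by auto
  have uLc: "continuous_into (L2 \<Omega>) (L2_norm \<Omega>) {0..} u"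
    unfolding continuous_into_def
  proof (intro ballI conjI)
    fix t :: real assume t: "t \<in> {0..}"
    then show "u t \<in> L2 \<Omega>" using uL by simp
    have l: "((\<lambda>s. H1_norm \<Omega> (\<lambda>x. u s x - u t x)) \<longlongrightarrow> 0) (at t within {0..})"
      using uc t unfolding continuous_into_def by blast
    show "((\<lambda>s. L2_norm \<Omega> (\<lambda>x. u s x - u t x)) \<longlongrightarrow> 0) (at t within {0..})"
    proof (rule Lim_null_comparison[OF _ l])
      show "eventually (\<lambda>s. norm (L2_norm \<Omega> (\<lambda>x. u s x - u t x)) \<le> H1_norm \<Omega> (\<lambda>x. u s x - u t x)) (at t within {0..})"
        unfolding eventually_at_filter
      proof (intro always_eventually allI impI)
        fix s :: real assume "s \<in> {0..}"
        then have "(\<lambda>x. u s x - u t x) \<in> H_k \<Omega> 1" using H1.diff_closed[OF uH uH] t by simp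
        from H1_norm_facts(2,6)[OF this] show "norm (L2_norm \<Omega> (\<lambda>x. u s x - u t x)) \<le> H1_norm \<Omega> (\<lambda>x. u s x - u t x)" by simp
      qed
    qed
  qed
  have sub: "{0<..} \<subseteq> {0::real..}" by auto
  have cu: "continuous_on {0<..} (\<lambda>t. L2_inner \<Omega> (u t) w)" if "w \<in> L2 \<Omega>" for w
    by (rule continuous_on_subset[OF L2.continuous_into_inner[OF uLc[folded Ln] that] sub])
  have cut: "continuous_on {0<..} (\<lambda>t. L2_inner \<Omega> (ut t) w)" if "w \<in> L2 \<Omega>" for w
    by (rule continuous_on_subset[OF L2.continuous_into_inner[OF utc[folded Ln] that] sub])
  have wu: "has_weak_partial {0<..} 1 (\<lambda>t. L2_inner \<Omega> (u t) w) (\<lambda>t. L2_inner \<Omega> (ut t) w)" if "w \<in> L2 \<Omega>" for w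
    by (rule L2.weak_time_derivative_inner[OF ut[folded Ln] that continuous_locally_integrable[OF cu[OF that]]])
  have wut: "has_weak_partial {0<..} 1 (\<lambda>t. L2_inner \<Omega> (ut t) w) (\<lambda>t. L2_inner \<Omega> (utt t) w)" if "w \<in> L2 \<Omega>" for w
    by (rule L2.weak_time_derivative_inner[OF utt[folded Ln] that continuous_locally_integrable[OF cut[OF that]]])
  \<comment> \<open>The derivative \<open>ut\<close> of the equation and the derivative
    \<open>a1\<close> of the regularity class are a priori different functions. After testing they
    agree almost everywhere, so the locally bounded \<open>a2\<close> is a derivative of
    \<open>ut\<close>, which makes \<open>ut\<close> Lipschitz.\<close>
  have wut2: "has_weak_partial {0<..} 1 (\<lambda>t. L2_inner \<Omega> (ut t) w) (\<lambda>t. L2_inner \<Omega> (a2 t) w)" if w: "w \<in> L2 \<Omega>" for w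
  proof -
    have 1: "has_weak_partial {0<..} 1 (\<lambda>t. L2_inner \<Omega> (u t) w) (\<lambda>t. L2_inner \<Omega> (a1 t) w)"
      by (rule L2.weak_time_derivative_inner[OF a(2)[folded Ln] w continuous_locally_integrable[OF cu[OF w]]])
    have li: "locally_integrable {0<..} (\<lambda>t. L2_inner \<Omega> (a1 t) w)" using 1 unfolding has_weak_partial_def by blast
    have 2: "has_weak_partial {0<..} 1 (\<lambda>t. L2_inner \<Omega> (a1 t) w) (\<lambda>t. L2_inner \<Omega> (a2 t) w)"
      by (rule L2.weak_time_derivative_inner[OF a(3)[folded Ln] w li])
    have li2: "locally_integrable {0<..} (\<lambda>t. L2_inner \<Omega> (a2 t) w)" using 2 unfolding has_weak_partial_def by blast
    show ?thesis
      by (rule has_weak_partial_cong_AE[OF open_greaterThan 2 continuous_locally_integrable[OF cut[OF w]] li2 _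
            has_weak_partial_unique[OF open_greaterThan 1 wu[OF w]]]) auto
  qed
  have wuX: "has_weak_partial {0<..} 1 (\<lambda>t. H1_inner \<Omega> (u t) w) (\<lambda>t. H1_inner \<Omega> (v1 t) w)" if "w \<in> H10 \<Omega>" for w
    by (rule X.weak_time_derivative_inner[OF v1(2)[folded Xn] that
          continuous_locally_integrable[OF continuous_on_subset[OF X.continuous_into_inner[OF uc[folded Xn] that] sub]]])
  define E where "E t = 1/2 * (L2_norm \<Omega> (ut t))\<^sup>2 + E0 \<Omega> f (u t)" for t
  have decr: "E R \<le> E 1" if R: "1 \<le> R" for R
  proof -
    \<comment> \<open>All constants from here on may depend on \<open>R\<close>; they disappear when
      the interval is subdivided.\<close>
    obtain L1 where L1: "L1 \<ge> 0" "AE t in lebesgue_on {1..R}. v1 t \<in> H10 \<Omega> \<and> H1_norm \<Omega> (v1 t) \<le> L1"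
      by (rule vLinf_loc_bound[OF v1(1), of 1 R]) auto
    obtain L2c where L2c: "L2c \<ge> 0" "AE t in lebesgue_on {1..R}. a2 t \<in> L2 \<Omega> \<and> L2_norm \<Omega> (a2 t) \<le> L2c"
      by (rule vLinf_loc_bound[OF a(1), of 1 R]) auto
    have LX: "H1_norm \<Omega> (\<lambda>x. u t x - u s x) \<le> L1 * (t - s)" if "1 \<le> s" "s \<le> t" "t \<le> R" for s t
    proof (rule X.Lipschitz_of_weak_derivative[OF uc[folded Xn] wuX, unfolded Xn, OF _ _ _ that(2) L1(1)])
      show "AE t in lebesgue_on {s..t}. v1 t \<in> H10 \<Omega> \<and> H1_norm \<Omega> (v1 t) \<le> L1"
        by (rule AE_lebesgue_on_subset[OF L1(2)]) (use that in auto)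
    qed (use that in auto)
    have LL: "L2_norm \<Omega> (\<lambda>x. ut t x - ut s x) \<le> L2c * (t - s)" if "1 \<le> s" "s \<le> t" "t \<le> R" for s t
    proof (rule L2.Lipschitz_of_weak_derivative[OF utc[folded Ln] wut2, unfolded Ln, OF _ _ _ that(2) L2c(1)])
      show "AE t in lebesgue_on {s..t}. a2 t \<in> L2 \<Omega> \<and> L2_norm \<Omega> (a2 t) \<le> L2c"
        by (rule AE_lebesgue_on_subset[OF L2c(2)]) (use that in auto)
    qed (use that in auto)
    define M where "M = H1_norm \<Omega> (u 1) + L1 * (R - 1) + 1"
    have M: "M > 0" unfolding M_def
      using H1_norm_facts(1)[OF uH[of 1]] L1(1) R by (intro add_nonneg_pos add_nonneg_nonneg mult_nonneg_nonneg) auto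
    have uM: "H1_norm \<Omega> (u t) \<le> M" if t: "1 \<le> t" "t \<le> R" for t
    proof -
      have "H1_norm \<Omega> (u t) \<le> H1_norm \<Omega> (u 1) + H1_norm \<Omega> (\<lambda>x. u t x - u 1 x)"
        using X.nrm_triangle_diff[OF uX uX, of t 1] t unfolding Xn by simp
      also have "H1_norm \<Omega> (\<lambda>x. u t x - u 1 x) \<le> L1 * (t - 1)" using LX[of 1 t] t by simp
      also have "L1 * (t - 1) \<le> L1 * (R - 1)" using L1(1) t by (intro mult_left_mono) auto
      finally show ?thesis unfolding M_def by simp
    qed
    define Mt where "Mt = L2_norm \<Omega> (ut 1) + L2c * (R - 1)"
    have utM: "L2_norm \<Omega> (ut t) \<le> Mt" if t: "1 \<le> t" "t \<le> R" for t
    proof -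
      have "L2_norm \<Omega> (ut t) \<le> L2_norm \<Omega> (ut 1) + L2_norm \<Omega> (\<lambda>x. ut t x - ut 1 x)"
        using L2.nrm_triangle_diff[OF utL utL, of t 1] t unfolding Ln by simp
      also have "L2_norm \<Omega> (\<lambda>x. ut t x - ut 1 x) \<le> L2c * (t - 1)" using LL[of 1 t] t by simp
      also have "L2c * (t - 1) \<le> L2c * (R - 1)" using L2c(1) t by (intro mult_left_mono) auto
      finally show ?thesis unfolding Mt_def by simp
    qed
    have Mt: "Mt \<ge> 0" using utM[of 1] R L2.nrm_nonneg[OF utL[of 1]] unfolding Ln by simp
    have "bounded (h ` {1..R})"
      by (intro compact_imp_bounded compact_continuous_image continuous_on_subset[OF hc]) auto
    then obtain H where H: "\<forall>t\<in>{1..R}. \<bar>h t\<bar> \<le> H" unfolding bounded_iff by auto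
    have H0: "H \<ge> 0" using bspec[OF H, of 1] R by simp
    obtain K where K: "K > 0"
      and K1: "\<And>a b w N. a \<in> H10 \<Omega> \<Longrightarrow> b \<in> H10 \<Omega> \<Longrightarrow> w \<in> H10 \<Omega> \<Longrightarrow> H1_norm \<Omega> a \<le> M \<Longrightarrow> H1_norm \<Omega> b \<le> M \<Longrightarrow>
        0 < N \<Longrightarrow> H1_norm \<Omega> (\<lambda>x. a x - b x) \<le> N \<Longrightarrow> \<bar>G \<Omega> f a w - G \<Omega> f b w\<bar> \<le> K * N * H1_norm \<Omega> w"
      and K2: "\<And>a b w N. a \<in> H10 \<Omega> \<Longrightarrow> b \<in> H10 \<Omega> \<Longrightarrow> w \<in> H10 \<Omega> \<Longrightarrow> H1_norm \<Omega> a \<le> M \<Longrightarrow> H1_norm \<Omega> b \<le> M \<Longrightarrow>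
        0 < N \<Longrightarrow> H1_norm \<Omega> (\<lambda>x. a x - b x) \<le> N \<Longrightarrow>
        \<bar>G \<Omega> f a w - G \<Omega> f b w - grad_inner \<Omega> (\<lambda>x. a x - b x) w\<bar> \<le> K * N * L2_norm \<Omega> w"
      and K3: "\<And>a b N. a \<in> H10 \<Omega> \<Longrightarrow> b \<in> H10 \<Omega> \<Longrightarrow> H1_norm \<Omega> a \<le> M \<Longrightarrow> H1_norm \<Omega> b \<le> M \<Longrightarrow>
        0 < N \<Longrightarrow> H1_norm \<Omega> (\<lambda>x. a x - b x) \<le> N \<Longrightarrow>
        \<bar>E0 \<Omega> f b - E0 \<Omega> f a - G \<Omega> f a (\<lambda>x. b x - a x)\<bar> \<le> K * N\<^sup>2"
      using G_diff_bound[OF M] by blast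
    \<comment> \<open>First-order expansion of \<open>u\<close> in L2 with quadratic error, by
      testing the remainder with itself and using that \<open>ut\<close> is Lipschitz.\<close>
    have der: "L2_norm \<Omega> (\<lambda>x. (u t' x - u t x) - (t' - t) * ut \<tau> x) \<le> L2c * (t' - t) * (t' - t)"
      if t: "1 \<le> t" "t \<le> \<tau>" "\<tau> \<le> t'" "t' \<le> R" for t \<tau> t'
    proof -
      have mem: "(\<lambda>x. u t' x - u t x) \<in> L2 \<Omega>" "(\<lambda>x. (t' - t) * ut \<tau> x) \<in> L2 \<Omega>"
        using t by (auto intro!: L2.diff_closed L2_scale uL utL)
      define z where "z = (\<lambda>x. (u t' x - u t x) - (t' - t) * ut \<tau> x)"
      have z: "z \<in> L2 \<Omega>" unfolding z_def by (rule L2.diff_closed[OF mem])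
      have "AE s in lebesgue_on {t..t'}. \<bar>L2_inner \<Omega> (ut s) z - L2_inner \<Omega> (ut \<tau>) z\<bar> \<le> L2c * (t' - t) * L2_norm \<Omega> z"
      proof (rule AE_I2)
        fix s assume "s \<in> space (lebesgue_on {t..t'})"
        then have s: "t \<le> s" "s \<le> t'" by auto
        have d: "L2_norm \<Omega> (\<lambda>x. ut s x - ut \<tau> x) \<le> L2c * (t' - t)"
        proof (cases "\<tau> \<le> s")
          case True
          have "L2_norm \<Omega> (\<lambda>x. ut s x - ut \<tau> x) \<le> L2c * (s - \<tau>)" using True s t by (intro LL) auto
          also have "\<dots> \<le> L2c * (t' - t)" using L2c(1) s t by (intro mult_left_mono) auto
          finally show ?thesis .
        next
          case False
          have "L2_norm \<Omega> (\<lambda>x. ut s x - ut \<tau> x) = L2_norm \<Omega> (\<lambda>x. ut \<tau> x - ut s x)"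
            using L2.nrm_minus_commute[OF utL utL, of s \<tau>] s t unfolding Ln by simp
          also have "\<dots> \<le> L2c * (\<tau> - s)" using False s t by (intro LL) auto
          also have "\<dots> \<le> L2c * (t' - t)" using L2c(1) s t by (intro mult_left_mono) auto
          finally show ?thesis .
        qed
        have "\<bar>L2_inner \<Omega> (ut s) z - L2_inner \<Omega> (ut \<tau>) z\<bar> \<le> L2_norm \<Omega> (\<lambda>x. ut s x - ut \<tau> x) * L2_norm \<Omega> z"
          using L2.inner_diff_bound[OF utL utL z, of s \<tau>] s t unfolding Ln by simp
        also have "\<dots> \<le> L2c * (t' - t) * L2_norm \<Omega> z"
          using d L2.nrm_nonneg[OF z] unfolding Ln by (intro mult_right_mono) auto
        finally show "\<bar>L2_inner \<Omega> (ut s) z - L2_inner \<Omega> (ut \<tau>) z\<bar> \<le> L2c * (t' - t) * L2_norm \<Omega> z" .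
      qed
      moreover have "t \<le> t'" "{t..t'} \<subseteq> {0<..}" using t by (auto simp: subset_eq)
      ultimately have "\<bar>L2_inner \<Omega> (u t') z - L2_inner \<Omega> (u t) z - L2_inner \<Omega> (ut \<tau>) z * (t' - t)\<bar>
          \<le> L2c * (t' - t) * L2_norm \<Omega> z * (t' - t)"
        by (intro weak_partial_increment_approx[OF open_greaterThan wu[OF z] cu[OF z]])
      moreover have "L2_inner \<Omega> (u t') z - L2_inner \<Omega> (u t) z - L2_inner \<Omega> (ut \<tau>) z * (t' - t) = L2_inner \<Omega> z z"
        using L2.B_diff[OF mem z] L2.B_diff[OF uL uL z, of t' t] L2.B_scale[OF utL z, of \<tau> "t' - t"] t
        unfolding z_def[symmetric] by simp
      moreover have "L2_inner \<Omega> z z = L2_norm \<Omega> z * L2_norm \<Omega> z"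
        using L2.nrm_sq[OF z] unfolding Ln by (simp add: power2_eq_square)
      ultimately have le: "L2_norm \<Omega> z * L2_norm \<Omega> z \<le> L2_norm \<Omega> z * (L2c * (t' - t) * (t' - t))"
        by (simp add: mult_ac)
      show ?thesis
      proof (cases "L2_norm \<Omega> z = 0")
        case True
        then show ?thesis unfolding z_def[symmetric] using L2c(1) t by simp
      next
        case False
        then have "L2_norm \<Omega> z > 0" using L2.nrm_nonneg[OF z] unfolding Ln by simp
        with le show ?thesis unfolding z_def[symmetric] by (rule mult_left_le_imp_le)
      qed
    qed
    \<comment> \<open>Three sources of error: the Taylor remainder of \<open>E0\<close> together
      with freezing \<open>G\<close> at time \<open>t\<close>, the damping, and the exchange of
      increments of \<open>u\<close> for multiples of \<open>ut\<close>.\<close>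
    define c where "c = 2 * K * (L1 + 1)\<^sup>2 + H * Mt * L2c + L2c\<^sup>2"
    show ?thesis
    proof (rule quadratic_increments_imp_le[OF _ R, of E c])
      fix t t' assume t: "1 \<le> t" "t < t'" "t' \<le> R"
      define \<delta> where "\<delta> = t' - t"
      have \<delta>: "\<delta> > 0" using t by (simp add: \<delta>_def)
      define w where "w = (\<lambda>x. u t' x - u t x)"
      have w: "w \<in> H10 \<Omega>" unfolding w_def using t by (intro X.diff_closed uX) auto
      have wL: "w \<in> L2 \<Omega>" by (rule H10_D(2)[OF w])
      \<comment> \<open>The extra 1 keeps \<open>N\<close> positive even if the Lipschitz constant
        is 0.\<close>
      define N where "N = (L1 + 1) * \<delta>"
      have N: "N > 0" unfolding N_def using L1(1) \<delta> by simp
      have LN: "H1_norm \<Omega> (\<lambda>x. u \<tau> x - u t x) \<le> N" if "t \<le> \<tau>" "\<tau> \<le> t'" for \<tau>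
      proof -
        have "H1_norm \<Omega> (\<lambda>x. u \<tau> x - u t x) \<le> L1 * (\<tau> - t)" using that t by (intro LX) auto
        also have "\<dots> \<le> N" unfolding N_def \<delta>_def using that L1(1) by (intro mult_mono) auto
        finally show ?thesis .
      qed
      have wN: "H1_norm \<Omega> w \<le> N" unfolding w_def using LN[of t'] t by simp
      have EG: "E0 \<Omega> f (u t') - E0 \<Omega> f (u t) - K * N\<^sup>2 \<le> G \<Omega> f (u t) w"
      proof -
        have "H1_norm \<Omega> (\<lambda>x. u t x - u t' x) \<le> N"
          using X.nrm_minus_commute[OF uX uX, of t t'] LN[of t'] t unfolding Xn by simp
        from K3[OF uX uX uM uM N this] t show ?thesis unfolding w_def by (simp add: abs_le_iff)
      qed
      \<comment> \<open>An upper bound for the derivative of \<tau> \<mapsto>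
        \<open>L2_inner \<Omega> (ut \<tau>) w\<close> on [t,t']. Its leading term is minus the
        increment of \<open>E0\<close>, which cancels in the total energy.\<close>
      define B where "B = - (E0 \<Omega> f (u t') - E0 \<Omega> f (u t)) + 2 * K * N\<^sup>2 + H * Mt * L2c * \<delta>\<^sup>2"
      have rho: "L2_norm \<Omega> (\<lambda>x. w x - \<delta> * ut \<tau> x) \<le> L2c * \<delta>\<^sup>2" if "t \<le> \<tau>" "\<tau> \<le> t'" for \<tau>
        using der[of t \<tau> t'] that t unfolding w_def \<delta>_def by (simp add: power2_eq_square mult.assoc)
      have "AE \<tau> in lebesgue_on {t..t'}. L2_inner \<Omega> (utt \<tau>) w \<le> B"
      proof (rule eventually_mono[OF eventually_conj[OF _ AE_space]])
        show "AE \<tau> in lebesgue_on {t..t'}. \<forall>w\<in>H10 \<Omega>.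
           L2_inner \<Omega> (utt \<tau>) w + h \<tau> * L2_inner \<Omega> (ut \<tau>) w + G \<Omega> f (u \<tau>) w = 0"
          by (rule AE_lebesgue_on_subset[OF eq]) (use t in auto)
        fix \<tau> assume as: "(\<forall>w\<in>H10 \<Omega>. L2_inner \<Omega> (utt \<tau>) w + h \<tau> * L2_inner \<Omega> (ut \<tau>) w + G \<Omega> f (u \<tau>) w = 0)
          \<and> \<tau> \<in> space (lebesgue_on {t..t'})"
        then have \<tau>: "t \<le> \<tau>" "\<tau> \<le> t'" by auto
        have e: "L2_inner \<Omega> (utt \<tau>) w = - (h \<tau> * L2_inner \<Omega> (ut \<tau>) w) - G \<Omega> f (u \<tau>) w"
          using bspec[OF conjunct1[OF as] w] by simp
        have "\<bar>G \<Omega> f (u \<tau>) w - G \<Omega> f (u t) w\<bar> \<le> K * N * H1_norm \<Omega> w"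
          using t \<tau> by (intro K1 uX uM w N LN) auto
        also have "\<dots> \<le> K * N * N" using K N wN by (intro mult_left_mono) auto
        finally have g: "- G \<Omega> f (u \<tau>) w \<le> - (E0 \<Omega> f (u t') - E0 \<Omega> f (u t)) + 2 * K * N\<^sup>2"
          using EG by (simp add: abs_le_iff power2_eq_square)
        have utl: "ut \<tau> \<in> L2 \<Omega>" using \<tau> t by (intro utL) auto
        have scl: "(\<lambda>x. \<delta> * ut \<tau> x) \<in> L2 \<Omega>" by (rule L2_scale[OF utl])
        \<comment> \<open>The damping term has a sign up to a quadratic error, since
          \<open>w\<close> is nearly \<delta> times \<open>ut \<tau>\<close>.\<close>
        have "L2_inner \<Omega> (ut \<tau>) w = \<delta> * L2_inner \<Omega> (ut \<tau>) (ut \<tau>) + L2_inner \<Omega> (ut \<tau>) (\<lambda>x. w x - \<delta> * ut \<tau> x)"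
          using L2.B_diff2[OF wL scl utl] L2.B_scale2[OF utl utl, of \<delta>] by simp
        moreover have "\<bar>L2_inner \<Omega> (ut \<tau>) (\<lambda>x. w x - \<delta> * ut \<tau> x)\<bar> \<le> L2_norm \<Omega> (ut \<tau>) * L2_norm \<Omega> (\<lambda>x. w x - \<delta> * ut \<tau> x)"
          using L2.Cauchy_Schwarz[OF utl L2.diff_closed[OF wL scl]] unfolding Ln .
        moreover have "L2_norm \<Omega> (ut \<tau>) * L2_norm \<Omega> (\<lambda>x. w x - \<delta> * ut \<tau> x) \<le> Mt * (L2c * \<delta>\<^sup>2)"
          using utM[of \<tau>] rho[OF \<tau>] \<tau> t Mt L2.nrm_nonneg[OF L2.diff_closed[OF wL scl]] unfolding Ln by (intro mult_mono) auto
        moreover have "\<delta> * L2_inner \<Omega> (ut \<tau>) (ut \<tau>) \<ge> 0" using \<delta> L2.B_nonneg[OF utl] by simp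
        ultimately have low: "L2_inner \<Omega> (ut \<tau>) w \<ge> - (Mt * (L2c * \<delta>\<^sup>2))" by linarith
        have hb: "0 \<le> h \<tau>" "h \<tau> \<le> H" using h0[of \<tau>] bspec[OF H, of \<tau>] \<tau> t by auto
        have "- (h \<tau> * L2_inner \<Omega> (ut \<tau>) w) \<le> h \<tau> * (Mt * (L2c * \<delta>\<^sup>2))"
          using mult_left_mono[OF low hb(1)] by simp
        also have "\<dots> \<le> H * (Mt * (L2c * \<delta>\<^sup>2))" using hb(2) Mt L2c(1) by (intro mult_right_mono) auto
        finally show "L2_inner \<Omega> (utt \<tau>) w \<le> B" using e g unfolding B_def by (simp add: mult.assoc)
      qed
      moreover have "t \<le> t'" "{t..t'} \<subseteq> {0<..}" using t by (auto simp: subset_eq)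
      ultimately have inc: "L2_inner \<Omega> (ut t') w - L2_inner \<Omega> (ut t) w \<le> B * \<delta>"
        unfolding \<delta>_def by (intro weak_partial_increment_le[OF open_greaterThan wut[OF wL] cut[OF wL]])
      have m1: "ut t \<in> L2 \<Omega>" "ut t' \<in> L2 \<Omega>" using t by (auto intro: utL)
      define z where "z = (\<lambda>x. ut t' x - ut t x)"
      have z: "z \<in> L2 \<Omega>" unfolding z_def by (rule L2.diff_closed[OF m1(2,1)])
      have zL: "L2_norm \<Omega> z \<le> L2c * \<delta>" unfolding z_def \<delta>_def using t by (intro LL) auto
      have close: "\<delta> * L2_inner \<Omega> z (ut \<tau>) \<le> L2_inner \<Omega> z w + L2c\<^sup>2 * \<delta>\<^sup>2 * \<delta>" if \<tau>: "t \<le> \<tau>" "\<tau> \<le> t'" for \<tau>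
      proof -
        have utl: "ut \<tau> \<in> L2 \<Omega>" using \<tau> t by (intro utL) auto
        have scl: "(\<lambda>x. \<delta> * ut \<tau> x) \<in> L2 \<Omega>" by (rule L2_scale[OF utl])
        have "\<bar>L2_inner \<Omega> z (\<lambda>x. w x - \<delta> * ut \<tau> x)\<bar> \<le> L2_norm \<Omega> z * L2_norm \<Omega> (\<lambda>x. w x - \<delta> * ut \<tau> x)"
          using L2.Cauchy_Schwarz[OF z L2.diff_closed[OF wL scl]] unfolding Ln .
        also have "\<dots> \<le> (L2c * \<delta>) * (L2c * \<delta>\<^sup>2)"
          using zL rho[OF \<tau>] L2c(1) \<delta> L2.nrm_nonneg[OF L2.diff_closed[OF wL scl]] unfolding Ln by (intro mult_mono) auto
        also have "\<dots> = L2c\<^sup>2 * \<delta>\<^sup>2 * \<delta>" by (simp add: power2_eq_square)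
        finally have "\<bar>L2_inner \<Omega> z (\<lambda>x. w x - \<delta> * ut \<tau> x)\<bar> \<le> L2c\<^sup>2 * \<delta>\<^sup>2 * \<delta>" .
        moreover have "L2_inner \<Omega> z (\<lambda>x. w x - \<delta> * ut \<tau> x) = L2_inner \<Omega> z w - \<delta> * L2_inner \<Omega> z (ut \<tau>)"
          using L2.B_diff2[OF wL scl z] L2.B_scale2[OF utl z, of \<delta>] by simp
        ultimately show ?thesis by (simp add: abs_le_iff)
      qed
      have zw: "L2_inner \<Omega> z w \<le> B * \<delta>" using inc L2.B_diff[OF m1(2,1) wL] unfolding z_def by simp
      \<comment> \<open>A difference of squares as product of difference and sum. In the sum each
        \<delta> \<open>ut\<close> is exchanged for \<open>w\<close> by \<open>close\<close>, and
        \<open>inc\<close> bounds the result.\<close>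
      have "(L2_norm \<Omega> (ut t'))\<^sup>2 - (L2_norm \<Omega> (ut t))\<^sup>2 = L2_inner \<Omega> z (ut t) + L2_inner \<Omega> z (ut t')"
        using L2.nrm_sq[OF m1(1)] L2.nrm_sq[OF m1(2)] L2.B_diff[OF m1(2,1) m1(1)] L2.B_diff[OF m1(2,1) m1(2)]
          L2.B_sym[of \<Omega> "ut t" "ut t'"] unfolding Ln z_def by simp
      then have "\<delta> * ((L2_norm \<Omega> (ut t'))\<^sup>2 - (L2_norm \<Omega> (ut t))\<^sup>2) \<le> \<delta> * (2 * (B + L2c\<^sup>2 * \<delta>\<^sup>2))"
        using close[of t] close[of t'] zw t by (simp add: distrib_left algebra_simps)
      then have "(L2_norm \<Omega> (ut t'))\<^sup>2 - (L2_norm \<Omega> (ut t))\<^sup>2 \<le> 2 * (B + L2c\<^sup>2 * \<delta>\<^sup>2)"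
        using \<delta> by (simp only: mult_le_cancel_left_pos)
      moreover have "c * \<delta>\<^sup>2 = 2 * K * N\<^sup>2 + H * Mt * L2c * \<delta>\<^sup>2 + L2c\<^sup>2 * \<delta>\<^sup>2"
      proof -
        have "N\<^sup>2 = (L1 + 1)\<^sup>2 * \<delta>\<^sup>2" by (simp only: N_def power_mult_distrib)
        then show ?thesis unfolding c_def by (simp add: distrib_right mult.assoc)
      qed
      ultimately show "E t' - E t \<le> c * (t' - t)\<^sup>2"
        unfolding E_def B_def \<delta>_def[symmetric] by (simp add: algebra_simps)
    qed
  qed
  show ?thesis
  proof (rule that[of "E 1"])
    fix t :: real assume "1 \<le> t"
    have "E0 \<Omega> f (u t) \<le> E t" unfolding E_def by simp
    also have "\<dots> \<le> E 1" by (rule decr[OF \<open>1 \<le> t\<close>])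
    finally show "E0 \<Omega> f (u t) \<le> E 1" .
  qed
qed

section \<open>Coercivity, and the two cases of the inequality\<close>

lemma E0_lower_bound:
  assumes k: "k \<ge> 0" "\<And>s. antideriv f s \<ge> - k * (1 + s\<^sup>2)" and v: "v \<in> H10 \<Omega>"
  shows "E0 \<Omega> f v \<ge> 1/2 * grad_inner \<Omega> v v - k * ((LINT x|lebesgue_on \<Omega>. 1) + (L2_norm \<Omega> v)\<^sup>2)"
proof -
  have i: "integrable (lebesgue_on \<Omega>) (\<lambda>x. - k * (1 + (v x)\<^sup>2))"
    by (intro integrable_mult_right Bochner_Integration.integrable_add integrable_const_\<Omega> L2_D(2) H10_D(2) v)
  have "(LINT x|lebesgue_on \<Omega>. - k * (1 + (v x)\<^sup>2)) \<le> (LINT x|lebesgue_on \<Omega>. antideriv f (v x))"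
    by (intro integral_mono i f_comp_L2(2)[OF v] k(2))
  moreover have "(LINT x|lebesgue_on \<Omega>. - k * (1 + (v x)\<^sup>2)) = - k * ((LINT x|lebesgue_on \<Omega>. 1) + (L2_norm \<Omega> v)\<^sup>2)"
    using L2_D(2)[OF H10_D(2)[OF v]] integrable_const_\<Omega> by (simp add: L2_norm_sq)
  ultimately show ?thesis unfolding E0_def by linarith
qed

end

text \<open>At every order the Slobodeckij expression contains the squared L2 norm as a summand. A
  finite norm guarantees a finite expression, so the comparison may be made among reals.\<close>

lemma Hs_norm_less_imp_L2_norm_less:
  assumes "Hs_norm \<Omega> s f < ennreal \<beta>" "f \<in> L2 \<Omega>" "\<beta> > 0"
  shows "L2_norm \<Omega> f < \<beta>"
proof -
  define k where "k = nat \<lfloor>s\<rfloor>"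
  define N where "N = slobodeckij_sq \<Omega> k (s - real k) f"
  have fin: "N < \<infinity>" and lt: "ennreal (sqrt (enn2real N)) < ennreal \<beta>"
    using assms(1) unfolding Hs_norm_def Let_def k_def[symmetric] N_def[symmetric] by (auto split: if_splits)
  have "(\<integral>\<^sup>+x. ennreal ((f x)\<^sup>2) \<partial>lebesgue_on \<Omega>) \<le> N"
    unfolding N_def by (cases k) simp_all
  moreover have "(\<integral>\<^sup>+x. ennreal ((f x)\<^sup>2) \<partial>lebesgue_on \<Omega>) = ennreal ((L2_norm \<Omega> f)\<^sup>2)"
    unfolding L2_norm_sq by (rule nn_integral_eq_integral[OF L2_D(2)[OF assms(2)]]) simp
  ultimately have "ennreal ((L2_norm \<Omega> f)\<^sup>2) \<le> N" by simp
  then have "(L2_norm \<Omega> f)\<^sup>2 \<le> enn2real N"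
    using fin enn2real_mono[of "ennreal ((L2_norm \<Omega> f)\<^sup>2)" N] by simp
  then have "L2_norm \<Omega> f \<le> sqrt (enn2real N)" by (rule real_le_rsqrt)
  also have "\<dots> < \<beta>" using lt assms(3) by (simp add: ennreal_less_iff)
  finally show ?thesis .
qed

theorem lemma3:
  fixes \<Omega> :: "'a::euclidean_space set"
    and f h :: "real \<Rightarrow> real"
    and p \<theta>\<^sub>0 q :: real
    and u\<^sub>0 u\<^sub>1 \<psi> :: "'a \<Rightarrow> real"
    and u :: "real \<Rightarrow> 'a \<Rightarrow> real"
  assumes "smooth_bounded_domain \<Omega>"
    and "nonlinearity_condition \<Omega> p f"
    and "lojasiewicz_condition \<Omega> f \<theta>\<^sub>0"
    and "damping_condition \<theta>\<^sub>0 h"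
    and "u\<^sub>0 \<in> H_k \<Omega> 2 \<inter> H10 \<Omega>"
    and "u\<^sub>1 \<in> H10 \<Omega>"
    and "u \<in> solution_class \<Omega>"
    and "solves_damped_wave \<Omega> f h u\<^sub>0 u\<^sub>1 u"
    and "\<psi> \<in> equilibria \<Omega> f"
    and "q = (2 - p) / (2 * (1 + p))"
  shows "\<exists>c>0. \<exists>T>0. \<exists>\<theta>. \<exists>\<beta>>0. 0 < \<theta> \<and> \<theta> \<le> 1/2 \<and>
    (\<forall>t\<ge>T. Hs_norm \<Omega> (1 - q) (\<lambda>x. u t x - \<psi> x) < ennreal \<beta> \<longrightarrow>
       Hm1_norm \<Omega> (G \<Omega> f (u t)) \<ge> c * \<bar>E0 \<Omega> f (u t) - E0 \<Omega> f \<psi>\<bar> powr (1 - \<theta>))"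
proof -
  have \<Omega>: "open \<Omega>" "bounded \<Omega>" using assms(1) unfolding smooth_bounded_domain_def by auto
  have fc: "continuous_on UNIV f" and p: "p \<ge> 0" "(real DIM('a) - 2) * p < 2"
    using assms(2) unfolding nonlinearity_condition_def W1inf_loc_def by auto
  obtain C f' where C: "C > 0" "has_weak_partial UNIV 1 f f'" "AE s in lebesgue. \<bar>f' s\<bar> \<le> C * (1 + rpow \<bar>s\<bar> p)"
    using assms(2) unfolding nonlinearity_condition_def by blast
  obtain \<mu> where \<mu>: "Liminf at_infinity (\<lambda>s. ereal (f s / s)) \<ge> ereal (- \<mu>)"
    using assms(2) unfolding nonlinearity_condition_def by blast
  interpret subcritical_nonlinearity \<Omega> f p "2 * C"
    by standard (use \<Omega> p fc C weak_derivative_growth[OF fc C(2) C(1) p(1) C(3)] in auto)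
  have hc: "continuous_on {0..} h" and h0: "\<And>t. 0 \<le> t \<Longrightarrow> 0 \<le> h t"
    using assms(4) unfolding damping_condition_def W1inf_loc_def by auto
  obtain Emax where Emax: "\<And>t. 1 \<le> t \<Longrightarrow> E0 \<Omega> f (u t) \<le> Emax"
    using energy_bound[OF assms(7,8) hc h0] by blast
  obtain k where k: "k \<ge> 0" "\<And>s. antideriv f s \<ge> - k * (1 + s\<^sup>2)"
    using antideriv_lower_bound[OF fc \<mu>] by blast
  have uX: "u t \<in> H10 \<Omega>" if "t \<ge> 0" for t
    using assms(8) that unfolding solves_damped_wave_def by blast
  have \<psi>X: "\<psi> \<in> H10 \<Omega>" using assms(9) unfolding equilibria_def by blast
  have \<theta>0: "0 < \<theta>\<^sub>0" "\<theta>\<^sub>0 \<le> 1/2" using assms(3) unfolding lojasiewicz_condition_def by auto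
  obtain c0 \<sigma> where c0: "c0 > 0" and \<sigma>: "\<sigma> > 0"
    and loj: "\<And>v. v \<in> H10 \<Omega> \<Longrightarrow> H1_norm \<Omega> (\<lambda>x. v x - \<psi> x) \<le> \<sigma> \<Longrightarrow>
        Hm1_norm \<Omega> (G \<Omega> f v) \<ge> c0 * \<bar>E0 \<Omega> f v - E0 \<Omega> f \<psi>\<bar> powr (1 - \<theta>\<^sub>0)"
    using assms(3,9) unfolding lojasiewicz_condition_def by blast
  \<comment> \<open>Bounds the L2 norm of u(t), because \<beta> will be at most 1.\<close>
  define m where "m = L2_norm \<Omega> \<psi> + 1"
  have \<psi>n: "0 \<le> H1_norm \<Omega> \<psi>" "0 \<le> L2_norm \<Omega> \<psi>" using H1_norm_facts(1,6)[OF H10_D(1)[OF \<psi>X]] by auto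
  have m: "m > 0" using \<psi>n by (simp add: m_def)
  define vol where "vol = (LINT x|lebesgue_on \<Omega>. 1::real)"
  have vol: "vol \<ge> 0" unfolding vol_def by (intro Bochner_Integration.integral_nonneg) auto
  define A where "A = k * (vol + m\<^sup>2)"
  have A: "A \<ge> 0" unfolding A_def using k(1) vol by simp
  \<comment> \<open>The square root bounds the H1 norm of u(t), by the energy bound and coercivity;
    the summand for \<psi> places both functions in one ball.\<close>
  define M where "M = sqrt (m\<^sup>2 + 2 * (\<bar>Emax\<bar> + A)) + H1_norm \<Omega> \<psi> + 1"
  have M: "M > 0" unfolding M_def using \<psi>n A by (intro add_nonneg_pos add_nonneg_nonneg) auto
  obtain K where K: "K > 0"
      and K1: "\<And>a b w N. a \<in> H10 \<Omega> \<Longrightarrow> b \<in> H10 \<Omega> \<Longrightarrow> w \<in> H10 \<Omega> \<Longrightarrow> H1_norm \<Omega> a \<le> M \<Longrightarrow> H1_norm \<Omega> b \<le> M \<Longrightarrow>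
        0 < N \<Longrightarrow> H1_norm \<Omega> (\<lambda>x. a x - b x) \<le> N \<Longrightarrow> \<bar>G \<Omega> f a w - G \<Omega> f b w\<bar> \<le> K * N * H1_norm \<Omega> w"
      and Kb: "\<And>a b w N. a \<in> H10 \<Omega> \<Longrightarrow> b \<in> H10 \<Omega> \<Longrightarrow> w \<in> H10 \<Omega> \<Longrightarrow> H1_norm \<Omega> a \<le> M \<Longrightarrow> H1_norm \<Omega> b \<le> M \<Longrightarrow>
        0 < N \<Longrightarrow> H1_norm \<Omega> (\<lambda>x. a x - b x) \<le> N \<Longrightarrow>
        \<bar>G \<Omega> f a w - G \<Omega> f b w - grad_inner \<Omega> (\<lambda>x. a x - b x) w\<bar> \<le> K * N * L2_norm \<Omega> w"
      and K3: "\<And>a b N. a \<in> H10 \<Omega> \<Longrightarrow> b \<in> H10 \<Omega> \<Longrightarrow> H1_norm \<Omega> a \<le> M \<Longrightarrow> H1_norm \<Omega> b \<le> M \<Longrightarrow>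
        0 < N \<Longrightarrow> H1_norm \<Omega> (\<lambda>x. a x - b x) \<le> N \<Longrightarrow>
        \<bar>E0 \<Omega> f b - E0 \<Omega> f a - G \<Omega> f a (\<lambda>x. b x - a x)\<bar> \<le> K * N\<^sup>2"
    using G_diff_bound[OF M] by blast
  \<comment> \<open>Chosen so that the lower-order loss (K + 1)\<beta> consumes at most half of
    \<sigma>.\<close>
  define \<beta> where "\<beta> = min 1 (\<sigma> / (2 * (K + 1)))"
  have \<beta>: "\<beta> > 0" "\<beta> \<le> 1" "(K + 1) * \<beta> \<le> \<sigma> / 2"
  proof -
    show "\<beta> > 0" "\<beta> \<le> 1" unfolding \<beta>_def using \<sigma> K by auto
    have "(K + 1) * \<beta> \<le> (K + 1) * (\<sigma> / (2 * (K + 1)))" unfolding \<beta>_def using K by (intro mult_left_mono) auto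
    also have "\<dots> = \<sigma> / 2" using K by (simp add: field_simps)
    finally show "(K + 1) * \<beta> \<le> \<sigma> / 2" .
  qed
  define D where "D = \<bar>Emax\<bar> + A + \<bar>E0 \<Omega> f \<psi>\<bar> + 1"
  have D: "D > 0" unfolding D_def using A by (intro add_nonneg_pos add_nonneg_nonneg) auto
  \<comment> \<open>The second entry serves the case away from \<psi>: the energy difference is at
    most \<open>D\<close> there and the dual norm at least \<sigma>/2.\<close>
  define c where "c = min c0 (\<sigma> / 2 / D powr (1 - \<theta>\<^sub>0))"
  have c: "c > 0" unfolding c_def using c0 \<sigma> D by simp
  have main: "Hm1_norm \<Omega> (G \<Omega> f (u t)) \<ge> c * \<bar>E0 \<Omega> f (u t) - E0 \<Omega> f \<psi>\<bar> powr (1 - \<theta>\<^sub>0)"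
    if t: "1 \<le> t" and near: "Hs_norm \<Omega> (1 - q) (\<lambda>x. u t x - \<psi> x) < ennreal \<beta>" for t
  proof -
    have ut: "u t \<in> H10 \<Omega>" using t by (intro uX) simp
    define w where "w = (\<lambda>x. u t x - \<psi> x)"
    have w: "w \<in> H10 \<Omega>" unfolding w_def by (rule H10_diff[OF \<Omega>(1) ut \<psi>X])
    note wH = H10_D(1)[OF w]
    have wL: "L2_norm \<Omega> w < \<beta>"
      using Hs_norm_less_imp_L2_norm_less[OF near[folded w_def] H10_D(2)[OF w] \<beta>(1)] .
    let ?N = "H1_norm \<Omega> w"
    show ?thesis
    proof (cases "?N \<le> \<sigma>")
      case True
      have "c * \<bar>E0 \<Omega> f (u t) - E0 \<Omega> f \<psi>\<bar> powr (1 - \<theta>\<^sub>0) \<le> c0 * \<bar>E0 \<Omega> f (u t) - E0 \<Omega> f \<psi>\<bar> powr (1 - \<theta>\<^sub>0)"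
        unfolding c_def by (intro mult_right_mono) auto
      then show ?thesis using loj[OF ut] True unfolding w_def by linarith
    next
      case False
      then have N: "?N > \<sigma>" "?N > 0" using \<sigma> by auto
      have "L2_norm \<Omega> (u t) \<le> L2_norm \<Omega> \<psi> + L2_norm \<Omega> w"
        using L2.nrm_triangle_diff[OF H10_D(2)[OF ut] H10_D(2)[OF \<psi>X]] unfolding L2_nrm w_def .
      then have um: "L2_norm \<Omega> (u t) \<le> m" using wL \<beta>(2) unfolding m_def by linarith
      then have um2: "(L2_norm \<Omega> (u t))\<^sup>2 \<le> m\<^sup>2" using H1_norm_facts(6)[OF H10_D(1)[OF ut]] by (rule power_mono)
      then have "k * (vol + (L2_norm \<Omega> (u t))\<^sup>2) \<le> A" unfolding A_def using k(1) by (intro mult_left_mono) auto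
      then have low: "E0 \<Omega> f (u t) \<ge> 1/2 * grad_inner \<Omega> (u t) (u t) - A"
        using E0_lower_bound[OF k ut] unfolding vol_def by linarith
      have g0: "grad_inner \<Omega> (u t) (u t) \<ge> 0" by (rule H1_norm_facts(4)[OF H10_D(1)[OF ut]])
      have "grad_inner \<Omega> (u t) (u t) \<le> 2 * (\<bar>Emax\<bar> + A)"
        using low Emax[OF t] abs_ge_self[of Emax] by (simp add: field_simps)
      moreover have "L2_inner \<Omega> (u t) (u t) \<le> m\<^sup>2"
        using um2 L2.nrm_sq[OF H10_D(2)[OF ut]] unfolding L2_nrm by simp
      ultimately have "(H1_norm \<Omega> (u t))\<^sup>2 \<le> m\<^sup>2 + 2 * (\<bar>Emax\<bar> + A)"
        unfolding H1_norm_facts(3)[OF H10_D(1)[OF ut]] by (simp add: add_mono)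
      then have "H1_norm \<Omega> (u t) \<le> sqrt (m\<^sup>2 + 2 * (\<bar>Emax\<bar> + A))" by (rule real_le_rsqrt)
      then have uM: "H1_norm \<Omega> (u t) \<le> M" unfolding M_def using \<psi>n by simp
      have \<psi>M: "H1_norm \<Omega> \<psi> \<le> M" unfolding M_def using A by simp
      have "\<bar>G \<Omega> f (u t) w - G \<Omega> f \<psi> w - grad_inner \<Omega> w w\<bar> \<le> K * ?N * L2_norm \<Omega> w"
        using Kb[OF ut \<psi>X w uM \<psi>M N(2)] unfolding w_def by simp
      moreover have "K * ?N * L2_norm \<Omega> w \<le> K * ?N * \<beta>" using K N(2) wL by (intro mult_left_mono) auto
      \<comment> \<open>The gradient term is the squared H1 norm minus the squared L2 norm. One L2
        factor is below \<beta>, the other is left as the H1 norm so that it can be divided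
        out.\<close>
      moreover have "grad_inner \<Omega> w w \<ge> ?N * ?N - \<beta> * ?N"
      proof -
        have "L2_inner \<Omega> w w = L2_norm \<Omega> w * L2_norm \<Omega> w"
          using L2.nrm_sq[OF H10_D(2)[OF w]] unfolding L2_nrm by (simp add: power2_eq_square)
        also have "\<dots> \<le> \<beta> * ?N" using wL H1_norm_facts(2,6)[OF wH] \<beta>(1) by (intro mult_mono) auto
        finally show ?thesis using H1_norm_facts(3)[OF wH] by (simp add: power2_eq_square)
      qed
      ultimately have "G \<Omega> f (u t) w \<ge> ?N * ?N - \<beta> * ?N - K * ?N * \<beta>"
        using equilibrium_G_eq_0[OF assms(9) w] by (simp add: abs_le_iff)
      then have "(?N - (K + 1) * \<beta>) * ?N \<le> \<bar>G \<Omega> f (u t) w\<bar>" by (simp add: algebra_simps)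
      then have "?N - (K + 1) * \<beta> \<le> \<bar>G \<Omega> f (u t) w\<bar> / ?N" using N(2) by (simp add: pos_le_divide_eq)
      then have big: "\<sigma> / 2 \<le> Hm1_norm \<Omega> (G \<Omega> f (u t))"
        using Hm1_norm_G_ge[OF ut w N(2)] \<beta>(3) N(1) by linarith
      have "\<bar>E0 \<Omega> f (u t) - E0 \<Omega> f \<psi>\<bar> \<le> D"
        unfolding D_def using low g0 Emax[OF t] A by linarith
      then have "\<bar>E0 \<Omega> f (u t) - E0 \<Omega> f \<psi>\<bar> powr (1 - \<theta>\<^sub>0) \<le> D powr (1 - \<theta>\<^sub>0)"
        using \<theta>0 by (intro powr_mono2) auto
      then have "c * \<bar>E0 \<Omega> f (u t) - E0 \<Omega> f \<psi>\<bar> powr (1 - \<theta>\<^sub>0) \<le> (\<sigma> / 2 / D powr (1 - \<theta>\<^sub>0)) * D powr (1 - \<theta>\<^sub>0)"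
        using c by (intro mult_mono) (auto simp: c_def)
      also have "\<dots> = \<sigma> / 2" using D by simp
      finally show ?thesis using big by linarith
    qed
  qed
  show ?thesis
    using c \<beta>(1) \<theta>0 main by (intro exI[of _ c] exI[of _ 1] exI[of _ \<theta>\<^sub>0] exI[of _ \<beta>] conjI) auto
qed

end
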